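(* Let $\widetilde{E}_1\subset\{0,1,2\}^\omega$ be the set of $\xi$ such that the orbital Schreier graph $\widetilde{\Gamma}_\xi$ of the interlaced adding machines group $\mathcal{I}$ has one end. For almost every $\xi\in\widetilde{E}_1$ (with respect to the uniform measure $\lambda$ on $\{0,1,2\}^\omega$), $$\lim_{n\to\infty}\mathbb{P}_{\mu_n}\big(Mav_{H_n}(\cdot,\xi_n)=M\big)\sim M^{-\frac{2\log 2}{\log 3}},$$ where $\{H_n\}$ is the exhaustion of $(\widetilde{\Gamma}_\xi,\xi)$ with unique dissipative vertex $0^n$ described in the context, and $\sim$ is the criticality relation defined in the context.
   Context: **Group.** $\mathcal{I}$ (the iterated monodromy group of $-z^3/2+3z/2$) is the group of automorphisms of the ternary rooted tree (vertices = finite words over $\{0,1,2\}$) generated by $a,b$ defined recursively by $a(0w)=1w$, $a(1w)=0\,a(w)$, $a(2w)=2w$ and $b(0w)=2w$, $b(2w)=0\,b(w)$, $b(1w)=1w$. $\widetilde{\Gamma}_n$ is the graph with vertex set $\{0,1,2\}^n$ and, for each vertex $w$ and each $s\in\{a,b\}$, one (unoriented) edge between $w$ and $s(w)$ (loops and multiple edges allowed); for $\xi\in\{0,1,2\}^\omega$, $\widetilde{\Gamma}_\xi$ is defined in the same way on the orbit $\mathcal{I}\cdot\xi$, and $\xi_n$ is the prefix of $\xi$ of length $n$. The rooted graphs $(\widetilde\Gamma_n,\xi_n)$ converge locally to $(\widetilde\Gamma_\xi,\xi)$. **Sandpile model.** Let $H$ be a finite connected graph (a loop contributes 2 to the degree)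 with a nonempty set $P$ of dissipative vertices and $V_0=V(H)\setminus P$. A configuration is $\eta:V_0\to\mathbb{N}$; it is stable if $\eta(v)<\deg(v)$ for all $v\in V_0$. Firing $v\in V_0$ with $\eta(v)\ge\deg(v)$ sends one chip along each edge incident to $v$; chips reaching $P$ disappear. Stabilization by finitely many firings always occurs, and the result and number of firings of each vertex are independent of the order. Recurrent configurations are the recurrent states of the Markov chain on stable configurations that adds a chip at a random vertex of $V_0$ (every vertex having positive probability) and stabilizes; equivalently, stable $c$ such that there is no nonempty $U\subset V_0$ with $c(v)<\deg_{H[U]}(v)$ for all $v\in U$. $\mathcal{R}_H$ is the set of recurrent configurations, and $Mav_H(c,v)$, the mass of the avalanche, is the number of distinct vertices fired while stabilizing $c+\delta_v$. $\mu_n$ is the uniform distribution on $\mathcal{R}_{H_n}$. **Subgraphs $H_n$.** $H_n$ is the connected component of $\xi_n$ in $\widetilde\Gamma_n\setminus\{0^n\}$ together with $0^n$, and $0^n$ is its unique dissipative vertex; up to isomorphism (with $\xi_n$ corresponding to $\xi$) the $H_n$ form an exhaustion of $(\widetilde\Gamma_\xi,\xi)$. **The relation $\sim$.** $\lim_{n\to\infty}\mathbb{P}_{\mu_n}(Mav_{H_n}(\cdot,\xi_n)=M)\sim M^{-\delta}$ (criticality with critical exponent $\delta>0$) means: there are constants $C_1,C_2>0$ such that for every $\epsilon>0$ there is $M_\epsilon\ge1$ such that for all $M>M_\epsilon$ $$C_1M^{-\delta-\epsilon}\le\lim_{n\to\infty}\mathbb{P}_{\mu_n}(Mav_{H_n}(\cdot,\xi_n)=M)\le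 C_2M^{-\delta+\epsilon},$$ where only those integers $M$ are considered which can be realized as the mass of an avalanche. *)

theory Defs
  imports
    "HOL-Probability.Probability"
    "HOL-Algebra.Bij"
    "HOL-Algebra.Generated_Groups"
    "Graph_Theory.Digraph_Component"
begin

section \<open>The interlaced adding machines group\<close>

datatype digit = D0 | D1 | D2

lemma UNIV_digit: "(UNIV :: digit set) = {D0, D1, D2}"
  using digit.exhaust by blast

instance digit :: finite
  by standard (simp add: UNIV_digit)

text \<open>Vertices of the ternary rooted tree are digit lists; the boundary is the type of digit
  streams. The generators \<open>a\<close>, \<open>b\<close> are \<open>act GA\<close>, \<open>act GB\<close>.\<close>

datatype gen = GA | GB

fun act :: "gen \<Rightarrow> digit list \<Rightarrow> digit list" where
  "act s [] = []"
| "act GA (D0 # w) = D1 # w"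
| "act GA (D1 # w) = D0 # act GA w"
| "act GA (D2 # w) = D2 # w"
| "act GB (D0 # w) = D2 # w"
| "act GB (D2 # w) = D0 # act GB w"
| "act GB (D1 # w) = D1 # w"

text \<open>\<open>BijGroup UNIV\<close> is the group of all permutations of the set of words; the generated
  subgroup consists of automorphisms of the rooted tree.\<close>

definition interlaced_group :: "(digit list \<Rightarrow> digit list) set" where
  "interlaced_group = generate (BijGroup UNIV) (range act)"

text \<open>The action of a tree automorphism on the boundary: the \<open>n\<close>-th digit of the image is
  read off from the image of the prefix of length \<open>n + 1\<close>.\<close>

definition boundary_act :: "(digit list \<Rightarrow> digit list) \<Rightarrow> digit stream \<Rightarrow> digit stream" where
  "boundary_act g \<xi> = to_stream (\<lambda>n. g (stake (Suc n) \<xi>) ! n)"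

definition boundary_orbit :: "digit stream \<Rightarrow> digit stream set" where
  "boundary_orbit \<xi> = {boundary_act g \<xi> | g. g \<in> interlaced_group}"

definition uniform_boundary_measure :: "digit stream measure" where
  "uniform_boundary_measure = stream_space (measure_pmf (pmf_of_set UNIV))"

lemma length_act [simp]: "length (act s w) = length w"
  by (induction s w rule: act.induct) auto

lemma inj_act: "inj (act s)"
proof (rule injI)
  fix u v :: "digit list"
  assume "act s u = act s v"
  then show "u = v"
  proof (induction s u arbitrary: v rule: act.induct)
    case (1 s)
    then have "length (act s v) = 0" by simp
    then show ?case by simp
  qed (case_tac v; case_tac "hd v"; auto)+
qed

lemma surj_act: "surj (act s)"
proof -
  have "\<exists>u. act s u = v" for v
  proof (induction v)
    case Nil
    show ?case by (rule exI[of _ "[]"]) simp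
  next
    case (Cons d v)
    then obtain u where "act s u = v" by blast
    then show ?case
      by (cases s; cases d)
        (metis act.simps)+
  qed
  then show ?thesis by (metis surjI)
qed

lemma act_in_BijGroup: "act s \<in> carrier (BijGroup UNIV)"
  by (simp add: BijGroup_def Bij_def bij_betw_def inj_act surj_act)

lemma snth_boundary_act: "boundary_act g \<xi> !! n = g (stake (Suc n) \<xi>) ! n"
  by (simp add: boundary_act_def to_stream_def)

lemma boundary_act_gen:
  "boundary_act (act GA) (D0 ## w) = D1 ## w"
  "boundary_act (act GA) (D1 ## w) = D0 ## boundary_act (act GA) w"
  "boundary_act (act GA) (D2 ## w) = D2 ## w"
  "boundary_act (act GB) (D0 ## w) = D2 ## w"
  "boundary_act (act GB) (D2 ## w) = D0 ## boundary_act (act GB) w"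
  "boundary_act (act GB) (D1 ## w) = D1 ## w"
proof -
  have snth_0: "(x ## s) !! 0 = x" for x and s :: "digit stream"
    by simp
  have eq: "s = t" if "s !! 0 = t !! 0" "\<And>n. s !! Suc n = t !! Suc n" for s t :: "digit stream"
    using that by (metis not0_implies_Suc smap_alt stream.map_id)
  have st: "stake (Suc n) (x ## w) = x # stake n w" for n x and w :: "digit stream"
    by simp
  show "boundary_act (act GA) (D0 ## w) = D1 ## w"
    "boundary_act (act GA) (D1 ## w) = D0 ## boundary_act (act GA) w"
    "boundary_act (act GA) (D2 ## w) = D2 ## w"
    "boundary_act (act GB) (D0 ## w) = D2 ## w"
    "boundary_act (act GB) (D2 ## w) = D0 ## boundary_act (act GB) w"
    "boundary_act (act GB) (D1 ## w) = D1 ## w"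
    by (rule eq; simp only: snth_boundary_act st act.simps snth_0 snth_Stream stake_nth nth_Cons_0
        nth_Cons_Suc stream.sel lessI)+
qed


section \<open>Schreier graphs and ends\<close>

text \<open>Unoriented multigraphs with loops are represented by \<^typ>\<open>('a, 'b) pre_digraph\<close>, where
  every edge carries an auxiliary orientation that is ignored: adjacency is that of
  \<^const>\<open>mk_symmetric\<close>, and the degree is the sum of in- and out-degree, so that a loop
  contributes 2. The edge named \<open>(w, s)\<close> joins \<open>w\<close> and \<open>s(w)\<close>.\<close>

definition schreier_level :: "nat \<Rightarrow> (digit list, digit list \<times> gen) pre_digraph" where
  "schreier_level n = \<lparr>verts = {w. length w = n}, arcs = {w. length w = n} \<times> UNIV,
     tail = fst, head = (\<lambda>(w, s). act s w)\<rparr>"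

definition schreier_orbital :: "digit stream \<Rightarrow> (digit stream, digit stream \<times> gen) pre_digraph" where
  "schreier_orbital \<xi> = \<lparr>verts = boundary_orbit \<xi>, arcs = boundary_orbit \<xi> \<times> UNIV,
     tail = fst, head = (\<lambda>(w, s). boundary_act (act s) w)\<rparr>"

text \<open>\<open>u\<close> and \<open>v\<close> lie in the same connected component of \<open>G\<close> with the vertices \<open>F\<close> removed
  (in particular, neither is in \<open>F\<close>).\<close>

definition joined_avoiding :: "('v, 'e) pre_digraph \<Rightarrow> 'v set \<Rightarrow> 'v \<Rightarrow> 'v \<Rightarrow> bool" where
  "joined_avoiding G F u v \<longleftrightarrow>
     reachable (with_proj (mk_symmetric (induce_subgraph G (verts G - F)))) u v"

definition rays :: "('v, 'e) pre_digraph \<Rightarrow> (nat \<Rightarrow> 'v) set" where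
  "rays G = {r. inj r \<and> range r \<subseteq> verts G \<and>
     (\<forall>i. dominates (with_proj (mk_symmetric G)) (r i) (r (Suc i)))}"

text \<open>Two rays are equivalent if, for every finite set of vertices removed, almost all vertices
  of both rays lie in the same connected component.\<close>

definition ray_equiv :: "('v, 'e) pre_digraph \<Rightarrow> ((nat \<Rightarrow> 'v) \<times> (nat \<Rightarrow> 'v)) set" where
  "ray_equiv G = {(r, s). r \<in> rays G \<and> s \<in> rays G \<and>
     (\<forall>F. finite F \<longrightarrow> (\<exists>N. \<forall>i\<ge>N. \<forall>j\<ge>N. joined_avoiding G F (r i) (s j)))}"

definition graph_ends :: "('v, 'e) pre_digraph \<Rightarrow> (nat \<Rightarrow> 'v) set set" where
  "graph_ends G = rays G // ray_equiv G"

definition one_ended_points :: "digit stream set" where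
  "one_ended_points = {\<xi>. card (graph_ends (schreier_orbital \<xi>)) = 1}"


section \<open>The Abelian sandpile model\<close>

text \<open>\<open>P\<close> is always the set of dissipative vertices of the graph \<open>H\<close>.\<close>

definition interior_verts :: "('v, 'e) pre_digraph \<Rightarrow> 'v set \<Rightarrow> 'v set" where
  "interior_verts H P = verts H - P"

definition degree_of :: "('v, 'e) pre_digraph \<Rightarrow> 'v \<Rightarrow> nat" where
  "degree_of H v = in_degree H v + out_degree H v"

text \<open>The number of edges between \<open>v\<close> and \<open>u\<close>; for \<open>u = v\<close> every loop is counted twice, as in
  the degree.\<close>

definition edge_count :: "('v, 'e) pre_digraph \<Rightarrow> 'v \<Rightarrow> 'v \<Rightarrow> nat" where
  "edge_count H v u = card {e \<in> arcs H. tail H e = v \<and> head H e = u}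
                    + card {e \<in> arcs H. tail H e = u \<and> head H e = v}"

text \<open>Configurations are maps on the interior vertices, extended by 0.\<close>

definition configs :: "('v, 'e) pre_digraph \<Rightarrow> 'v set \<Rightarrow> ('v \<Rightarrow> nat) set" where
  "configs H P = {\<eta>. \<forall>v. v \<notin> interior_verts H P \<longrightarrow> \<eta> v = 0}"

definition stable :: "('v, 'e) pre_digraph \<Rightarrow> 'v set \<Rightarrow> ('v \<Rightarrow> nat) \<Rightarrow> bool" where
  "stable H P \<eta> \<longleftrightarrow> (\<forall>v\<in>interior_verts H P. \<eta> v < degree_of H v)"

definition add_chip :: "('v \<Rightarrow> nat) \<Rightarrow> 'v \<Rightarrow> 'v \<Rightarrow> nat" where
  "add_chip \<eta> v = \<eta>(v := \<eta> v + 1)"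

text \<open>A loop at the fired vertex \<open>v\<close> returns its two chips to \<open>v\<close>.\<close>

definition fire :: "('v, 'e) pre_digraph \<Rightarrow> 'v set \<Rightarrow> 'v \<Rightarrow> ('v \<Rightarrow> nat) \<Rightarrow> 'v \<Rightarrow> nat" where
  "fire H P v \<eta> = (\<lambda>u. if u \<in> interior_verts H P
     then (\<eta> u - (if u = v then degree_of H v else 0)) + edge_count H v u else 0)"

inductive firing :: "('v, 'e) pre_digraph \<Rightarrow> 'v set \<Rightarrow> ('v \<Rightarrow> nat) \<Rightarrow> 'v list \<Rightarrow> ('v \<Rightarrow> nat) \<Rightarrow> bool"
  for H P where
  firing_Nil: "firing H P \<eta> [] \<eta>"
| firing_Cons: "\<lbrakk>v \<in> interior_verts H P; degree_of H v \<le> \<eta> v; firing H P (fire H P v \<eta>) vs \<eta>'\<rbrakk>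
    \<Longrightarrow> firing H P \<eta> (v # vs) \<eta>'"

definition stabilizing :: "('v, 'e) pre_digraph \<Rightarrow> 'v set \<Rightarrow> ('v \<Rightarrow> nat) \<Rightarrow> 'v list \<Rightarrow> ('v \<Rightarrow> nat) \<Rightarrow> bool" where
  "stabilizing H P \<eta> vs \<eta>' \<longleftrightarrow> firing H P \<eta> vs \<eta>' \<and> stable H P \<eta>'"

definition stabilization :: "('v, 'e) pre_digraph \<Rightarrow> 'v set \<Rightarrow> ('v \<Rightarrow> nat) \<Rightarrow> 'v \<Rightarrow> nat" where
  "stabilization H P \<eta> = (THE \<eta>'. \<exists>vs. stabilizing H P \<eta> vs \<eta>')"

text \<open>Mass of the avalanche: the number of distinct vertices fired.\<close>

definition avalanche_mass :: "('v, 'e) pre_digraph \<Rightarrow> 'v set \<Rightarrow> ('v \<Rightarrow> nat) \<Rightarrow> 'v \<Rightarrow> nat" where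
  "avalanche_mass H P c v =
     (THE m. \<exists>vs \<eta>'. stabilizing H P (add_chip c v) vs \<eta>' \<and> m = card (set vs))"

text \<open>For a Markov chain with transition kernel \<open>K\<close>, \<open>hit_prob K y n x\<close> is the probability that
  the chain started at \<open>x\<close> visits \<open>y\<close> at one of the times \<open>1, \<dots>, n\<close>. A state is recurrent if
  the chain returns to it with probability 1.\<close>

primrec hit_prob :: "('s \<Rightarrow> 's pmf) \<Rightarrow> 's \<Rightarrow> nat \<Rightarrow> 's \<Rightarrow> real" where
  "hit_prob K y 0 x = 0"
| "hit_prob K y (Suc n) x =
     measure_pmf.expectation (K x) (\<lambda>z. if z = y then 1 else hit_prob K y n z)"

definition recurrent_state :: "('s \<Rightarrow> 's pmf) \<Rightarrow> 's \<Rightarrow> bool" where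
  "recurrent_state K x \<longleftrightarrow> (\<lambda>n. hit_prob K x n x) \<longlonglongrightarrow> 1"

definition sandpile_kernel ::
    "('v, 'e) pre_digraph \<Rightarrow> 'v set \<Rightarrow> 'v pmf \<Rightarrow> ('v \<Rightarrow> nat) \<Rightarrow> ('v \<Rightarrow> nat) pmf" where
  "sandpile_kernel H P p c = map_pmf (\<lambda>v. stabilization H P (add_chip c v)) p"

text \<open>Recurrence does not depend on the choice of the law \<open>p\<close> of the added chip, as long as every
  interior vertex has positive probability.\<close>

definition recurrent_configs :: "('v, 'e) pre_digraph \<Rightarrow> 'v set \<Rightarrow> ('v \<Rightarrow> nat) set" where
  "recurrent_configs H P = {c \<in> configs H P. stable H P c \<and>
     (\<forall>p. set_pmf p = interior_verts H P \<longrightarrow> recurrent_state (sandpile_kernel H P p) c)}"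


section \<open>The exhaustion and the critical exponent\<close>

abbreviation zero_word :: "nat \<Rightarrow> digit list" where
  "zero_word n \<equiv> replicate n D0"

text \<open>In the degenerate case that the prefix is itself \<open>0\<^sup>n\<close>, which for \<open>\<xi> \<noteq> 000\<dots>\<close> occurs only
  for finitely many \<open>n\<close>, the component is empty and the graph is reduced to \<open>0\<^sup>n\<close>.\<close>

definition H_graph :: "digit stream \<Rightarrow> nat \<Rightarrow> (digit list, digit list \<times> gen) pre_digraph" where
  "H_graph \<xi> n = induce_subgraph (schreier_level n)
     ({w. joined_avoiding (schreier_level n) {zero_word n} (stake n \<xi>) w} \<union> {zero_word n})"

abbreviation H_recurrent :: "digit stream \<Rightarrow> nat \<Rightarrow> (digit list \<Rightarrow> nat) set" where
  "H_recurrent \<xi> n \<equiv> recurrent_configs (H_graph \<xi> n) {zero_word n}"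

abbreviation H_mass :: "digit stream \<Rightarrow> nat \<Rightarrow> (digit list \<Rightarrow> nat) \<Rightarrow> nat" where
  "H_mass \<xi> n c \<equiv> avalanche_mass (H_graph \<xi> n) {zero_word n} c (stake n \<xi>)"

definition H_mass_prob :: "digit stream \<Rightarrow> nat \<Rightarrow> nat \<Rightarrow> real" where
  "H_mass_prob \<xi> n M =
     measure_pmf.prob (pmf_of_set (H_recurrent \<xi> n)) {c. H_mass \<xi> n c = M}"

text \<open>The masses that are realized along the exhaustion. As they are compared with a limit in
  \<open>n\<close>, they have to occur for arbitrarily large \<open>n\<close>: a mass occurring only for finitely many
  \<open>n\<close>, in avalanches that reach the dissipative vertex of a small graph, is not the mass of an
  avalanche on the limit graph.\<close>

definition realizable_masses :: "digit stream \<Rightarrow> nat set" where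
  "realizable_masses \<xi> = {M. \<exists>\<^sub>F n in sequentially. \<exists>c\<in>H_recurrent \<xi> n. H_mass \<xi> n c = M}"

definition critical_on :: "nat set \<Rightarrow> (nat \<Rightarrow> real) \<Rightarrow> real \<Rightarrow> bool" where
  "critical_on A f \<delta> \<longleftrightarrow> \<delta> > 0 \<and>
     (\<exists>C1>0. \<exists>C2>0. \<forall>\<epsilon>>0. \<exists>M0\<ge>1. \<forall>M\<in>A. real M > M0 \<longrightarrow>
        C1 * real M powr (- \<delta> - \<epsilon>) \<le> f M \<and> f M \<le> C2 * real M powr (- \<delta> + \<epsilon>))"

end

theory Submission
  imports Defs
begin

text \<open>The graphs are cacti: every word lies on one cycle of \<open>a\<close> and one of \<open>b\<close>,
  whose lengths are powers of 2. A configuration is recurrent iff all values are 2 or 3 and each cycle has,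
  apart from its vertex closest to the root, at most one vertex with value 2; so the position of this gap is
  uniform on a cycle of length \<open>m\<close>, with \<open>m\<close> possible values, and independent for
  different cycles.

  Let the cycles between \<open>\<xi>\<close> and the root have lengths \<open>2\<^bsup>k(1)\<^esup> <
  2\<^bsup>k(2)\<^esup> < \<dots>\<close>. If \<open>r\<close> chips arrive at position \<open>i\<close> of a
  cycle of length \<open>m\<close> with gap \<open>z\<close>, the gap moves to \<open>z - r i\<close> modulo
  \<open>m\<close> and the number of chips passed on to the next cycle changes by at most one, according to the
  disappearance or creation of the gap. The odometer is therefore explicit; it is recognised by the maximum
  principle, since two recurrent configurations that differ by the Laplacian of an integer function are equal.

  The avalanche stops iff a single chip arrives exactly at the gap of some cycle. The mass then determines the
  preceding cycle, up to two choices the gap on it, and it lies between \<open>3\<^bsup>k(q-1)-1\<^esup>\<close>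
  and \<open>3\<^bsup>k(q)\<^esup>\<close>, where \<open>q\<close> is that cycle. Hence its probability is
  comparable with \<open>2\<^bsup>- k(q) - k(q+1)\<^esup>\<close>. For almost every \<open>\<xi>\<close> the
  ratios \<open>k(q+1) / k(q)\<close> tend to 1, by Borel-Cantelli, and the exponent is \<open>2 log 2 / log
  3\<close>.\<close>

section \<open>Recurrent configurations of dissipative sandpiles\<close>

text \<open>The delicate side is the lower bound: besides the gaps prescribed on two cycles, exactly
  one chip has to reach the first of them. A single chip passes a cycle of length \<open>m\<close>
  as a single chip for all but two positions of the gap, and since \<open>m l\<close> is at least
  \<open>2 ^ (l + 1)\<close>, the product of the factors \<open>1 - 2 / m\<close> over later cycles
  stays positive. It has to start from a positive value, and a first cycle of length 2 forbids the
  obvious start: it swallows the chip or turns it into two. So the number of chips is led through 2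
  and back to 1. Upper and lower bound then differ by a constant factor, and the \<epsilon> in the
  exponent comes only from the ratios of successive \<open>k\<close>. Recurrence is given through
  return probabilities, so the burning criterion has to be derived first; there the maximum
  principle yields that adding a chip is injective. In the code cycle \<open>l\<close> has length
  \<open>2 ^ k (Suc l)\<close>, because \<open>k 0\<close> is the first nonzero position of
  \<xi>.\<close>

locale sandpile_graph =
  fixes H :: "('v, 'e) pre_digraph" and P :: "'v set" and rank :: "'v \<Rightarrow> nat"
  assumes finite_interior: "finite (interior_verts H P)"
    and edge_sum_le: "v \<in> interior_verts H P \<Longrightarrow>
      (\<Sum>u\<in>interior_verts H P. edge_count H v u) \<le> degree_of H v"
    and escape: "v \<in> interior_verts H P \<Longrightarrow>
      (\<Sum>u\<in>interior_verts H P. edge_count H v u) < degree_of H v \<or>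
      (\<exists>u\<in>interior_verts H P. rank u < rank v \<and> 0 < edge_count H v u)"
begin

abbreviation V where "V \<equiv> interior_verts H P"
abbreviation dg where "dg \<equiv> degree_of H"
abbreviation ec where "ec \<equiv> edge_count H"

lemma ec_sym: "ec v u = ec u v"
  by (simp add: edge_count_def)

text \<open>The Laplacian with value 0 at the dissipative vertices; firing every \<open>v\<close>
  exactly \<open>f v\<close> times subtracts it. Integer values admit candidates that no legal
  sequence realizes.\<close>

definition lap :: "('v \<Rightarrow> int) \<Rightarrow> 'v \<Rightarrow> int" where
  "lap f u = int (dg u) * f u - (\<Sum>v\<in>V. f v * int (ec v u))"

lemma lap_diff: "lap (\<lambda>v. f v - g v) u = lap f u - lap g u"
  by (simp add: lap_def algebra_simps sum_subtractf)

lemma lap_add: "lap (\<lambda>v. f v + g v) u = lap f u + lap g u"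
  by (simp add: lap_def algebra_simps sum.distrib)

lemma lap_single:
  assumes "w \<in> V"
  shows "lap (\<lambda>v. if v = w then 1 else 0) u = (if u = w then int (dg w) else 0) - int (ec w u)"
proof -
  have "(\<Sum>v\<in>V. (if v = w then 1 else 0) * int (ec v u)) = int (ec w u)"
    using finite_interior assms by (simp add: if_distrib[of "\<lambda>x. x * _"] sum.delta cong: if_cong)
  then show ?thesis by (simp add: lap_def)
qed

lemma lap_cong: "(\<And>v. v \<in> V \<Longrightarrow> f v = g v) \<Longrightarrow> u \<in> V \<Longrightarrow> lap f u = lap g u"
  unfolding lap_def by (metis (no_types, lifting) sum.cong)

lemma fire_int:
  assumes "v \<in> V" "dg v \<le> \<eta> v" "u \<in> V"
  shows "int (fire H P v \<eta> u) = int (\<eta> u) - lap (\<lambda>x. if x = v then 1 else 0) u"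
  using assms by (auto simp: fire_def lap_single of_nat_diff)

lemma firing_subset: "firing H P \<eta> vs \<eta>' \<Longrightarrow> set vs \<subseteq> V"
  by (induction rule: firing.induct) auto

lemma firing_configs: "firing H P \<eta> vs \<eta>' \<Longrightarrow> \<eta> \<in> configs H P \<Longrightarrow> \<eta>' \<in> configs H P"
  by (induction rule: firing.induct) (auto simp: configs_def fire_def)

lemma firing_lap:
  assumes "firing H P \<eta> vs \<eta>'" "u \<in> V"
  shows "int (\<eta>' u) = int (\<eta> u) - lap (\<lambda>v. int (count_list vs v)) u"
  using assms
proof (induction rule: firing.induct)
  case (firing_Nil \<eta>)
  then show ?case by (simp add: lap_def)
next
  case (firing_Cons v \<eta> vs \<eta>')
  have "(\<lambda>x. int (count_list (v # vs) x))
      = (\<lambda>x. (if x = v then 1 else 0) + int (count_list vs x))"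
    by auto
  then show ?case
    using firing_Cons by (simp only: lap_add fire_int)
qed

text \<open>A vertex that can fire cannot have \<open>f v = 0\<close>: its Laplacian would be at
  most 0 and \<open>f\<close> would leave it unstable. So each legal firing can be charged against
  \<open>f\<close>. Two stabilizing sequences bound each other in this way, which makes the result
  independent of the order.\<close>

lemma least_action:
  assumes "firing H P \<eta> vs \<eta>'" "\<And>u. u \<in> V \<Longrightarrow> 0 \<le> f u"
    "\<And>u. u \<in> V \<Longrightarrow> int (\<eta> u) - lap f u < int (dg u)" "u \<in> V"
  shows "int (count_list vs u) \<le> f u"
  using assms
proof (induction arbitrary: f rule: firing.induct)
  case (firing_Nil \<eta>)
  then show ?case by simp
next
  case (firing_Cons v \<eta> vs \<eta>')
  have "0 < f v"
  proof (rule ccontr)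
    assume "\<not> 0 < f v"
    then have "f v = 0"
      using firing_Cons.prems(1)[of v] firing_Cons.hyps(1) by simp
    moreover have "0 \<le> (\<Sum>x\<in>V. f x * int (ec x v))"
      using firing_Cons.prems(1) by (intro sum_nonneg) auto
    ultimately have "lap f v \<le> 0"
      by (simp add: lap_def)
    then show False
      using firing_Cons.prems(2)[of v] firing_Cons.hyps(1,2) by simp
  qed
  define f' where "f' = (\<lambda>x. f x - (if x = v then 1 else 0))"
  have "int (count_list vs u) \<le> f' u"
  proof (rule firing_Cons.IH)
    show "0 \<le> f' w" if "w \<in> V" for w
      using firing_Cons.prems(1)[of w] that \<open>0 < f v\<close> by (auto simp: f'_def)
    show "int (fire H P v \<eta> w) - lap f' w < int (dg w)" if "w \<in> V" for w
      using firing_Cons.prems(2)[of w] that firing_Cons.hyps(1,2)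
      by (simp add: f'_def lap_diff fire_int)
  qed fact
  then show ?case by (auto simp: f'_def split: if_splits)
qed

lemma stabilizing_counts:
  assumes "stabilizing H P \<eta> vs \<eta>1" "stabilizing H P \<eta> ws \<eta>2"
  shows "count_list vs u \<le> count_list ws u"
proof (cases "u \<in> V")
  case True
  have "int (count_list vs u) \<le> int (count_list ws u)"
  proof (rule least_action[of \<eta> vs \<eta>1])
    show "firing H P \<eta> vs \<eta>1" using assms by (simp add: stabilizing_def)
    show "int (\<eta> w) - lap (\<lambda>u. int (count_list ws u)) w < int (dg w)" if "w \<in> V" for w
      using assms(2) that firing_lap[of \<eta> ws \<eta>2 w] by (auto simp: stabilizing_def stable_def)
  qed (use True in auto)
  then show ?thesis by simp
next
  case False
  then have "u \<notin> set vs"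
    using firing_subset assms(1) by (auto simp: stabilizing_def)
  then show ?thesis by (simp add: count_list_0_iff)
qed

lemma stabilizing_unique:
  assumes "stabilizing H P \<eta> vs \<eta>1" "stabilizing H P \<eta> ws \<eta>2" "\<eta> \<in> configs H P"
  shows "\<eta>1 = \<eta>2" "set vs = set ws"
proof -
  have eq: "count_list vs u = count_list ws u" for u
    using assms by (intro antisym stabilizing_counts)
  then show "set vs = set ws"
    by (metis count_list_0_iff subsetI subset_antisym)
  have "\<eta>1 u = \<eta>2 u" for u
  proof (cases "u \<in> V")
    case True
    then show ?thesis
      using assms firing_lap[of \<eta> vs \<eta>1 u] firing_lap[of \<eta> ws \<eta>2 u] eq
      by (simp add: stabilizing_def)
  next
    case False
    have "\<eta>1 \<in> configs H P" "\<eta>2 \<in> configs H P"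
      using assms firing_configs by (auto simp: stabilizing_def)
    then show ?thesis using False by (simp add: configs_def)
  qed
  then show "\<eta>1 = \<eta>2" by auto
qed

text \<open>The weight \<open>B ^ (R + 1) - B ^ (R - rank v)\<close> is strictly superharmonic once \<open>B\<close> exceeds all degrees,
  so each firing decreases the weighted number of chips.\<close>

lemma stabilizing_exists: "\<exists>vs \<eta>'. stabilizing H P \<eta> vs \<eta>'"
proof -
  define B :: int where "B = 2 + (\<Sum>v\<in>V. int (dg v))"
  define R where "R = (\<Sum>v\<in>V. rank v)"
  define W where "W v = B ^ (R + 1) - B ^ (R - rank v)" for v
  have B2: "B \<ge> 2" by (simp add: B_def sum_nonneg)
  have B: "int (dg v) < B" if "v \<in> V" for v
    using finite_interior that member_le_sum[of v V "\<lambda>v. int (dg v)"] by (simp add: B_def)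
  have R: "rank v \<le> R" if "v \<in> V" for v
    using finite_interior that member_le_sum[of v V rank] by (simp add: R_def)
  have W0: "0 \<le> W v" for v
    using B2 power_increasing[of "R - rank v" "R + 1" B] by (simp add: W_def)
  have super: "0 < lap W v" if v: "v \<in> V" for v
  proof -
    have sum_eq: "(\<Sum>u\<in>V. W u * int (ec u v)) = B ^ (R + 1) * (\<Sum>u\<in>V. int (ec v u)) - 
        (\<Sum>u\<in>V. B ^ (R - rank u) * int (ec v u))"
      by (simp add: W_def algebra_simps sum_subtractf sum_distrib_left ec_sym)
    have dB: "int (dg v) * B ^ (R - rank v) < B * B ^ (R - rank v)"
      using B[OF v] B2 by (intro mult_strict_right_mono) auto
    have nonneg: "0 \<le> (\<Sum>u\<in>V. B ^ (R - rank u) * int (ec v u))"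
      using B2 by (intro sum_nonneg) auto
    have le: "(\<Sum>u\<in>V. int (ec v u)) \<le> int (dg v)"
      using edge_sum_le[OF v] by (metis of_nat_mono of_nat_sum)
    have main: "lap W v = B ^ (R + 1) * (int (dg v) - (\<Sum>u\<in>V. int (ec v u))) 
        - int (dg v) * B ^ (R - rank v) + (\<Sum>u\<in>V. B ^ (R - rank u) * int (ec v u))"
      unfolding lap_def sum_eq by (simp add: W_def algebra_simps)
    from escape[OF v] show ?thesis
    proof
      assume "(\<Sum>u\<in>V. ec v u) < dg v"
      then have "(\<Sum>u\<in>V. int (ec v u)) < int (dg v)"
        by (metis of_nat_less_iff of_nat_sum)
      then have "B ^ (R + 1) * 1 \<le> B ^ (R + 1) * (int (dg v) - (\<Sum>u\<in>V. int (ec v u)))"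
        using B2 by (intro mult_left_mono) auto
      moreover have "B * B ^ (R - rank v) \<le> B ^ (R + 1)"
        using B2 by (simp add: power_increasing)
      ultimately show ?thesis using main nonneg dB by linarith
    next
      assume "\<exists>u\<in>V. rank u < rank v \<and> 0 < ec v u"
      then obtain u where u: "u \<in> V" "rank u < rank v" "0 < ec v u" by blast
      have "B * B ^ (R - rank v) \<le> B ^ (R - rank u)"
      proof -
        have "B ^ Suc (R - rank v) \<le> B ^ (R - rank u)"
          using B2 u R[OF v] by (intro power_increasing) auto
        then show ?thesis by simp
      qed
      also have "\<dots> \<le> B ^ (R - rank u) * int (ec v u)"
        using u B2 by simp
      also have "\<dots> \<le> (\<Sum>u\<in>V. B ^ (R - rank u) * int (ec v u))"
        using finite_interior u B2 by (intro member_le_sum) auto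
      finally have "B * B ^ (R - rank v) \<le> (\<Sum>u\<in>V. B ^ (R - rank u) * int (ec v u))" .
      moreover have "0 \<le> B ^ (R + 1) * (int (dg v) - (\<Sum>u\<in>V. int (ec v u)))"
        using B2 le by simp
      ultimately show ?thesis using main dB by linarith
    qed
  qed
  \<comment> \<open>The Laplacian is symmetric, so firing \<open>v\<close> lowers the weighted
    number of chips by exactly \<open>lap W v\<close>, a positive integer.\<close>
  have "\<exists>vs \<eta>'. stabilizing H P \<eta> vs \<eta>'" if "(\<Sum>u\<in>V. W u * int (\<eta> u)) \<le> int N" for N \<eta>
    using that
  proof (induction N arbitrary: \<eta> rule: less_induct)
    case (less N)
    show ?case
    proof (cases "stable H P \<eta>")
      case True
      then show ?thesis using firing_Nil[of H P \<eta>] by (auto simp: stabilizing_def)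
    next
      case False
      then obtain v where v: "v \<in> V" "dg v \<le> \<eta> v"
        by (auto simp: stable_def not_less)
      let ?\<eta> = "fire H P v \<eta>"
      have "(\<Sum>u\<in>V. W u * int (?\<eta> u)) = (\<Sum>u\<in>V. W u * (int (\<eta> u) - lap (\<lambda>x. if x = v then 1 else 0) u))"
        using v by (intro sum.cong refl) (simp add: fire_int)
      also have "\<dots> = (\<Sum>u\<in>V. W u * int (\<eta> u)) - (\<Sum>u\<in>V. W u * (if u = v then int (dg v) else 0))
          + (\<Sum>u\<in>V. W u * int (ec u v))"
        using v by (simp add: lap_single algebra_simps sum_subtractf sum.distrib ec_sym)
      also have "(\<Sum>u\<in>V. W u * (if u = v then int (dg v) else 0)) = W v * int (dg v)"
        using finite_interior v by (simp add: if_distrib[of "\<lambda>x. _ * x"] sum.delta cong: if_cong)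
      finally have "(\<Sum>u\<in>V. W u * int (?\<eta> u)) = (\<Sum>u\<in>V. W u * int (\<eta> u)) - lap W v"
        by (simp add: lap_def algebra_simps)
      then have *: "(\<Sum>u\<in>V. W u * int (?\<eta> u)) < int N"
        using super[OF v(1)] less.prems by linarith
      moreover have "0 \<le> (\<Sum>u\<in>V. W u * int (?\<eta> u))"
        using W0 by (intro sum_nonneg) auto
      ultimately obtain N' where "(\<Sum>u\<in>V. W u * int (?\<eta> u)) = int N'" "N' < N"
        using nonneg_int_cases[of "\<Sum>u\<in>V. W u * int (?\<eta> u)"] by fastforce
      then obtain vs \<eta>' where "stabilizing H P ?\<eta> vs \<eta>'"
        using less.IH[of N' ?\<eta>] by auto
      then show ?thesis
        using v firing_Cons[of v H P \<eta> vs \<eta>'] unfolding stabilizing_def by blast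
    qed
  qed
  moreover have "0 \<le> (\<Sum>u\<in>V. W u * int (\<eta> u))"
    using W0 by (intro sum_nonneg) auto
  then obtain N where "(\<Sum>u\<in>V. W u * int (\<eta> u)) = int N"
    using nonneg_int_cases by blast
  ultimately show ?thesis by (metis order_refl)
qed

lemma stabilization_eq:
  assumes "stabilizing H P \<eta> vs \<eta>'" "\<eta> \<in> configs H P"
  shows "stabilization H P \<eta> = \<eta>'"
  unfolding stabilization_def using assms stabilizing_unique by (intro the_equality) blast+

text \<open>Dhar's burning criterion. The sum over \<open>U\<close> includes \<open>v\<close>
  itself, so that loops count twice, as in the degree.\<close>

definition forbidden_free :: "('v \<Rightarrow> nat) \<Rightarrow> bool" where
  "forbidden_free c \<longleftrightarrow> (\<forall>U\<subseteq>V. U \<noteq> {} \<longrightarrow> (\<exists>v\<in>U. (\<Sum>u\<in>U. ec v u) \<le> c v))"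

definition burnable :: "('v \<Rightarrow> nat) set" where
  "burnable = {c \<in> configs H P. stable H P c \<and> forbidden_free c}"

text \<open>On the set \<open>U\<close> where \<open>h\<close> is maximal some vertex
  \<open>w\<close> holds at least its degree inside \<open>U\<close>. As \<open>h\<close> is
  integral, it drops by at least 1 outside \<open>U\<close>, so \<open>lap h w\<close> is at least
  \<open>dg w - c w\<close> as soon as the maximum is positive.\<close>

lemma max_principle:
  assumes "forbidden_free c" "\<And>v. v \<in> V \<Longrightarrow> int (c v) + lap h v < int (dg v)" "v \<in> V"
  shows "h v \<le> 0"
proof (rule ccontr)
  assume neg: "\<not> h v \<le> 0"
  define m where "m = Max (h ` V)"
  define U where "U = {u \<in> V. h u = m}"
  have fin: "finite V" "V \<noteq> {}" using finite_interior assms(3) by auto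
  have le: "h u \<le> m" if "u \<in> V" for u using fin that by (simp add: m_def)
  have m: "0 < m" using le[OF assms(3)] neg by simp
  have "m \<in> h ` V" unfolding m_def using fin by (intro Max_in) auto
  then have U: "U \<noteq> {}" "U \<subseteq> V" by (auto simp: U_def)
  then obtain w where w: "w \<in> U" "(\<Sum>u\<in>U. ec w u) \<le> c w"
    using assms(1) unfolding forbidden_free_def by blast
  have wV: "w \<in> V" "h w = m" using w U_def by auto
  have "(\<Sum>u\<in>V. h u * int (ec u w)) \<le> (\<Sum>u\<in>V. (m - 1) * int (ec w u) + (if u \<in> U then int (ec w u) else 0))"
  proof (rule sum_mono)
    fix u assume u: "u \<in> V"
    show "h u * int (ec u w) \<le> (m - 1) * int (ec w u) + (if u \<in> U then int (ec w u) else 0)"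
    proof (cases "u \<in> U")
      case True
      then show ?thesis by (simp add: U_def algebra_simps ec_sym)
    next
      case False
      then have "h u \<le> m - 1" using le[OF u] u by (auto simp: U_def)
      then show ?thesis using False mult_right_mono[of "h u" "m - 1" "int (ec w u)"] by (simp add: ec_sym)
    qed
  qed
  also have "\<dots> = (m - 1) * (\<Sum>u\<in>V. int (ec w u)) + (\<Sum>u\<in>U. int (ec w u))"
    using U(2) fin by (simp add: sum.distrib sum_distrib_left sum.inter_restrict[symmetric] Int_absorb1)
  also have "\<dots> \<le> (m - 1) * int (dg w) + int (c w)"
  proof (intro add_mono mult_left_mono)
    show "(\<Sum>u\<in>V. int (ec w u)) \<le> int (dg w)"
      using edge_sum_le[OF wV(1)] by (metis of_nat_mono of_nat_sum)
    show "(\<Sum>u\<in>U. int (ec w u)) \<le> int (c w)"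
      using w(2) by (metis of_nat_mono of_nat_sum)
  qed (use m in auto)
  finally have "int (dg w) \<le> int (c w) + lap h w"
    using wV(2) by (simp add: lap_def algebra_simps)
  then show False using assms(2)[OF wV(1)] by simp
qed

lemma forbidden_free_mono:
  assumes "forbidden_free c" "\<And>v. c v \<le> c' v"
  shows "forbidden_free c'"
  using assms unfolding forbidden_free_def by (meson order_trans)

text \<open>Away from \<open>v\<close> firing only adds chips. If \<open>U\<close> contains
  \<open>v\<close> and more, a good vertex of \<open>U - {v}\<close> receives exactly as many chips
  as it has edges to \<open>v\<close>; for \<open>U = {v}\<close> the loops return theirs.\<close>

lemma forbidden_free_fire:
  assumes "forbidden_free c" "v \<in> V" "dg v \<le> c v"
  shows "forbidden_free (fire H P v c)"
  unfolding forbidden_free_def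
proof (intro allI impI, rule ccontr)
  fix U assume U: "U \<subseteq> V" "U \<noteq> {}" "\<not> (\<exists>w\<in>U. (\<Sum>u\<in>U. ec w u) \<le> fire H P v c w)"
  then have less: "fire H P v c w < (\<Sum>u\<in>U. ec w u)" if "w \<in> U" for w
    using that by (meson not_le)
  have finU: "finite U" using U finite_interior finite_subset by blast
  show False
  proof (cases "v \<in> U")
    case False
    obtain w where "w \<in> U" "(\<Sum>u\<in>U. ec w u) \<le> c w"
      using assms(1) U unfolding forbidden_free_def by blast
    moreover have "c w \<le> fire H P v c w"
      using False \<open>w \<in> U\<close> U(1) by (auto simp: fire_def)
    ultimately show False using less[of w] by simp
  next
    case True
    show False
    proof (cases "U = {v}")
      case True
      then show False using less[of v] assms(2) by (simp add: fire_def)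
    next
      case False
      then have "U - {v} \<noteq> {}" using True by blast
      then obtain w where w: "w \<in> U" "w \<noteq> v" "(\<Sum>u\<in>U - {v}. ec w u) \<le> c w"
        using assms(1) U unfolding forbidden_free_def by (metis Diff_iff Diff_subset insertI1 order_trans)
      have "fire H P v c w = c w + ec v w"
        using w U(1) by (auto simp: fire_def)
      moreover have "(\<Sum>u\<in>U. ec w u) = (\<Sum>u\<in>U - {v}. ec w u) + ec v w"
        using True finU by (simp add: sum.remove[of U v] ec_sym)
      ultimately show False using less[OF w(1)] w(3) by simp
    qed
  qed
qed

lemma forbidden_free_firing:
  "firing H P \<eta> vs \<eta>' \<Longrightarrow> forbidden_free \<eta> \<Longrightarrow> forbidden_free \<eta>'"
  by (induction rule: firing.induct) (auto intro: forbidden_free_fire)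

lemma add_chip_configs: "c \<in> configs H P \<Longrightarrow> v \<in> V \<Longrightarrow> add_chip c v \<in> configs H P"
  by (auto simp: configs_def add_chip_def)

definition drop_chip :: "'v \<Rightarrow> ('v \<Rightarrow> nat) \<Rightarrow> 'v \<Rightarrow> nat" where
  "drop_chip v c = stabilization H P (add_chip c v)"

lemma burnable_stabilizing:
  assumes "c \<in> burnable" "v \<in> V"
  obtains vs where "stabilizing H P (add_chip c v) vs (drop_chip v c)" "drop_chip v c \<in> burnable"
proof -
  obtain vs \<eta>' where vs: "stabilizing H P (add_chip c v) vs \<eta>'"
    using stabilizing_exists by blast
  have conf: "add_chip c v \<in> configs H P"
    using assms add_chip_configs by (simp add: burnable_def)
  have "forbidden_free (add_chip c v)"
    using assms(1) by (rule_tac forbidden_free_mono[of c]) (auto simp: burnable_def add_chip_def)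
  then have "forbidden_free \<eta>'"
    using vs forbidden_free_firing by (auto simp: stabilizing_def)
  then have "\<eta>' \<in> burnable"
    using vs conf firing_configs by (auto simp: burnable_def stabilizing_def)
  moreover have "drop_chip v c = \<eta>'"
    unfolding drop_chip_def by (rule stabilization_eq[OF vs conf])
  ultimately show thesis using that vs by simp
qed

text \<open>The maximum principle, applied to the difference in both directions, leaves no choice
  for the odometer. The candidate \<open>f\<close> need not come from a legal sequence: an explicit
  guess only has to satisfy the Laplace equation with a burnable result.\<close>

lemma odometer_unique:
  assumes "stabilizing H P \<eta> vs \<eta>'" "\<eta>' \<in> burnable" "c' \<in> burnable"
    "\<And>u. u \<in> V \<Longrightarrow> int (c' u) = int (\<eta> u) - lap f u" "u \<in> V"
  shows "int (count_list vs u) = f u"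
proof -
  let ?g = "\<lambda>u. int (count_list vs u)"
  have \<eta>': "int (\<eta>' u) = int (\<eta> u) - lap ?g u" if "u \<in> V" for u
    using assms(1) firing_lap that by (auto simp: stabilizing_def)
  have lt: "int (c' w) < int (dg w)" "int (\<eta>' w) < int (dg w)" if "w \<in> V" for w
    using assms(2,3) that by (auto simp: burnable_def stable_def)
  have "?g u - f u \<le> 0"
    using assms(2-5) \<eta>' lt
    by (intro max_principle[where c = \<eta>' and h = "\<lambda>u. ?g u - f u"])
      (auto simp: burnable_def lap_diff)
  moreover have "f u - ?g u \<le> 0"
    using assms(2-5) \<eta>' lt
    by (intro max_principle[where c = c' and h = "\<lambda>u. f u - ?g u"])
      (auto simp: burnable_def lap_diff)
  ultimately show ?thesis by simp
qed

lemma avalanche_mass_eq: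
  assumes "c \<in> burnable" "v \<in> V" "c' \<in> burnable"
    "\<And>u. u \<in> V \<Longrightarrow> int (c' u) = int (add_chip c v u) - lap f u"
  shows "avalanche_mass H P c v = card {u \<in> V. 0 < f u}"
proof -
  obtain vs where vs: "stabilizing H P (add_chip c v) vs (drop_chip v c)" "drop_chip v c \<in> burnable"
    using burnable_stabilizing assms by blast
  have "set vs = {u \<in> V. 0 < f u}"
  proof -
    have "u \<in> set vs \<longleftrightarrow> 0 < f u" if "u \<in> V" for u
    proof -
      have "0 < f u \<longleftrightarrow> count_list vs u \<noteq> 0"
        using odometer_unique[OF vs assms(3,4) that] by linarith
      then show ?thesis by (simp add: count_list_0_iff)
    qed
    then show ?thesis
      using vs(1) firing_subset unfolding stabilizing_def by blast
  qed
  moreover have "add_chip c v \<in> configs H P"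
    using assms add_chip_configs by (auto simp: burnable_def)
  ultimately have "set ws = {u \<in> V. 0 < f u}" if "stabilizing H P (add_chip c v) ws \<eta>'" for ws \<eta>'
    using stabilizing_unique(2)[OF that vs(1)] by simp
  with vs(1) show ?thesis
    unfolding avalanche_mass_def by (intro the_equality) metis+
qed

text \<open>Two preimages differ by the Laplacian of the difference of their odometers, which the
  maximum principle forces to vanish. On the finite set \<open>burnable\<close> this makes adding a
  chip a permutation, which repetition can undo.\<close>

lemma inj_on_drop_chip:
  assumes "v \<in> V"
  shows "inj_on (drop_chip v) burnable"
proof (rule inj_onI)
  fix c1 c2 assume c: "c1 \<in> burnable" "c2 \<in> burnable" "drop_chip v c1 = drop_chip v c2"
  obtain vs where vs: "stabilizing H P (add_chip c1 v) vs (drop_chip v c1)"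
    using burnable_stabilizing[OF c(1) assms] by blast
  obtain ws where ws: "stabilizing H P (add_chip c2 v) ws (drop_chip v c2)"
    using burnable_stabilizing[OF c(2) assms] by blast
  let ?h = "\<lambda>u. int (count_list vs u) - int (count_list ws u)"
  have eq: "int (c1 u) = int (c2 u) + lap ?h u" if "u \<in> V" for u
    using firing_lap[of "add_chip c1 v" vs "drop_chip v c1" u] firing_lap[of "add_chip c2 v" ws "drop_chip v c2" u]
      vs ws that c(3)
    by (auto simp: stabilizing_def lap_diff add_chip_def split: if_splits)
  have lt: "int (c1 w) < int (dg w)" "int (c2 w) < int (dg w)" if "w \<in> V" for w
    using c(1,2) that by (auto simp: burnable_def stable_def)
  have "?h u \<le> 0" if "u \<in> V" for u
    by (rule max_principle[where c = c2 and h = ?h])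
      (use c(1,2) eq[symmetric] lt that in \<open>auto simp: burnable_def\<close>)
  moreover have "- ?h u \<le> 0" if "u \<in> V" for u
  proof -
    have "lap (\<lambda>u. - ?h u) w = - lap ?h w" for w
      using lap_diff[of "\<lambda>u. int (count_list vs u)" "\<lambda>u. int (count_list ws u)" w]
        lap_diff[of "\<lambda>u. int (count_list ws u)" "\<lambda>u. int (count_list vs u)" w] by simp
    moreover have "int (c1 w) + - lap ?h w < int (dg w)" if "w \<in> V" for w
      using eq[OF that] lt[OF that] by simp
    ultimately show ?thesis using c(1) that
      by (intro max_principle[where c = c1 and h = "\<lambda>u. - ?h u"]) (auto simp: burnable_def)
  qed
  ultimately have h0: "?h u = 0" if "u \<in> V" for u
    using that by fastforce
  have "c1 u = c2 u" if "u \<in> V" for u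
  proof -
    have "lap ?h u = lap (\<lambda>_. 0) u"
      by (rule lap_cong[OF h0 that])
    then show ?thesis using eq[OF that] by (simp add: lap_def)
  qed
  moreover have "c1 u = c2 u" if "u \<notin> V" for u
    using c(1,2) that by (simp add: burnable_def configs_def)
  ultimately show "c1 = c2" by blast
qed

lemma finite_burnable: "finite burnable"
proof (rule finite_subset)
  let ?F = "{c. \<forall>v. (v \<in> V \<longrightarrow> c v \<in> (\<Union>v\<in>V. {..<dg v})) \<and> (v \<notin> V \<longrightarrow> c v = 0)}"
  show "burnable \<subseteq> ?F"
    by (auto simp: burnable_def configs_def stable_def)
  show "finite ?F"
    by (rule finite_set_of_finite_funs) (use finite_interior in auto)
qed

end

section \<open>Return probabilities of Markov chains with finitely supported kernels\<close>

lemma expectation_mono_finite: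
  fixes f g :: "'a \<Rightarrow> real"
  assumes "finite (set_pmf p)" "\<And>x. x \<in> set_pmf p \<Longrightarrow> f x \<le> g x"
  shows "measure_pmf.expectation p f \<le> measure_pmf.expectation p g"
  using assms by (intro integral_mono_AE integrable_measure_pmf_finite) (auto intro: AE_pmfI)

lemma expectation_cong_pmf:
  fixes f g :: "'a \<Rightarrow> real"
  assumes "\<And>x. x \<in> set_pmf p \<Longrightarrow> f x = g x"
  shows "measure_pmf.expectation p f = measure_pmf.expectation p g"
  using assms by (intro integral_cong_AE) (auto intro: AE_pmfI)

locale finite_kernel =
  fixes K :: "'s \<Rightarrow> 's pmf"
  assumes finite_support: "finite (set_pmf (K x))"
begin

lemma hit_prob_bounds: "0 \<le> hit_prob K y n x \<and> hit_prob K y n x \<le> 1"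
proof (induction n arbitrary: x)
  case (Suc n)
  have "measure_pmf.expectation (K x) (\<lambda>z. if z = y then 1 else hit_prob K y n z)
      \<le> measure_pmf.expectation (K x) (\<lambda>_. 1)"
    using Suc by (intro expectation_mono_finite finite_support) auto
  moreover have "measure_pmf.expectation (K x) (\<lambda>_. 0)
      \<le> measure_pmf.expectation (K x) (\<lambda>z. if z = y then 1 else hit_prob K y n z)"
    using Suc by (intro expectation_mono_finite finite_support) auto
  ultimately show ?case by simp
qed simp

lemma hit_prob_closed:
  assumes "\<And>x. x \<in> S \<Longrightarrow> set_pmf (K x) \<subseteq> S" "y \<notin> S" "x \<in> S"
  shows "hit_prob K y n x = 0"
  using assms(3)
proof (induction n arbitrary: x)
  case (Suc n)
  have "measure_pmf.expectation (K x) (\<lambda>z. if z = y then 1 else hit_prob K y n z)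
      = measure_pmf.expectation (K x) (\<lambda>z. 0)"
    using Suc assms by (intro expectation_cong_pmf) auto
  then show ?case by simp
qed simp

text \<open>Positive probability of never visiting \<open>y\<close>, stated through finite horizons
  because recurrence is a limit of these.\<close>

definition escapes :: "'s \<Rightarrow> 's \<Rightarrow> bool" where
  "escapes y x \<longleftrightarrow> (\<exists>\<delta>>0. \<forall>n. hit_prob K y n x \<le> 1 - \<delta>)"

lemma escapes_not_recurrent: "escapes y y \<Longrightarrow> \<not> recurrent_state K y"
proof
  assume "escapes y y" "recurrent_state K y"
  then obtain \<delta> where \<delta>: "\<delta> > 0" "\<And>n. hit_prob K y n y \<le> 1 - \<delta>"
    and lim: "(\<lambda>n. hit_prob K y n y) \<longlonglongrightarrow> 1"
    by (auto simp: escapes_def recurrent_state_def)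
  have "1 \<le> 1 - \<delta>"
    using lim \<delta>(2) by (intro LIMSEQ_le_const2) auto
  then show False using \<delta>(1) by simp
qed

text \<open>The deficit at \<open>z\<close>, multiplied by the probability of moving there, is a
  deficit at \<open>x\<close>; the condition \<open>z \<noteq> y\<close> is needed because the step
  itself could be a hit.\<close>

lemma escapes_step:
  assumes "escapes y z" "z \<in> set_pmf (K x)" "z \<noteq> y"
  shows "escapes y x"
proof -
  obtain \<delta> where \<delta>: "\<delta> > 0" "\<And>n. hit_prob K y n z \<le> 1 - \<delta>"
    using assms(1) by (auto simp: escapes_def)
  define \<epsilon> where "\<epsilon> = \<delta> * pmf (K x) z"
  have pos: "\<epsilon> > 0" using \<delta> assms(2) by (simp add: \<epsilon>_def pmf_positive)
  have "hit_prob K y n x \<le> 1 - \<epsilon>" for n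
  proof (cases n)
    case 0
    have "\<delta> \<le> 1" using \<delta>(2)[of 0] by simp
    then have "\<epsilon> \<le> 1" using \<delta>(1) by (simp add: \<epsilon>_def mult_le_one pmf_le_1)
    then show ?thesis using 0 by simp
  next
    case (Suc m)
    have "hit_prob K y n x \<le> measure_pmf.expectation (K x) (\<lambda>u. 1 - \<delta> * indicator {z} u)"
      unfolding Suc hit_prob.simps using \<delta> assms(3) hit_prob_bounds
      by (intro expectation_mono_finite finite_support) (auto simp: indicator_def)
    also have "\<dots> = 1 - \<delta> * measure_pmf.expectation (K x) (indicator {z})"
      using finite_support by (subst Bochner_Integration.integral_diff)
        (auto intro: integrable_measure_pmf_finite)
    also have "\<dots> = 1 - \<epsilon>"
      by (simp add: \<epsilon>_def measure_pmf_single)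
    finally show ?thesis .
  qed
  then show ?thesis using pos by (auto simp: escapes_def)
qed

lemma hit_prob_mono: "n \<le> m \<Longrightarrow> hit_prob K y n x \<le> hit_prob K y m x"
proof (induction n arbitrary: x m)
  case (Suc n)
  then obtain m' where m': "m = Suc m'" "n \<le> m'" by (metis Suc_le_D Suc_le_mono)
  show ?case unfolding m'(1) hit_prob.simps
    using Suc.IH[OF m'(2)] by (intro expectation_mono_finite finite_support) auto
qed (simp add: hit_prob_bounds)

lemma hit_prob_reachable:
  assumes "(\<lambda>a b. b \<in> set_pmf (K a))\<^sup>+\<^sup>+ x y"
  shows "\<exists>n. 0 < hit_prob K y n x"
proof -
  have extend: "0 < hit_prob K y (Suc n) x" 
    if "z \<in> set_pmf (K x)" "z = y \<or> 0 < hit_prob K y n z" for x z n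
  proof -
    have "0 < (if z = y then 1 else hit_prob K y n z) * pmf (K x) z"
      using that by (auto simp: pmf_positive)
    also have "\<dots> \<le> (\<Sum>a\<in>set_pmf (K x). (if a = y then 1 else hit_prob K y n a) * pmf (K x) a)"
      using that finite_support hit_prob_bounds
      by (intro member_le_sum) (auto intro!: mult_nonneg_nonneg)
    also have "\<dots> = hit_prob K y (Suc n) x"
      using finite_support by (simp add: integral_measure_pmf_real[where A = "set_pmf (K x)"])
    finally show ?thesis .
  qed
  show ?thesis using assms
  proof (induction rule: converse_tranclp_induct)
    case (base x)
    then show ?case using extend[of y x 0] by blast
  next
    case (step x z)
    then obtain n where "0 < hit_prob K y n z" by blast
    then show ?case using step(1) extend by blast
  qed
qed

text \<open>In a finite closed set from which \<open>y\<close> is always reachable there are a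
  horizon \<open>N\<close> and a \<delta> > 0 such that every start hits \<open>y\<close> within
  \<open>N\<close> steps with probability at least \<delta>. Misses over blocks of length
  \<open>N\<close> then decay geometrically.\<close>

lemma recurrent_if_reachable:
  assumes "finite S" "\<And>x. x \<in> S \<Longrightarrow> set_pmf (K x) \<subseteq> S" "y \<in> S"
    "\<And>x. x \<in> S \<Longrightarrow> (\<lambda>a b. b \<in> set_pmf (K a))\<^sup>+\<^sup>+ x y"
  shows "recurrent_state K y"
proof -
  have "\<exists>n. 0 < hit_prob K y n x" if "x \<in> S" for x
    using hit_prob_reachable assms(4) that by blast
  then obtain n where n: "\<And>x. x \<in> S \<Longrightarrow> 0 < hit_prob K y (n x) x" by metis
  define N where "N = (\<Sum>x\<in>S. n x)"
  define \<delta> where "\<delta> = Min (hit_prob K y N ` S)"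
  have le_N: "n x \<le> N" if "x \<in> S" for x
    using that assms(1) member_le_sum[of x S n] by (simp add: N_def)
  have hN: "0 < hit_prob K y N x" if "x \<in> S" for x
    using n[OF that] hit_prob_mono[OF le_N[OF that]] less_le_trans by blast
  have \<delta>: "0 < \<delta>" using hN assms(1,3) by (subst \<delta>_def, subst Min_gr_iff) auto
  have \<delta>_le: "\<delta> \<le> hit_prob K y N x" if "x \<in> S" for x
    using assms(1) that by (simp add: \<delta>_def)
  have \<delta>1: "\<delta> \<le> 1" using \<delta>_le[OF assms(3)] hit_prob_bounds[of y N y] by simp
  have miss: "1 - hit_prob K y (Suc k) x
      = measure_pmf.expectation (K x) (\<lambda>z. if z = y then 0 else 1 - hit_prob K y k z)" for k x
  proof -
    have "1 - hit_prob K y (Suc k) x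
        = measure_pmf.expectation (K x) (\<lambda>z. 1 - (if z = y then 1 else hit_prob K y k z))"
      using finite_support by (subst Bochner_Integration.integral_diff)
        (auto intro: integrable_measure_pmf_finite)
    also have "\<dots> = measure_pmf.expectation (K x) (\<lambda>z. if z = y then 0 else 1 - hit_prob K y k z)"
      by (intro expectation_cong_pmf) auto
    finally show ?thesis .
  qed
  \<comment> \<open>Markov property: after \<open>k\<close> misses the chain is still in
    \<open>S\<close>, so \<open>m\<close> further misses cost a factor of at most
    \<open>Q\<close>.\<close>
  have comp: "1 - hit_prob K y (k + m) x \<le> Q * (1 - hit_prob K y k x)"
    if "\<And>z. z \<in> S \<Longrightarrow> 1 - hit_prob K y m z \<le> Q" "x \<in> S" for k m Q x
    using that(2)
  proof (induction k arbitrary: x)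
    case 0
    then show ?case using that by simp
  next
    case (Suc k)
    have "1 - hit_prob K y (Suc k + m) x
        = measure_pmf.expectation (K x) (\<lambda>z. if z = y then 0 else 1 - hit_prob K y (k + m) z)"
      using miss[of "k + m" x] by simp
    also have "\<dots> \<le> measure_pmf.expectation (K x) (\<lambda>z. Q * (if z = y then 0 else 1 - hit_prob K y k z))"
      using Suc assms(2)[OF Suc.prems] by (intro expectation_mono_finite finite_support) auto
    also have "\<dots> = Q * (1 - hit_prob K y (Suc k) x)"
      using miss[of k x] by simp
    finally show ?case .
  qed
  have pow: "1 - hit_prob K y (N * k) x \<le> (1 - \<delta>) ^ k" if "x \<in> S" for k x
    using that
  proof (induction k arbitrary: x)
    case (Suc k)
    have "1 - hit_prob K y (N + N * k) x \<le> (1 - \<delta>) ^ k * (1 - hit_prob K y N x)"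
      using Suc by (intro comp) auto
    also have "\<dots> \<le> (1 - \<delta>) ^ k * (1 - \<delta>)"
      using \<delta>_le[OF Suc.prems] \<delta>1 by (intro mult_left_mono) auto
    finally show ?case by (simp add: algebra_simps)
  qed simp
  have "(\<lambda>k. (1 - \<delta>) ^ k) \<longlonglongrightarrow> 0"
    using \<delta> \<delta>1 by (intro LIMSEQ_realpow_zero) auto
  show ?thesis unfolding recurrent_state_def
  proof (rule LIMSEQ_I)
    fix r :: real assume "0 < r"
    then obtain k where k: "(1 - \<delta>) ^ k < r"
      using \<open>(\<lambda>k. (1 - \<delta>) ^ k) \<longlonglongrightarrow> 0\<close> \<delta>1
      by (auto simp: LIMSEQ_iff abs_if not_less split: if_splits)
    have "norm (hit_prob K y m y - 1) < r" if "N * k \<le> m" for m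
      using hit_prob_mono[OF that, of y y] pow[OF assms(3), of k] k hit_prob_bounds[of y m y] by simp
    then show "\<exists>no. \<forall>m\<ge>no. norm (hit_prob K y m y - 1) < r" by blast
  qed
qed

end

section \<open>The recurrent states are the burnable configurations\<close>

context sandpile_graph
begin

lemma add_chip_stable:
  assumes "c \<in> configs H P" "stable H P c" "v \<in> V" "Suc (c v) < dg v"
  shows "drop_chip v c = add_chip c v"
proof -
  have "stable H P (add_chip c v)" using assms by (auto simp: stable_def add_chip_def)
  then have "stabilizing H P (add_chip c v) [] (add_chip c v)"
    by (simp add: stabilizing_def firing_Nil)
  then show ?thesis
    unfolding drop_chip_def using assms add_chip_configs by (intro stabilization_eq) auto
qed

text \<open>A vertex of least rank in \<open>U\<close> has an edge leaving \<open>U\<close>, to a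
  vertex of lower rank or out of \<open>V\<close>, so its degree in \<open>U\<close> is below
  \<open>dg\<close>.\<close>

lemma max_stable_burnable: "(\<lambda>v. if v \<in> V then dg v - 1 else 0) \<in> burnable"
proof -
  have pos: "0 < dg v" if "v \<in> V" for v
  proof -
    have "ec v u \<le> dg v" if "u \<in> V" for u
      using edge_sum_le[OF \<open>v \<in> V\<close>] member_le_sum[of u V "ec v"] that finite_interior by simp
    then show ?thesis using escape[OF that] by force
  qed
  have "\<exists>v\<in>U. (\<Sum>u\<in>U. ec v u) \<le> dg v - 1" if U: "U \<subseteq> V" "U \<noteq> {}" for U
  proof -
    have fU: "finite U" using U finite_interior finite_subset by blast
    obtain v where v: "v \<in> U" "\<And>u. u \<in> U \<Longrightarrow> rank v \<le> rank u"
      using ex_min_if_finite[of "rank ` U"] U(2) fU by (force simp: not_less)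
    have vV: "v \<in> V" using v U by blast
    have "(\<Sum>u\<in>U. ec v u) < dg v"
      using escape[OF vV]
    proof
      assume "(\<Sum>u\<in>V. ec v u) < dg v"
      then show ?thesis using sum_mono2[OF finite_interior U(1), of "ec v"] by simp
    next
      assume "\<exists>u\<in>V. rank u < rank v \<and> 0 < ec v u"
      then obtain u where u: "u \<in> V" "u \<notin> U" "0 < ec v u" using v(2) by (meson not_less)
      have "(\<Sum>u\<in>U. ec v u) < (\<Sum>u\<in>V. ec v u)"
        using u finite_interior U(1) by (intro sum_strict_mono2[of V U u]) auto
      then show ?thesis using edge_sum_le[OF vV] by simp
    qed
    then show ?thesis using v(1) by force
  qed
  then have "forbidden_free (\<lambda>v. if v \<in> V then dg v - 1 else 0)"
    unfolding forbidden_free_def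
  proof (intro allI impI)
    fix U assume U: "U \<subseteq> V" "U \<noteq> {}"
    then obtain v where "v \<in> U" "(\<Sum>u\<in>U. ec v u) \<le> dg v - 1"
      using \<open>\<And>U. U \<subseteq> V \<Longrightarrow> U \<noteq> {} \<Longrightarrow> \<exists>v\<in>U. (\<Sum>u\<in>U. ec v u) \<le> dg v - 1\<close> by blast
    then show "\<exists>v\<in>U. (\<Sum>u\<in>U. ec v u) \<le> (if v \<in> V then dg v - 1 else 0)"
      using U(1) by (intro bexI[of _ v]) auto
  qed
  then show ?thesis
    unfolding burnable_def using pos by (auto simp: configs_def stable_def)
qed

lemma drop_chip_burnable: "c \<in> burnable \<Longrightarrow> v \<in> V \<Longrightarrow> drop_chip v c \<in> burnable"
  using burnable_stabilizing by blast

lemma set_sandpile_kernel: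
  "set_pmf p = V \<Longrightarrow> set_pmf (sandpile_kernel H P p c) = (\<lambda>v. drop_chip v c) ` V"
  by (simp add: sandpile_kernel_def drop_chip_def)

text \<open>Adding chips at \<open>v\<close> permutes \<open>burnable\<close>, so enough repetitions
  undo one addition and reachability is symmetric. The states reachable from \<open>c\<close> form a
  finite closed set, and each of them leads back to \<open>c\<close>.\<close>

lemma burnable_recurrent:
  assumes "c \<in> burnable" "set_pmf p = V"
  shows "recurrent_state (sandpile_kernel H P p) c"
proof -
  let ?K = "sandpile_kernel H P p"
  let ?r = "\<lambda>a b. b \<in> set_pmf (?K a)"
  interpret finite_kernel ?K
    by standard (simp add: set_sandpile_kernel assms finite_interior)
  have returns: "?r\<^sup>*\<^sup>* (drop_chip v x) x" if x: "x \<in> burnable" "v \<in> V" for x v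
  proof -
    have maps: "drop_chip v ` burnable \<subseteq> burnable"
      using x(2) drop_chip_burnable by blast
    have in_b: "(drop_chip v ^^ n) x \<in> burnable" for n
      by (induction n) (use x drop_chip_burnable in auto)
    have inj: "inj_on (drop_chip v ^^ n) burnable" for n
    proof (induction n)
      case (Suc n)
      have "inj_on (drop_chip v) ((drop_chip v ^^ n) ` burnable)"
      proof (rule inj_on_subset[OF inj_on_drop_chip[OF x(2)]])
        show "(drop_chip v ^^ n) ` burnable \<subseteq> burnable"
          by (induction n) (use maps in auto)
      qed
      then show ?case using comp_inj_on[OF Suc, of "drop_chip v"] by (simp add: comp_def)
    qed simp
    \<comment> \<open>Pigeonhole among the iterates; injectivity cancels the first \<open>i\<close>
      of them.\<close>
    have "\<not> inj (\<lambda>n. (drop_chip v ^^ n) x)"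
      using in_b finite_burnable finite_subset[of "range (\<lambda>n. (drop_chip v ^^ n) x)" burnable]
      by (meson finite_imageD image_subset_iff infinite_UNIV_nat)
    then obtain i j where ij: "i < j" "(drop_chip v ^^ i) x = (drop_chip v ^^ j) x"
      unfolding inj_def by (metis nat_neq_iff)
    have "(drop_chip v ^^ i) ((drop_chip v ^^ (j - i)) x) = (drop_chip v ^^ j) x"
      using ij(1) by (metis add_diff_inverse_nat comp_apply funpow_add less_imp_le_nat not_less)
    then have "(drop_chip v ^^ (j - i)) x = x"
      using in_b[of "j - i"] x(1) ij(2) inj_onD[OF inj[of i], of "(drop_chip v ^^ (j - i)) x" x] by simp
    then obtain k where k: "(drop_chip v ^^ Suc k) x = x"
      using ij(1) by (metis Suc_diff_Suc)
    have "?r\<^sup>*\<^sup>* (drop_chip v x) ((drop_chip v ^^ n) (drop_chip v x))" for n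
    proof (induction n)
      case (Suc n)
      have "?r ((drop_chip v ^^ n) (drop_chip v x)) ((drop_chip v ^^ Suc n) (drop_chip v x))"
        using x(2) by (simp add: set_sandpile_kernel assms)
      from rtranclp.rtrancl_into_rtrancl[of ?r, OF Suc this] show ?case .
    qed simp
    then show ?thesis using k by (metis comp_apply funpow_Suc_right)
  qed
  define S where "S = {x. ?r\<^sup>*\<^sup>* c x}"
  have S_b: "x \<in> burnable \<and> ?r\<^sup>*\<^sup>* x c" if "?r\<^sup>*\<^sup>* c x" for x
    using that
  proof (induction rule: rtranclp_induct)
    case base
    then show ?case using assms by simp
  next
    case (step y z)
    then obtain v where "v \<in> V" "z = drop_chip v y"
      by (auto simp: set_sandpile_kernel assms)
    then show ?case using step returns[of y v] drop_chip_burnable[of y v] rtranclp_trans[of ?r z y c] by auto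
  qed
  show ?thesis
  proof (rule recurrent_if_reachable[of S])
    show "finite S" using S_b finite_burnable by (auto simp: S_def intro: finite_subset)
    show "set_pmf (?K x) \<subseteq> S" if "x \<in> S" for x
      using that rtranclp.rtrancl_into_rtrancl[of ?r c x] by (auto simp: S_def)
    show "c \<in> S" by (simp add: S_def)
    show "?r\<^sup>+\<^sup>+ x c" if x: "x \<in> S" for x
    proof -
      have "?r\<^sup>*\<^sup>* c x" "x \<in> burnable" using x S_b by (auto simp: S_def)
      obtain y where y: "?r x y" using set_pmf_not_empty[of "?K x"] by blast
      then have "?r\<^sup>*\<^sup>* c y" using rtranclp.rtrancl_into_rtrancl[of ?r, OF \<open>?r\<^sup>*\<^sup>* c x\<close>] by blast
      then have "?r\<^sup>*\<^sup>* y c" using S_b by blast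
      then show ?thesis using rtranclp_into_tranclp2[of ?r, OF y] by blast
    qed
  qed
qed

text \<open>A stable configuration outside \<open>burnable\<close> can be filled up chip by chip,
  without any firing, until it enters \<open>burnable\<close>, at the latest at the maximal stable
  configuration. It cannot come back from there, as \<open>burnable\<close> is closed under the
  chain.\<close>

theorem recurrent_configs_eq:
  assumes "V \<noteq> {}"
  shows "recurrent_configs H P = burnable"
proof
  show "burnable \<subseteq> recurrent_configs H P"
    using burnable_recurrent by (auto simp: recurrent_configs_def burnable_def)
  show "recurrent_configs H P \<subseteq> burnable"
  proof
    fix c assume c: "c \<in> recurrent_configs H P"
    define p where "p = pmf_of_set V"
    have p: "set_pmf p = V" using assms finite_interior by (simp add: p_def)
    let ?K = "sandpile_kernel H P p"
    interpret finite_kernel ?K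
      by standard (simp add: set_sandpile_kernel p finite_interior)
    have rec: "recurrent_state ?K c" and conf: "c \<in> configs H P" "stable H P c"
      using c p by (auto simp: recurrent_configs_def)
    show "c \<in> burnable"
    proof (rule ccontr)
      assume nb: "c \<notin> burnable"
      \<comment> \<open>Induction on the number of chips missing to the maximal stable
        configuration, over all stable \<open>c'\<close> above \<open>c\<close>. An added chip makes
        \<open>c'\<close> exceed \<open>c\<close> somewhere, so the path avoids
        \<open>c\<close>.\<close>
      have "escapes c c'" if "c' \<in> configs H P" "stable H P c'" "\<And>v. c v \<le> c' v" for c'
        using that
      proof (induction "\<Sum>v\<in>V. dg v - 1 - c' v" arbitrary: c' rule: less_induct)
        case less
        show ?case
        proof (cases "c' \<in> burnable")
          case True
          have "hit_prob ?K c n c' = 0" for n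
            using nb True p drop_chip_burnable by (intro hit_prob_closed[of burnable]) (auto simp: set_sandpile_kernel)
          then show ?thesis unfolding escapes_def by (intro exI[of _ 1]) simp
        next
          case False
          have "\<exists>v\<in>V. Suc (c' v) < dg v"
          proof (rule ccontr)
            assume neg: "\<not> ?thesis"
            have "c' v = (if v \<in> V then dg v - 1 else 0)" for v
            proof (cases "v \<in> V")
              case True
              then have "\<not> Suc (c' v) < dg v" "c' v < dg v" using neg less.prems(2) by (auto simp: stable_def)
              then show ?thesis using True by simp
            next
              case False
              then show ?thesis using less.prems(1) by (simp add: configs_def)
            qed
            then have "c' = (\<lambda>v. if v \<in> V then dg v - 1 else 0)" by blast
            then show False using False max_stable_burnable by simp
          qed
          then obtain v where v: "v \<in> V" "Suc (c' v) < dg v" by blast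
          let ?c = "add_chip c' v"
          have "escapes c ?c"
          proof (rule less.hyps)
            show "(\<Sum>u\<in>V. dg u - 1 - ?c u) < (\<Sum>u\<in>V. dg u - 1 - c' u)"
              using finite_interior v
              by (intro sum_strict_mono_ex1) (auto simp: add_chip_def intro!: bexI[of _ v])
            show "?c \<in> configs H P" using less.prems v by (intro add_chip_configs)
            show "stable H P ?c" using less.prems v by (auto simp: stable_def add_chip_def)
            show "c u \<le> ?c u" for u using less.prems(3)[of u] by (auto simp: add_chip_def)
          qed
          moreover have "?c \<in> set_pmf (?K c')"
            unfolding set_sandpile_kernel[OF p]
            using add_chip_stable[OF less.prems(1,2) v] v(1) by (metis image_eqI)
          moreover have "c v < ?c v"
            using less.prems(3)[of v] by (simp add: add_chip_def)
          then have "?c \<noteq> c" by auto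
          ultimately show ?thesis by (rule escapes_step)
        qed
      qed
      then show False using conf rec escapes_not_recurrent by blast
    qed
  qed
qed

end

section \<open>Words and the cycles of the Schreier graphs\<close>

fun opp :: "digit \<Rightarrow> digit" where
  "opp D0 = D0" | "opp D1 = D2" | "opp D2 = D1"

fun gen_digit :: "gen \<Rightarrow> digit" where
  "gen_digit GA = D1" | "gen_digit GB = D2"

text \<open>The longest suffix over \<open>{0, d}\<close>, read in binary with the first digit least significant and
  keeping its place. A word hangs from the vertex of the cycle through \<open>0\<^sup>k\<close> at this position.\<close>

fun tail_val :: "digit \<Rightarrow> digit list \<Rightarrow> nat" where
  "tail_val d [] = 0"
| "tail_val d (x # u) = (if x = d \<and> set u \<subseteq> {D0, d} then 1 else 0) + 2 * tail_val d u"

fun bits :: "digit \<Rightarrow> nat \<Rightarrow> nat \<Rightarrow> digit list" where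
  "bits d 0 y = []"
| "bits d (Suc k) y = (if odd y then d else D0) # bits d k (y div 2)"

lemma gen_digit_neq [simp]: "gen_digit s \<noteq> D0" "D0 \<noteq> gen_digit s"
  by (cases s; simp)+

lemma opp_neq [simp]: "d \<noteq> D0 \<Longrightarrow> opp d \<noteq> d" "d \<noteq> D0 \<Longrightarrow> opp d \<noteq> D0"
  by (cases d; simp)+

lemma opp_iff: "d \<noteq> D0 \<Longrightarrow> x \<notin> {D0, d} \<longleftrightarrow> x = opp d"
  by (cases d; cases x; simp)

lemma tail_val_append:
  "tail_val d (u @ v) = (if set v \<subseteq> {D0, d} then tail_val d u else 0) + 2 ^ length u * tail_val d v"
  by (induction u) auto

lemma tail_val_eq_0: "d \<notin> set u \<Longrightarrow> tail_val d u = 0"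
  by (induction u) auto

lemma tail_val_less: "tail_val d u < 2 ^ length u"
  by (induction u) auto

lemma length_bits [simp]: "length (bits d k y) = k"
  by (induction k arbitrary: y) auto

lemma set_bits: "set (bits d k y) \<subseteq> {D0, d}"
  by (induction k arbitrary: y) auto

lemma tail_val_bits: "d \<noteq> D0 \<Longrightarrow> tail_val d (bits d k y) = y mod 2 ^ k"
proof (induction k arbitrary: y)
  case (Suc k)
  have "y mod (2 * 2 ^ k) = y mod 2 + 2 * (y div 2 mod 2 ^ k)"
    using mod_mult2_eq[of y 2 "2 ^ k"] by simp
  then show ?case using Suc set_bits[of d k "y div 2"]
    by (auto simp: odd_iff_mod_2_eq_one even_iff_mod_2_eq_zero)
qed simp

lemma bits_tail_val: "d \<noteq> D0 \<Longrightarrow> set u \<subseteq> {D0, d} \<Longrightarrow> bits d (length u) (tail_val d u) = u"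
  by (induction u) auto

lemma bits_0: "bits d k 0 = replicate k D0"
  by (induction k) auto

text \<open>The generator with digit \<open>d\<close> acts as a binary adding machine on the longest
  prefix over \<open>{D0, d}\<close> and fixes the rest, so the rest is a label of its
  cycle.\<close>

definition cyc_prefix :: "digit \<Rightarrow> digit list \<Rightarrow> digit list" where
  "cyc_prefix d w = takeWhile (\<lambda>x. x \<in> {D0, d}) w"

definition cyc :: "digit \<Rightarrow> digit list \<Rightarrow> digit list" where
  "cyc d w = dropWhile (\<lambda>x. x \<in> {D0, d}) w"

lemma cyc_split [simp]: "cyc_prefix d w @ cyc d w = w"
  by (simp add: cyc_prefix_def cyc_def)

lemma length_cyc_prefix: "length (cyc_prefix d w) = length w - length (cyc d w)"
  by (metis add_diff_cancel_right' cyc_split length_append)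

lemma set_cyc_prefix: "set (cyc_prefix d w) \<subseteq> {D0, d}"
  unfolding cyc_prefix_def using set_takeWhileD by fastforce

lemma cyc_cases: "d \<noteq> D0 \<Longrightarrow> cyc d w = [] \<or> hd (cyc d w) = opp d"
  unfolding cyc_def using hd_dropWhile[of "\<lambda>x. x \<in> {D0, d}" w] opp_iff by blast

lemma cyc_append:
  assumes "set u \<subseteq> {D0, d}" "v = [] \<or> hd v = opp d" "d \<noteq> D0"
  shows "cyc d (u @ v) = v" "cyc_prefix d (u @ v) = u"
proof -
  have "cyc d v = v" "cyc_prefix d v = []"
    using assms(2,3) unfolding cyc_def cyc_prefix_def by (cases v; auto simp: opp_iff)+
  moreover have "cyc d (u @ v) = cyc d v" "cyc_prefix d (u @ v) = u @ cyc_prefix d v"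
    using assms(1) unfolding cyc_def cyc_prefix_def
    using dropWhile_append2[of u "\<lambda>x. x \<in> {D0, d}" v] takeWhile_append2[of u "\<lambda>x. x \<in> {D0, d}" v]
    by blast+
  ultimately show "cyc d (u @ v) = v" "cyc_prefix d (u @ v) = u" by simp_all
qed

text \<open>The carry runs through digits \<open>d\<close> and stops at the first \<open>D0\<close>.
  If it leaves the prefix it meets the opposite digit, which the generator fixes, or the end of the
  word. So this is addition modulo \<open>2 ^ length u\<close>, and \<open>bits\<close> truncates
  accordingly.\<close>

lemma act_append:
  assumes "set u \<subseteq> {D0, gen_digit s}" "v = [] \<or> hd v = opp (gen_digit s)"
  shows "act s (u @ v) = bits (gen_digit s) (length u) (tail_val (gen_digit s) u + 1) @ v"
  using assms(1)
proof (induction u)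
  case Nil
  then show ?case using assms(2) by (cases v; cases s; auto)
next
  case (Cons x u)
  then have IH: "act s (u @ v) = bits (gen_digit s) (length u) (tail_val (gen_digit s) u + 1) @ v"
    and x: "x = D0 \<or> x = gen_digit s" and u: "bits (gen_digit s) (length u) (tail_val (gen_digit s) u) = u"
    by (auto intro!: bits_tail_val)
  show ?case
  proof (cases "x = D0")
    case True
    then show ?thesis using u by (cases s) auto
  next
    case False
    then show ?thesis using x IH Cons.prems by (cases s) auto
  qed
qed

lemma act_cyc:
  "act s w = bits (gen_digit s) (length (cyc_prefix (gen_digit s) w))
      (tail_val (gen_digit s) (cyc_prefix (gen_digit s) w) + 1) @ cyc (gen_digit s) w"
  using act_append[of "cyc_prefix (gen_digit s) w" s "cyc (gen_digit s) w"]
    set_cyc_prefix cyc_cases[of "gen_digit s" w] by simp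

definition act_inv :: "gen \<Rightarrow> digit list \<Rightarrow> digit list" where
  "act_inv s = inv_into UNIV (act s)"

lemma act_act_inv [simp]: "act s (act_inv s w) = w"
  by (simp add: act_inv_def surj_act surj_f_inv_f)

lemma act_inv_act [simp]: "act_inv s (act s w) = w"
  by (simp add: act_inv_def inj_act)

lemma act_eq_iff: "act s u = w \<longleftrightarrow> u = act_inv s w"
  by auto

lemma length_act_inv [simp]: "length (act_inv s w) = length w"
  by (metis act_act_inv length_act)

lemma cyc_act: "cyc (gen_digit s) (act s w) = cyc (gen_digit s) w"
  unfolding act_cyc[of s w] by (rule cyc_append) (use set_bits cyc_cases in auto)

lemma cyc_act_inv: "cyc (gen_digit s) (act_inv s w) = cyc (gen_digit s) w"
  by (metis act_act_inv cyc_act)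

text \<open>A cycle is given by its digit \<open>d\<close> and the common suffix \<open>\<kappa>\<close> of its vertices. The height is the
  position on this cycle of the vertex from which \<open>w\<close> hangs, and 0 if \<open>w\<close> hangs from no vertex but
  the root of the cycle.\<close>

definition height :: "digit \<Rightarrow> digit list \<Rightarrow> digit list \<Rightarrow> nat" where
  "height d \<kappa> w = (if drop (length w - length \<kappa>) w = \<kappa>
     then tail_val d (take (length w - length \<kappa>) w) else 0)"

definition cycle_key :: "digit \<Rightarrow> digit list \<Rightarrow> bool" where
  "cycle_key d \<kappa> \<longleftrightarrow> d \<noteq> D0 \<and> (\<kappa> = [] \<or> hd \<kappa> = opp d)"

lemma height_append: "height d \<kappa> (u @ \<kappa>) = tail_val d u"
  by (simp add: height_def)

lemma height_less: "height d \<kappa> w < 2 ^ (length w - length \<kappa>)"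
  using tail_val_less[of d "take (length w - length \<kappa>) w"] by (auto simp: height_def)

lemma height_cyc:
  assumes "cyc d w = \<kappa>"
  shows "height d \<kappa> w = tail_val d (cyc_prefix d w)"
  using height_append[of d \<kappa> "cyc_prefix d w"] cyc_split[of d w] unfolding assms by simp

lemma height_act_same:
  assumes "cyc (gen_digit s) w = \<kappa>"
  shows "height (gen_digit s) \<kappa> (act s w) = (height (gen_digit s) \<kappa> w + 1) mod 2 ^ (length w - length \<kappa>)"
proof -
  let ?d = "gen_digit s"
  have len: "length (cyc_prefix ?d w) = length w - length \<kappa>"
    using assms length_cyc_prefix by simp
  have "height ?d \<kappa> (act s w) = tail_val ?d (bits ?d (length (cyc_prefix ?d w)) (tail_val ?d (cyc_prefix ?d w) + 1))"
    using act_cyc[of s w] assms height_append by metis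
  then show ?thesis using len height_cyc[OF assms] by (simp add: tail_val_bits)
qed

text \<open>Only a prefix of the word changes. If it ends before the cut, \<open>tail_val\<close>
  does not see it: it uses the other digit or is followed by the digit opposite to \<open>d\<close>.
  If it reaches the cut or beyond and the suffix is \<open>\<kappa>\<close>, it must use the other
  digit. This is the cactus property: what hangs from a vertex of a cycle is left only along that
  cycle.\<close>

lemma height_act_other:
  assumes "cycle_key d \<kappa>" "\<not> (cyc (gen_digit s) w = \<kappa> \<and> d = gen_digit s)"
  shows "height d \<kappa> (act s w) = height d \<kappa> w"
proof -
  let ?e = "gen_digit s"
  define u where "u = cyc_prefix ?e w"
  define v where "v = cyc ?e w"
  define u' where "u' = bits ?e (length u) (tail_val ?e u + 1)"
  define k where "k = length w - length \<kappa>"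
  have w: "w = u @ v" and sw: "act s w = u' @ v" and len: "length u' = length u"
    and su: "set u \<subseteq> {D0, ?e}" "set u' \<subseteq> {D0, ?e}" and hv: "v = [] \<or> hd v = opp ?e"
    using act_cyc[of s w] set_cyc_prefix set_bits cyc_cases[of ?e w] unfolding u_def v_def u'_def
    by simp_all
  have d: "d \<noteq> D0" using assms(1) by (simp add: cycle_key_def)
  have k': "length (act s w) - length \<kappa> = k" by (simp add: k_def)
  consider "length u < k" | "length u = k" | "k < length u" by linarith
  then show ?thesis
  proof cases
    case 1
    define v1 where "v1 = take (k - length u) v"
    have tk: "take k w = u @ v1" "take k (act s w) = u' @ v1" and dr: "drop k w = drop k (act s w)"
      unfolding sw using 1 by (auto simp: w len v1_def)
    have "tail_val d (u @ v1) = tail_val d (u' @ v1)"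
    proof (cases "d = ?e")
      case True
      have "v1 \<noteq> []" "hd v1 = hd v"
        using 1 by (auto simp: v1_def k_def w)
      then have "v1 \<noteq> []" "hd v1 = opp d" using hv True v1_def by auto
      then have "\<not> set v1 \<subseteq> {D0, d}"
        using d by (metis hd_in_set insertE opp_neq singletonD subsetD)
      then show ?thesis by (simp add: tail_val_append len)
    next
      case False
      then have "tail_val d u = 0" "tail_val d u' = 0"
        using su d by (auto intro!: tail_val_eq_0)
      then show ?thesis by (simp add: tail_val_append len)
    qed
    then show ?thesis unfolding height_def k' k_def[symmetric] by (simp add: tk dr)
  next
    case 2
    have tk: "take k w = u" "take k (act s w) = u'" "drop k w = v" "drop k (act s w) = v"
      unfolding sw using 2 len by (auto simp: w)
    show ?thesis
    proof (cases "v = \<kappa>")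
      case True
      then have "d \<noteq> ?e" using assms(2) v_def by blast
      then have "tail_val d u = 0" "tail_val d u' = 0"
        using su d by (auto intro!: tail_val_eq_0)
      then show ?thesis unfolding height_def k' k_def[symmetric] by (simp add: tk)
    next
      case False
      then show ?thesis unfolding height_def k' k_def[symmetric] by (simp add: tk)
    qed
  next
    case 3
    have *: "tail_val d (take k x) = 0"
      if x: "set x \<subseteq> {D0, ?e}" "length x = length u" and dr: "drop k (x @ v) = \<kappa>" for x
    proof -
      have ne: "drop k x \<noteq> []" using 3 x by simp
      then have "\<kappa> \<noteq> []" "hd \<kappa> = hd (drop k x)" using dr by auto
      then have "hd (drop k x) = opp d" using assms(1) by (simp add: cycle_key_def)
      moreover have "hd (drop k x) \<in> {D0, ?e}"
        using x ne by (meson hd_in_set in_set_dropD subsetD)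
      ultimately have "d \<noteq> ?e" using d by auto
      then show ?thesis using x d by (intro tail_val_eq_0) (auto dest: in_set_takeD)
    qed
    have tk: "take k w = take k u" "take k (act s w) = take k u'"
      unfolding sw using 3 len by (auto simp: w)
    show ?thesis unfolding height_def k' k_def[symmetric] tk
      unfolding sw using *[of u] *[of u'] su len by (auto simp: w)
  qed
qed

lemma height_act_inv_same:
  assumes "cyc (gen_digit s) w = \<kappa>"
  shows "height (gen_digit s) \<kappa> (act_inv s w)
    = (height (gen_digit s) \<kappa> w + 2 ^ (length w - length \<kappa>) - 1) mod 2 ^ (length w - length \<kappa>)"
proof -
  let ?m = "2 ^ (length w - length \<kappa>) :: nat" and ?h = "height (gen_digit s) \<kappa>"
  have "cyc (gen_digit s) (act_inv s w) = \<kappa>" using assms cyc_act_inv by simp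
  from height_act_same[OF this] have *: "?h w = (?h (act_inv s w) + 1) mod ?m" by simp
  have less: "?h (act_inv s w) < ?m"
    using height_less[of "gen_digit s" \<kappa> "act_inv s w"] by simp
  show ?thesis
  proof (cases "?h (act_inv s w) + 1 = ?m")
    case True
    then have "?h w = 0" "?h (act_inv s w) = ?m - 1" using * by auto
    then show ?thesis using less by simp
  next
    case False
    then have "?h w = ?h (act_inv s w) + 1" using * less by simp
    then show ?thesis using less by simp
  qed
qed

lemma height_act_inv_other:
  assumes "cycle_key d \<kappa>" "\<not> (cyc (gen_digit s) w = \<kappa> \<and> d = gen_digit s)"
  shows "height d \<kappa> (act_inv s w) = height d \<kappa> w"
  using height_act_other[of d \<kappa> s "act_inv s w"] assms cyc_act_inv by simp

lemma cyc_vertex_iff: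
  assumes "cycle_key d \<kappa>" "length w = n" "length \<kappa> \<le> n" "y < 2 ^ (n - length \<kappa>)"
  shows "cyc d w = \<kappa> \<and> height d \<kappa> w = y \<longleftrightarrow> w = bits d (n - length \<kappa>) y @ \<kappa>"
proof
  assume *: "cyc d w = \<kappa> \<and> height d \<kappa> w = y"
  then have "length (cyc_prefix d w) = n - length \<kappa>"
    using assms(2) length_cyc_prefix by simp
  moreover have "tail_val d (cyc_prefix d w) = y" using * height_cyc by metis
  ultimately have "cyc_prefix d w = bits d (n - length \<kappa>) y"
    using bits_tail_val[OF _ set_cyc_prefix, of d w] assms(1) by (simp add: cycle_key_def)
  then show "w = bits d (n - length \<kappa>) y @ \<kappa>" using * cyc_split by metis
next
  assume w: "w = bits d (n - length \<kappa>) y @ \<kappa>"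
  have "cyc d w = \<kappa>"
    unfolding w using assms(1) set_bits by (intro cyc_append) (auto simp: cycle_key_def)
  then show "cyc d w = \<kappa> \<and> height d \<kappa> w = y"
    using w assms height_append[of d \<kappa>] by (simp add: tail_val_bits cycle_key_def)
qed

text \<open>Nonzero digits are read as binary ones, whichever of the two they are. This is the rank
  for the escape to the zero word.\<close>

fun weight :: "digit list \<Rightarrow> nat" where
  "weight [] = 0"
| "weight (x # u) = (if x = D0 then 0 else 1) + 2 * weight u"

lemma weight_append: "weight (u @ v) = weight u + 2 ^ length u * weight v"
  by (induction u) auto

lemma weight_tail_val: "d \<noteq> D0 \<Longrightarrow> set u \<subseteq> {D0, d} \<Longrightarrow> weight u = tail_val d u"
  by (induction u) auto

text \<open>Tells the two sides of the zero word apart; the value \<open>D0\<close> marks the zero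
  word itself.\<close>

fun last_nonzero :: "digit list \<Rightarrow> digit" where
  "last_nonzero [] = D0"
| "last_nonzero (x # u) = (if last_nonzero u = D0 then x else last_nonzero u)"

lemma last_nonzero_append:
  "last_nonzero (u @ v) = (if last_nonzero v = D0 then last_nonzero u else last_nonzero v)"
  by (induction u) auto

lemma last_nonzero_eq_D0: "last_nonzero w = D0 \<longleftrightarrow> w = replicate (length w) D0"
  by (induction w) auto

lemma last_nonzero_in: "last_nonzero w \<in> insert D0 (set w)"
  by (induction w) auto

lemma tail_val_last_nonzero: "tail_val e u \<noteq> 0 \<Longrightarrow> e \<noteq> D0 \<Longrightarrow> last_nonzero u = e"
proof (induction u)
  case (Cons x u)
  show ?case
  proof (cases "tail_val e u = 0")
    case True
    then have x: "x = e" "set u \<subseteq> {D0, e}" using Cons.prems by (auto split: if_splits)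
    have "last_nonzero u \<in> {D0, e}" using last_nonzero_in[of u] x(2) by blast
    then show ?thesis using x(1) by auto
  qed (use Cons in auto)
qed simp

lemma last_nonzero_hd: "w \<noteq> [] \<Longrightarrow> hd w \<noteq> D0 \<Longrightarrow> last_nonzero w \<noteq> D0"
  by (cases w) auto

text \<open>The part fixed by the generator begins with a nonzero digit unless it is empty; in that
  case both words use only \<open>D0\<close> and the digit of the generator.\<close>

lemma last_nonzero_act:
  assumes "last_nonzero w \<noteq> D0" "last_nonzero (act s w) \<noteq> D0"
  shows "last_nonzero (act s w) = last_nonzero w"
proof (cases "cyc (gen_digit s) w = []")
  case False
  then have "hd (cyc (gen_digit s) w) \<noteq> D0"
    using cyc_cases[of "gen_digit s" w] by auto
  then have *: "last_nonzero (cyc (gen_digit s) w) \<noteq> D0" using False last_nonzero_hd by blast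
  have "last_nonzero w = last_nonzero (cyc_prefix (gen_digit s) w @ cyc (gen_digit s) w)" by simp
  then show ?thesis unfolding act_cyc[of s w] last_nonzero_append using * by simp
next
  case True
  then have "set w \<subseteq> {D0, gen_digit s}" by (metis append_Nil2 cyc_split set_cyc_prefix)
  moreover have "set (act s w) \<subseteq> {D0, gen_digit s}"
    unfolding act_cyc[of s w] True using set_bits by simp
  ultimately show ?thesis
    using last_nonzero_in[of w] last_nonzero_in[of "act s w"] assms
    by (metis empty_iff insert_iff subsetD)
qed

text \<open>On the cycle belonging to the first nonzero digit of \<open>w\<close> the position is
  positive. One step back lowers it by 1 and keeps the rest of the word.\<close>

lemma weight_decreases:
  assumes "last_nonzero w \<noteq> D0"
  shows "\<exists>s. weight (act_inv s w) < weight w"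
proof -
  obtain s where s: "tail_val (gen_digit s) (cyc_prefix (gen_digit s) w) \<noteq> 0"
  proof -
    have "\<exists>s. tail_val (gen_digit s) (cyc_prefix (gen_digit s) w) \<noteq> 0"
      using assms
    proof (induction w)
      case (Cons x w)
      show ?case
      proof (cases "x = D0")
        case True
        then obtain s where "tail_val (gen_digit s) (cyc_prefix (gen_digit s) w) \<noteq> 0"
          using Cons by (auto split: if_splits)
        then show ?thesis using True by (intro exI[of _ s]) (simp add: cyc_prefix_def)
      next
        case False
        then obtain s where "x = gen_digit s" by (metis digit.exhaust gen_digit.simps)
        then show ?thesis using set_cyc_prefix[of "gen_digit s" w]
            by (intro exI[of _ s]) (simp add: cyc_prefix_def)
      qed
    qed simp
    then show thesis using that by blast
  qed
  let ?d = "gen_digit s" and ?w = "act_inv s w"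
  define \<kappa> where "\<kappa> = cyc ?d w"
  have c: "cyc ?d w = \<kappa>" "cyc ?d ?w = \<kappa>" by (simp_all add: \<kappa>_def cyc_act_inv)
  have wt: "weight x = height ?d \<kappa> x + 2 ^ (length x - length \<kappa>) * weight \<kappa>" if "cyc ?d x = \<kappa>" for x
  proof -
    have "weight x = weight (cyc_prefix ?d x) + 2 ^ length (cyc_prefix ?d x) * weight \<kappa>"
      using that by (metis cyc_split weight_append)
    moreover have "length (cyc_prefix ?d x) = length x - length \<kappa>"
      using that length_cyc_prefix by simp
    ultimately show ?thesis
      using height_cyc[OF that] weight_tail_val[OF _ set_cyc_prefix, of ?d x] by simp
  qed
  have h0: "height ?d \<kappa> w \<noteq> 0" using s height_cyc[OF c(1)] by simp
  have "height ?d \<kappa> w + 2 ^ (length w - length \<kappa>) - 1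
      = (height ?d \<kappa> w - 1) + 2 ^ (length w - length \<kappa>)"
    using h0 by simp
  then have "height ?d \<kappa> ?w = height ?d \<kappa> w - 1"
    using height_act_inv_same[OF c(1)] height_less[of ?d \<kappa> w] by (simp only: mod_add_self2) simp
  then have "weight ?w < weight w" using wt[OF c(1)] wt[OF c(2)] h0 by simp
  then show ?thesis by blast
qed

section \<open>The sandpile on one side of the Schreier graph\<close>

fun other_gen :: "gen \<Rightarrow> gen" where
  "other_gen GA = GB" | "other_gen GB = GA"

lemma UNIV_gen: "(UNIV :: gen set) = {GA, GB}"
  using gen.exhaust by blast

instance gen :: finite
  by standard (simp add: UNIV_gen)

lemma sum_gen: "(\<Sum>t\<in>UNIV. f t) = f s + f (other_gen s)"
  by (cases s) (auto simp: UNIV_gen add.commute)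

lemma gen_digit_other: "gen_digit t = gen_digit s \<longleftrightarrow> t = s" "other_gen s \<noteq> s"
  by (cases s; cases t; simp)+

lemma gen_digit_ex: "e \<noteq> D0 \<Longrightarrow> \<exists>s. gen_digit s = e"
  by (metis digit.exhaust gen_digit.simps)

definition side_verts :: "digit \<Rightarrow> nat \<Rightarrow> digit list set" where
  "side_verts d n = {w. length w = n \<and> last_nonzero w = d}"

definition side_graph :: "digit \<Rightarrow> nat \<Rightarrow> (digit list, digit list \<times> gen) pre_digraph" where
  "side_graph d n = induce_subgraph (schreier_level n) (side_verts d n \<union> {zero_word n})"

lemma last_nonzero_zero_word [simp]: "last_nonzero (zero_word n) = D0"
  using last_nonzero_eq_D0[of "zero_word n"] by simp

lemma finite_side_verts: "finite (side_verts d n)"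
proof (rule finite_subset)
  show "side_verts d n \<subseteq> {w. set w \<subseteq> UNIV \<and> length w = n}" by (auto simp: side_verts_def)
qed (rule finite_lists_length_eq[OF finite])

lemma zero_notin_side: "d \<noteq> D0 \<Longrightarrow> zero_word n \<notin> side_verts d n"
  by (auto simp: side_verts_def)

lemma side_verts_act:
  assumes "w \<in> side_verts d n" "d \<noteq> D0"
  shows "act s w \<in> side_verts d n \<union> {zero_word n}" "act_inv s w \<in> side_verts d n \<union> {zero_word n}"
proof -
  have *: "x \<in> side_verts d n \<union> {zero_word n}"
    if "length x = n" "last_nonzero x \<noteq> D0 \<Longrightarrow> last_nonzero x = d" for x
    using that last_nonzero_eq_D0[of x] by (cases "last_nonzero x = D0") (auto simp: side_verts_def)
  have w: "length w = n" "last_nonzero w = d" using assms by (auto simp: side_verts_def)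
  show "act s w \<in> side_verts d n \<union> {zero_word n}"
    using w assms(2) last_nonzero_act[of w s] by (intro *) auto
  show "act_inv s w \<in> side_verts d n \<union> {zero_word n}"
    using w assms(2) last_nonzero_act[of "act_inv s w" s] by (intro *) auto
qed

lemma joined_avoiding_level:
  "joined_avoiding (schreier_level n) {zero_word n} u v \<longleftrightarrow>
    (u, v) \<in> rtrancl_on ({w. length w = n} - {zero_word n})
      {(w, w'). \<exists>s. length w = n \<and> w \<noteq> zero_word n \<and> w' \<noteq> zero_word n \<and> (w' = act s w \<or> w = act s w')}"
proof -
  have "parcs (mk_symmetric (induce_subgraph (schreier_level n) (verts (schreier_level n) - {zero_word n})))
     = {(w, w'). \<exists>s. length w = n \<and> w \<noteq> zero_word n \<and> w' \<noteq> zero_word n \<and> (w' = act s w \<or> w = act s w')}"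
    (is "?L = ?R")
  proof
    show "?L \<subseteq> ?R"
    proof
      fix p assume "p \<in> ?L"
      then obtain w s where "length w = n" "w \<noteq> zero_word n" "act s w \<noteq> zero_word n"
        "p = (w, act s w) \<or> p = (act s w, w)"
        unfolding parcs_mk_symmetric by (auto simp: schreier_level_def)
      then show "p \<in> ?R" by fastforce
    qed
    show "?R \<subseteq> ?L"
    proof
      fix p assume "p \<in> ?R"
      then obtain w w' s where p: "p = (w, w')" "length w = n" "w \<noteq> zero_word n" "w' \<noteq> zero_word n"
        "w' = act s w \<or> w = act s w'" by blast
      define e where "e = (if w' = act s w then (w, s) else (w', s))"
      have "e \<in> arcs (induce_subgraph (schreier_level n) (verts (schreier_level n) - {zero_word n}))"
        using p by (auto simp: e_def schreier_level_def)
      moreover have "p \<in> {(fst e, act (snd e) (fst e)), (act (snd e) (fst e), fst e)}"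
        using p by (auto simp: e_def)
      ultimately show "p \<in> ?L"
        unfolding parcs_mk_symmetric by (intro UN_I[of e]) (auto simp: schreier_level_def case_prod_beta)
    qed
  qed
  then show ?thesis
    unfolding joined_avoiding_def reachable_def by (simp add: schreier_level_def)
qed

text \<open>Backward steps that lower the weight lead from any vertex of the side to
  \<open>d\<close> followed by zeros, the only vertex of the side from which such a step enters the
  zero word. Conversely, no step avoiding the zero word changes the last nonzero digit.\<close>

lemma component_side_verts:
  assumes "length x = n" "last_nonzero x = d" "d \<noteq> D0"
  shows "{w. joined_avoiding (schreier_level n) {zero_word n} x w} = side_verts d n"
proof -
  let ?A = "{w. length w = n} - {zero_word n}"
  let ?R = "{(w, w'). \<exists>s. length w = n \<and> w \<noteq> zero_word n \<and> w' \<noteq> zero_word n \<and> (w' = act s w \<or> w = act s w')}"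
  define base where "base = d # zero_word (n - 1)"
  have in_A: "w \<in> ?A" if "w \<in> side_verts d n" for w
  proof -
    have "w \<noteq> zero_word n" using that zero_notin_side[OF assms(3)] by blast
    then show ?thesis using that by (simp add: side_verts_def)
  qed
  have x: "x \<in> side_verts d n" using assms by (simp add: side_verts_def)
  have sym: "sym ?R" by (auto simp: sym_def)
  have to_base: "(w, base) \<in> rtrancl_on ?A ?R" if "w \<in> side_verts d n" for w
    using that
  proof (induction "weight w" arbitrary: w rule: less_induct)
    case less
    then have w: "length w = n" "last_nonzero w = d" by (auto simp: side_verts_def)
    then obtain s where s: "weight (act_inv s w) < weight w"
      using weight_decreases assms(3) by blast
    show ?case
    proof (cases "act_inv s w = zero_word n")
      case True
      have "n > 0" using w assms(3) by (cases w) auto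
      then have "w = act s (D0 # zero_word (n - 1))"
        using True by (metis Suc_diff_1 act_act_inv replicate_Suc)
      then have "w = gen_digit s # zero_word (n - 1)" by (cases s) auto
      then have "w = base" using w(2) by (simp add: base_def)
      then show ?thesis using in_A[OF less.prems] by auto
    next
      case False
      then have "act_inv s w \<in> side_verts d n"
        using side_verts_act(2)[OF less.prems assms(3), of s] by blast
      then have "(act_inv s w, base) \<in> rtrancl_on ?A ?R" using less.hyps s by blast
      moreover have "(w, act_inv s w) \<in> ?R"
        using False in_A[OF less.prems] by (auto intro!: exI[of _ s])
      ultimately show ?thesis
        using in_A[OF less.prems] by (metis (no_types, lifting) converse_rtrancl_on_into_rtrancl_on)
    qed
  qed
  have "joined_avoiding (schreier_level n) {zero_word n} x w \<longleftrightarrow> w \<in> side_verts d n" for w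
  proof
    assume "w \<in> side_verts d n"
    then have "(base, w) \<in> rtrancl_on ?A ?R"
      using to_base rtrancl_on_sym[OF sym] by (metis (no_types, lifting) symE)
    then show "joined_avoiding (schreier_level n) {zero_word n} x w"
      unfolding joined_avoiding_level using to_base[OF x] rtrancl_on_trans by fast
  next
    assume "joined_avoiding (schreier_level n) {zero_word n} x w"
    then show "w \<in> side_verts d n"
      unfolding joined_avoiding_level
    proof (induction rule: rtrancl_on_induct)
      case base
      then show ?case using x by simp
    next
      case (step y z)
      then obtain s where s: "z \<noteq> zero_word n" "z = act s y \<or> y = act s z" by blast
      then have "z = act s y \<or> z = act_inv s y" by auto
      then show ?case using side_verts_act[OF \<open>y \<in> side_verts d n\<close> assms(3), of s] s(1) by auto
    qed
  qed
  then show ?thesis by blast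
qed

lemma H_graph_side:
  assumes "last_nonzero (stake n \<xi>) \<noteq> D0"
  shows "H_graph \<xi> n = side_graph (last_nonzero (stake n \<xi>)) n"
  unfolding H_graph_def side_graph_def using component_side_verts[of "stake n \<xi>" n] assms by simp

lemma interior_side: "d \<noteq> D0 \<Longrightarrow> interior_verts (side_graph d n) {zero_word n} = side_verts d n"
  using zero_notin_side by (auto simp: interior_verts_def side_graph_def)

lemma side_graph_simps [simp]:
  "arcs (side_graph d n) = {(u, s). u \<in> side_verts d n \<union> {zero_word n} \<and> act s u \<in> side_verts d n \<union> {zero_word n}}"
  "tail (side_graph d n) = fst" "head (side_graph d n) = (\<lambda>(w, s). act s w)"
  by (auto simp: side_graph_def schreier_level_def side_verts_def)

lemma edge_count_side:
  assumes "u \<in> side_verts d n \<union> {zero_word n}" "w \<in> side_verts d n \<union> {zero_word n}"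
  shows "edge_count (side_graph d n) w u
    = (\<Sum>s\<in>UNIV. (if act s w = u then 1 else 0) + (if act_inv s w = u then 1 else 0))"
proof -
  have count: "card {e \<in> arcs (side_graph d n). tail (side_graph d n) e = x \<and> head (side_graph d n) e = y}
      = (\<Sum>s\<in>UNIV. if act s x = y then 1 else 0)"
    if "x \<in> side_verts d n \<union> {zero_word n}" "y \<in> side_verts d n \<union> {zero_word n}" for x y
  proof -
    have "{e \<in> arcs (side_graph d n). tail (side_graph d n) e = x \<and> head (side_graph d n) e = y}
        = Pair x ` {s. act s x = y}"
      using that by auto
    then show ?thesis by (simp add: card_image inj_on_def sum.If_cases)
  qed
  show ?thesis
    unfolding edge_count_def count[OF assms(2,1)] count[OF assms] sum.distrib
    by (auto simp: act_eq_iff intro!: sum.cong)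
qed

lemma degree_side:
  assumes "w \<in> side_verts d n" "d \<noteq> D0"
  shows "degree_of (side_graph d n) w = 4"
proof -
  have "out_arcs (side_graph d n) w = Pair w ` UNIV"
    using assms(1) side_verts_act(1)[OF assms] by (auto simp: out_arcs_def)
  moreover have "(u, s) \<in> in_arcs (side_graph d n) w \<longleftrightarrow> u = act_inv s w" for u s
  proof -
    have "(u, s) \<in> in_arcs (side_graph d n) w \<longleftrightarrow>
        u \<in> side_verts d n \<union> {zero_word n} \<and> act s u \<in> side_verts d n \<union> {zero_word n} \<and> act s u = w"
      by (auto simp: in_arcs_def)
    then show ?thesis
      using assms(1) side_verts_act(2)[OF assms, of s] by (metis UnI1 act_act_inv act_inv_act)
  qed
  then have "p \<in> in_arcs (side_graph d n) w \<longleftrightarrow> p \<in> (\<lambda>s. (act_inv s w, s)) ` UNIV" for p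
    by (cases p) (simp only: image_iff bex_UNIV prod.inject, blast)
  then have "in_arcs (side_graph d n) w = (\<lambda>s. (act_inv s w, s)) ` UNIV"
    by blast
  moreover have "card (UNIV :: gen set) = 2" by (simp add: UNIV_gen)
  ultimately show ?thesis
    by (simp add: degree_of_def in_degree_def out_degree_def card_image inj_on_def)
qed

lemma sum_edge_count_side:
  fixes f :: "digit list \<Rightarrow> 'a :: comm_semiring_1"
  assumes "U \<subseteq> side_verts d n \<union> {zero_word n}" "w \<in> side_verts d n"
  shows "(\<Sum>u\<in>U. f u * of_nat (edge_count (side_graph d n) w u))
    = (\<Sum>s\<in>UNIV. (if act s w \<in> U then f (act s w) else 0) + (if act_inv s w \<in> U then f (act_inv s w) else 0))"
proof -
  have fin: "finite U" using assms finite_side_verts finite_subset by blast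
  have "(\<Sum>u\<in>U. f u * of_nat (edge_count (side_graph d n) w u))
    = (\<Sum>u\<in>U. \<Sum>s\<in>UNIV. (if act s w = u then f u else 0) + (if act_inv s w = u then f u else 0))"
  proof (rule sum.cong[OF refl])
    fix u assume "u \<in> U"
    then have "edge_count (side_graph d n) w u
        = (\<Sum>s\<in>UNIV. (if act s w = u then 1 else 0) + (if act_inv s w = u then 1 else 0))"
      using assms by (intro edge_count_side) auto
    then show "f u * of_nat (edge_count (side_graph d n) w u)
        = (\<Sum>s\<in>UNIV. (if act s w = u then f u else 0) + (if act_inv s w = u then f u else 0))"
      by (auto simp: sum_distrib_left distrib_left mult_2_right intro!: sum.cong)
  qed
  also have "\<dots> = (\<Sum>s\<in>UNIV. \<Sum>u\<in>U. (if act s w = u then f u else 0) + (if act_inv s w = u then f u else 0))"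
    by (rule sum.swap)
  also have "\<dots> = (\<Sum>s\<in>UNIV. (if act s w \<in> U then f (act s w) else 0) + (if act_inv s w \<in> U then f (act_inv s w) else 0))"
    using fin by (simp add: sum.distrib)
  finally show ?thesis .
qed

lemma sum_edge_count_side_nat:
  assumes "U \<subseteq> side_verts d n \<union> {zero_word n}" "w \<in> side_verts d n"
  shows "(\<Sum>u\<in>U. edge_count (side_graph d n) w u)
    = (\<Sum>s\<in>UNIV. (if act s w \<in> U then 1 else 0) + (if act_inv s w \<in> U then 1 else 0))"
  using sum_edge_count_side[OF assms, of "\<lambda>_. 1 :: nat"] by simp

locale side =
  fixes d :: digit and n :: nat
  assumes d_nonzero: "d \<noteq> D0"
begin

text \<open>The backward step that lowers the weight leads to a lower vertex of the side or to the
  zero word, and in the latter case one of the four edges is lost to the dissipative vertex.\<close>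

sublocale sandpile_graph "side_graph d n" "{zero_word n}" weight
proof
  show "finite (interior_verts (side_graph d n) {zero_word n})"
    by (simp add: interior_side d_nonzero finite_side_verts)
next
  fix v assume "v \<in> interior_verts (side_graph d n) {zero_word n}"
  then have v: "v \<in> side_verts d n" by (simp add: interior_side d_nonzero)
  have sum4: "(\<Sum>s\<in>UNIV. (if act s v \<in> side_verts d n then 1 else 0)
      + (if act_inv s v \<in> side_verts d n then 1 else 0)) \<le> (4 :: nat)"
    by (simp add: UNIV_gen)
  show "(\<Sum>u\<in>interior_verts (side_graph d n) {zero_word n}. edge_count (side_graph d n) v u)
      \<le> degree_of (side_graph d n) v"
    using sum4 v by (simp add: interior_side d_nonzero degree_side sum_edge_count_side_nat[OF Un_upper1 v])
  have "last_nonzero v \<noteq> D0" using v d_nonzero by (simp add: side_verts_def)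
  then obtain s where s: "weight (act_inv s v) < weight v" using weight_decreases by blast
  have "(\<Sum>u\<in>side_verts d n. edge_count (side_graph d n) v u) < 4 \<or>
      (\<exists>u\<in>side_verts d n. weight u < weight v \<and> 0 < edge_count (side_graph d n) v u)"
  proof (cases "act_inv s v \<in> side_verts d n")
    case True
    then have "0 < edge_count (side_graph d n) v (act_inv s v)"
      using v by (subst edge_count_side) (auto simp: sum_gen[of _ s])
    then show ?thesis using s True by blast
  next
    case False
    have "(\<Sum>t\<in>UNIV. (if act t v \<in> side_verts d n then 1 else 0)
      + (if act_inv t v \<in> side_verts d n then 1 else 0)) < (4 :: nat)"
      unfolding sum_gen[of _ s] using False by simp
    then show ?thesis by (simp add: sum_edge_count_side_nat[OF Un_upper1 v])
  qed
  then show "(\<Sum>u\<in>interior_verts (side_graph d n) {zero_word n}. edge_count (side_graph d n) v u)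
        < degree_of (side_graph d n) v \<or>
      (\<exists>u\<in>interior_verts (side_graph d n) {zero_word n}.
        weight u < weight v \<and> 0 < edge_count (side_graph d n) v u)"
    using v by (simp add: interior_side d_nonzero degree_side)
qed

lemma V_eq: "V = side_verts d n"
  by (simp add: interior_side d_nonzero)

lemma dg_eq: "w \<in> side_verts d n \<Longrightarrow> dg w = 4"
  by (simp add: degree_side d_nonzero)

text \<open>A nonempty key begins with the digit that ends the prefix, so its cycle has the opposite
  digit; the empty key is the cycle through the zero word, which has the digit of the side.\<close>

definition key_digit :: "digit list \<Rightarrow> digit" where
  "key_digit \<kappa> = (if \<kappa> = [] then d else opp (hd \<kappa>))"

text \<open>A vertex lies on one cycle of each generator and is the root of one of them. The first
  nonzero digit selects the cycle on which it is not the root, so that every cycle owns its vertices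
  apart from the root.\<close>

definition key :: "digit list \<Rightarrow> digit list" where
  "key w = cyc (hd (dropWhile (\<lambda>x. x = D0) w)) w"

definition valid_key :: "digit list \<Rightarrow> bool" where
  "valid_key \<kappa> \<longleftrightarrow> length \<kappa> \<le> n \<and> (\<kappa> = [] \<or> hd \<kappa> \<noteq> D0 \<and> last_nonzero \<kappa> = d)"

abbreviation ht :: "digit list \<Rightarrow> digit list \<Rightarrow> nat" where
  "ht \<kappa> \<equiv> height (key_digit \<kappa>) \<kappa>"

lemma cycle_key_valid: "valid_key \<kappa> \<Longrightarrow> cycle_key (key_digit \<kappa>) \<kappa>"
  using d_nonzero by (cases "hd \<kappa>") (auto simp: valid_key_def cycle_key_def key_digit_def)

lemma ht_pos_side:
  assumes "valid_key \<kappa>" "length w = n" "0 < ht \<kappa> w"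
  shows "w \<in> side_verts d n"
proof -
  let ?k = "length w - length \<kappa>"
  have w: "drop ?k w = \<kappa>" "tail_val (key_digit \<kappa>) (take ?k w) \<noteq> 0"
    using assms(3) by (auto simp: height_def split: if_splits)
  have eq: "last_nonzero w = last_nonzero (take ?k w @ \<kappa>)" using w(1) by (metis append_take_drop_id)
  show ?thesis
  proof (cases "\<kappa> = []")
    case True
    have "tail_val d w \<noteq> 0" using w(2) True by (simp add: key_digit_def)
    then have "last_nonzero w = d" using tail_val_last_nonzero d_nonzero by blast
    then show ?thesis using assms(2) by (simp add: side_verts_def)
  next
    case False
    then have "last_nonzero \<kappa> = d" using assms(1) by (simp add: valid_key_def)
    then show ?thesis using eq assms(2) d_nonzero by (simp add: last_nonzero_append side_verts_def)
  qed
qed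

text \<open>For the first nonzero digit the position is positive; for the other digit the prefix
  consists of zeros and the position is 0. Positive height thus singles out the key among the two
  cycles through \<open>w\<close>.\<close>

lemma key_iff:
  assumes "w \<in> side_verts d n"
  shows "valid_key \<kappa> \<and> key w = \<kappa> \<longleftrightarrow> valid_key \<kappa> \<and> cyc (key_digit \<kappa>) w = \<kappa> \<and> 0 < ht \<kappa> w"
    and "valid_key (key w)"
proof -
  define e where "e = hd (dropWhile (\<lambda>x. x = D0) w)"
  have ne: "dropWhile (\<lambda>x. x = D0) w \<noteq> []"
  proof
    assume "dropWhile (\<lambda>x. x = D0) w = []"
    then have "\<forall>x\<in>set w. x = D0" by simp
    then have "w = zero_word (length w)" by (simp add: replicate_eqI)
    then show False using assms d_nonzero last_nonzero_eq_D0 by (simp add: side_verts_def)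
  qed
  have e: "e \<noteq> D0" unfolding e_def using hd_dropWhile[OF ne] by simp
  define z where "z = takeWhile (\<lambda>x. x = D0) w"
  define t where "t = tl (dropWhile (\<lambda>x. x = D0) w)"
  have w: "w = z @ e # t" using ne by (simp add: z_def e_def t_def)
  have z: "set z \<subseteq> {D0}" unfolding z_def using set_takeWhileD by fastforce
  have cw: "cyc e' w = (if e' = e then cyc e t else e # t)" "cyc_prefix e' w = (if e' = e then z @ e # cyc_prefix e t else z)"
    if "e' \<noteq> D0" for e'
  proof -
    have zz: "\<And>x. x \<in> set z \<Longrightarrow> x \<in> {D0, e'}" using z by blast
    show "cyc e' w = (if e' = e then cyc e t else e # t)"
    proof -
      have "dropWhile (\<lambda>x. x \<in> {D0, e'}) (z @ e # t) = dropWhile (\<lambda>x. x \<in> {D0, e'}) (e # t)"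
        by (rule dropWhile_append2) (use zz in blast)
      then show ?thesis unfolding w cyc_def using e by auto
    qed
    show "cyc_prefix e' w = (if e' = e then z @ e # cyc_prefix e t else z)"
    proof -
      have "takeWhile (\<lambda>x. x \<in> {D0, e'}) (z @ e # t) = z @ takeWhile (\<lambda>x. x \<in> {D0, e'}) (e # t)"
        by (rule takeWhile_append2) (use zz in blast)
      then show ?thesis unfolding w cyc_prefix_def using e by auto
    qed
  qed
  have pos: "0 < tail_val e (cyc_prefix e w)"
    using cw(2)[OF e] set_cyc_prefix[of e t] by (simp add: tail_val_append)
  have npos: "tail_val e' (cyc_prefix e' w) = 0" if "e' \<noteq> e" "e' \<noteq> D0" for e'
    using cw(2)[OF that(2)] that z by (auto intro!: tail_val_eq_0)
  have key: "key w = cyc e w" by (simp add: key_def e_def)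
  have lw: "length w = n" "last_nonzero w = d" using assms by (auto simp: side_verts_def)
  have kd: "key_digit (key w) = e"
  proof (cases "key w = []")
    case True
    then have "set w \<subseteq> {D0, e}" using key cyc_split[of e w] set_cyc_prefix[of e w] by simp
    then have "d = e" using lw last_nonzero_in[of w] d_nonzero by auto
    moreover have "key_digit (key w) = d" using True by (simp add: key_digit_def)
    ultimately show ?thesis by simp
  next
    case False
    then have "hd (key w) = opp e" using key cyc_cases[OF e, of w] by simp
    then show ?thesis using False e by (cases e) (auto simp: key_digit_def)
  qed
  show valid: "valid_key (key w)"
  proof -
    have "length (key w) \<le> n" using lw key by (metis cyc_split le_add2 length_append)
    moreover have "key w = [] \<or> hd (key w) \<noteq> D0 \<and> last_nonzero (key w) = d"
    proof (cases "key w = []")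
      case False
      then have hd: "hd (key w) = opp e" using key cyc_cases[OF e, of w] by simp
      then have "last_nonzero (key w) \<noteq> D0" using False e last_nonzero_hd by simp
      then have "last_nonzero (cyc_prefix e w @ key w) = last_nonzero (key w)"
        by (simp add: last_nonzero_append)
      then show ?thesis using hd e lw key by simp
    qed simp
    ultimately show ?thesis by (simp add: valid_key_def)
  qed
  show "valid_key \<kappa> \<and> key w = \<kappa> \<longleftrightarrow> valid_key \<kappa> \<and> cyc (key_digit \<kappa>) w = \<kappa> \<and> 0 < ht \<kappa> w"
  proof
    assume "valid_key \<kappa> \<and> key w = \<kappa>"
    then show "valid_key \<kappa> \<and> cyc (key_digit \<kappa>) w = \<kappa> \<and> 0 < ht \<kappa> w"
      using kd key pos height_cyc[of e w] by auto
  next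
    assume *: "valid_key \<kappa> \<and> cyc (key_digit \<kappa>) w = \<kappa> \<and> 0 < ht \<kappa> w"
    then have "key_digit \<kappa> \<noteq> D0" using cycle_key_valid by (simp add: cycle_key_def)
    then have "key_digit \<kappa> = e" using npos[of "key_digit \<kappa>"] height_cyc[of "key_digit \<kappa>" w] * by auto
    then show "valid_key \<kappa> \<and> key w = \<kappa>" using * key by auto
  qed
qed

lemma same_cycle_eq:
  assumes "w \<in> side_verts d n" "w' \<in> side_verts d n" "key w = \<kappa>" "key w' = \<kappa>" "ht \<kappa> w = ht \<kappa> w'"
  shows "w = w'"
proof -
  have \<kappa>: "valid_key \<kappa>" using key_iff(2)[OF assms(1)] assms(3) by simp
  have *: "x = bits (key_digit \<kappa>) (n - length \<kappa>) (ht \<kappa> x) @ \<kappa>" if "x \<in> side_verts d n" "key x = \<kappa>" for x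
    using cyc_vertex_iff[OF cycle_key_valid[OF \<kappa>], of x n "ht \<kappa> x"] key_iff(1)[OF that(1), of \<kappa>] \<kappa> that
      height_less[of "key_digit \<kappa>" \<kappa> x] by (simp add: side_verts_def valid_key_def)
  show ?thesis using *[OF assms(1,3)] *[OF assms(2,4)] assms(5) by metis
qed

end

section \<open>The recurrent configurations on one side of the zero word\<close>

context side
begin

definition cfg :: "digit list set \<Rightarrow> digit list \<Rightarrow> nat" where
  "cfg Z w = (if w \<in> side_verts d n then if w \<in> Z then 2 else 3 else 0)"

lemma not_zero_word: "w \<in> side_verts d n \<Longrightarrow> w \<noteq> zero_word n"
  using zero_notin_side[OF d_nonzero] by blast

text \<open>The root of cycle \<open>\<kappa>\<close> is \<open>\<kappa>\<close> preceded by zeros.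
  Its other cycle takes in at least the first digit of \<open>\<kappa>\<close>, so keys get shorter
  towards the zero word.\<close>

lemma root_key:
  assumes "v \<in> side_verts d n" "valid_key \<kappa>" "cyc (key_digit \<kappa>) v = \<kappa>" "ht \<kappa> v = 0"
  shows "length (key v) < length \<kappa>"
proof -
  let ?e = "key_digit \<kappa>" and ?e' = "key_digit (key v)"
  have ck: "cycle_key ?e \<kappa>" "cycle_key ?e' (key v)"
    using cycle_key_valid assms key_iff(2) by auto
  have k: "cyc ?e' v = key v" "0 < ht (key v) v"
    using key_iff[OF assms(1)] by blast+
  have ne: "?e' \<noteq> ?e"
  proof
    assume "?e' = ?e"
    then have "key v = \<kappa>" using k(1) assms(3) by metis
    then show False using k(2) assms(4) by (metis less_irrefl)
  qed
  have lv: "length v = n" using assms(1) by (simp add: side_verts_def)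
  have "v = bits ?e (n - length \<kappa>) 0 @ \<kappa>"
    using cyc_vertex_iff[OF ck(1) lv, of 0] assms(2-4) by (simp add: valid_key_def)
  then have v: "v = zero_word (n - length \<kappa>) @ \<kappa>" by (simp add: bits_0)
  have "\<kappa> \<noteq> []" using v not_zero_word[OF assms(1)] by auto
  then have hd: "hd \<kappa> = opp ?e" using ck(1) by (simp add: cycle_key_def)
  then have hd': "hd \<kappa> = ?e'" using ne ck by (cases ?e; cases ?e') (auto simp: cycle_key_def)
  have "cyc ?e' v = cyc ?e' \<kappa>"
    unfolding v cyc_def by (rule dropWhile_append2) auto
  also have "\<dots> = cyc ?e' (tl \<kappa>)"
    using hd' \<open>\<kappa> \<noteq> []\<close> by (cases \<kappa>) (auto simp: cyc_def)
  finally have "length (key v) \<le> length (tl \<kappa>)"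
    using k(1) by (metis cyc_def length_dropWhile_le)
  then show ?thesis using \<open>\<kappa> \<noteq> []\<close> by (cases \<kappa>) auto
qed

text \<open>Take a shortest key occurring in \<open>U\<close> and, among the vertices of
  \<open>U\<close> with this key, the lowest \<open>x\<close> and the highest \<open>y\<close>. The
  predecessor of \<open>x\<close> and the successor of \<open>y\<close> are outside
  \<open>U\<close>, since the root would have a shorter key. So both have degree at most 3 in
  \<open>U\<close>, or 2 if they coincide, and if they differ at most one of them is a gap.\<close>

lemma cfg_forbidden_free:
  assumes "inj_on key Z"
  shows "forbidden_free (cfg Z)"
  unfolding forbidden_free_def V_eq
proof (intro allI impI)
  fix U assume U: "U \<subseteq> side_verts d n" "U \<noteq> {}"
  then obtain w0 where w0: "w0 \<in> U" "\<And>w. w \<in> U \<Longrightarrow> length (key w0) \<le> length (key w)"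
    using ex_has_least_nat[of "\<lambda>w. w \<in> U" _ "\<lambda>w. length (key w)"] by blast
  define \<kappa> where "\<kappa> = key w0"
  have \<kappa>: "valid_key \<kappa>" using key_iff(2) w0 U by (auto simp: \<kappa>_def)
  have ck: "cycle_key (key_digit \<kappa>) \<kappa>" by (rule cycle_key_valid[OF \<kappa>])
  define m :: nat where "m = 2 ^ (n - length \<kappa>)"
  have less_m: "ht \<kappa> u < m" if "u \<in> U" for u
    using height_less[of "key_digit \<kappa>" \<kappa> u] that U(1) by (auto simp: m_def side_verts_def)
  have w0': "w0 \<in> U \<and> key w0 = \<kappa>" using w0 by (simp add: \<kappa>_def)
  obtain x where x: "x \<in> U" "key x = \<kappa>" "\<And>u. u \<in> U \<Longrightarrow> key u = \<kappa> \<Longrightarrow> ht \<kappa> x \<le> ht \<kappa> u"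
    using ex_has_least_nat[of "\<lambda>w. w \<in> U \<and> key w = \<kappa>", OF w0', of "ht \<kappa>"] by blast
  obtain y where y: "y \<in> U" "key y = \<kappa>" "\<And>u. u \<in> U \<Longrightarrow> key u = \<kappa> \<Longrightarrow> ht \<kappa> u \<le> ht \<kappa> y"
    using ex_has_greatest_nat[of "\<lambda>w. w \<in> U \<and> key w = \<kappa>", OF w0', of "ht \<kappa>" m] less_m by (metis less_imp_le_nat)
  have sv: "x \<in> side_verts d n" "y \<in> side_verts d n" using x y U by auto
  have lxy: "length x = n" "length y = n" using sv by (auto simp: side_verts_def)
  have cx: "cyc (key_digit \<kappa>) x = \<kappa>" "0 < ht \<kappa> x" and cy: "cyc (key_digit \<kappa>) y = \<kappa>" "0 < ht \<kappa> y"
    using key_iff(1)[OF sv(1), of \<kappa>] key_iff(1)[OF sv(2), of \<kappa>] x y \<kappa> by auto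
  obtain s where s: "gen_digit s = key_digit \<kappa>"
    using gen_digit_ex ck by (auto simp: cycle_key_def)
  have notin: "False" if "u \<in> U" "cyc (key_digit \<kappa>) u = \<kappa>" "ht \<kappa> u < ht \<kappa> x \<or> ht \<kappa> y < ht \<kappa> u" for u
  proof (cases "ht \<kappa> u = 0")
    case True
    have "length (key u) < length \<kappa>"
      using that(1) U(1) by (intro root_key[OF _ \<kappa> that(2) True]) blast
    then show False using w0(2)[OF that(1)] by (simp add: \<kappa>_def)
  next
    case False
    have "key u = \<kappa>" using key_iff(1)[of u \<kappa>] that U(1) \<kappa> False by auto
    then show False using x(3)[OF that(1)] y(3)[OF that(1)] that(3) by linarith
  qed
  have left: "act_inv s x \<notin> U"
  proof
    assume a: "act_inv s x \<in> U"
    have "ht \<kappa> (act_inv s x) = (ht \<kappa> x + m - 1) mod m"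
      using height_act_inv_same[of s x \<kappa>] cx(1) s lxy by (simp add: m_def)
    also have "ht \<kappa> x + m - 1 = (ht \<kappa> x - 1) + m" using cx(2) by simp
    also have "\<dots> mod m = ht \<kappa> x - 1" using less_m[OF x(1)] by (simp only: mod_add_self2) simp
    finally have "ht \<kappa> (act_inv s x) < ht \<kappa> x" using cx(2) by simp
    then show False using notin[OF a] cyc_act_inv[of s x] s cx(1) by simp
  qed
  have right: "act s y \<notin> U"
  proof
    assume a: "act s y \<in> U"
    have h: "ht \<kappa> (act s y) = (ht \<kappa> y + 1) mod m"
      using height_act_same[of s y \<kappa>] cy(1) s lxy by (simp add: m_def)
    show False
    proof (cases "ht \<kappa> y + 1 = m")
      case True
      then have "ht \<kappa> (act s y) < ht \<kappa> x" using h cx(2) by simp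
      then show False using notin[OF a] cyc_act[of s y] s cy(1) by simp
    next
      case False
      then have "ht \<kappa> y < ht \<kappa> (act s y)" using h less_m[OF y(1)] by simp
      then show False using notin[OF a] cyc_act[of s y] s cy(1) by simp
    qed
  qed
  have sub: "U \<subseteq> side_verts d n \<union> {zero_word n}" using U by blast
  have sum3: "(\<Sum>u\<in>U. ec x u) \<le> 3" "(\<Sum>u\<in>U. ec y u) \<le> 3"
    using left right sum_edge_count_side_nat[OF sub sv(1)] sum_edge_count_side_nat[OF sub sv(2)]
    by (simp_all add: sum_gen[of _ s])
  show "\<exists>v\<in>U. (\<Sum>u\<in>U. ec v u) \<le> cfg Z v"
  proof (cases "x = y")
    case True
    then have "(\<Sum>u\<in>U. ec x u) \<le> 2"
      using left right sum_edge_count_side_nat[OF sub sv(1)] by (simp add: sum_gen[of _ s])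
    then have "(\<Sum>u\<in>U. ec x u) \<le> cfg Z x" using sv by (simp add: cfg_def)
    then show ?thesis using x(1) by blast
  next
    case False
    then have "x \<notin> Z \<or> y \<notin> Z" using assms x(2) y(2) by (auto dest: inj_onD)
    then have "(\<Sum>u\<in>U. ec x u) \<le> cfg Z x \<or> (\<Sum>u\<in>U. ec y u) \<le> cfg Z y"
      using sum3 sv by (auto simp: cfg_def)
    then show ?thesis using x(1) y(1) by blast
  qed
qed

text \<open>\<open>U\<close> is the union of the branches hanging from the positions in
  \<open>A\<close>. By \<open>height_act_other\<close> it is left only along the cycle
  \<open>\<kappa>\<close>, and \<open>0 \<notin> A\<close> keeps it away from the zero word.\<close>

lemma block_degree:
  assumes "valid_key \<kappa>" "0 \<notin> A" "U = {u. length u = n \<and> ht \<kappa> u \<in> A}" "u \<in> U"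
  shows "u \<in> side_verts d n"
    and "cyc (key_digit \<kappa>) u \<noteq> \<kappa> \<Longrightarrow> (\<Sum>x\<in>U. ec u x) = 4"
    and "cyc (key_digit \<kappa>) u = \<kappa> \<Longrightarrow> (\<Sum>x\<in>U. ec u x)
      = 2 + (if (ht \<kappa> u + 1) mod 2 ^ (n - length \<kappa>) \<in> A then 1 else 0)
          + (if (ht \<kappa> u + 2 ^ (n - length \<kappa>) - 1) mod 2 ^ (n - length \<kappa>) \<in> A then 1 else 0)"
proof -
  have side: "w \<in> side_verts d n" if "w \<in> U" for w
    using ht_pos_side[OF assms(1), of w] that assms(2,3) by (metis (mono_tags) gr0I mem_Collect_eq)
  show "u \<in> side_verts d n" by (rule side[OF assms(4)])
  then have lu: "length u = n" by (simp add: side_verts_def)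
  have sub: "U \<subseteq> side_verts d n \<union> {zero_word n}" using side by blast
  have hu: "ht \<kappa> u \<in> A" using assms by simp
  have ck: "cycle_key (key_digit \<kappa>) \<kappa>" by (rule cycle_key_valid[OF assms(1)])
  obtain s where s: "gen_digit s = key_digit \<kappa>"
    using gen_digit_ex ck by (auto simp: cycle_key_def)
  have memU: "x \<in> U \<longleftrightarrow> ht \<kappa> x \<in> A" if "length x = n" for x
    using that assms(3) by simp
  have other: "act t u \<in> U \<and> act_inv t u \<in> U" if "\<not> (cyc (gen_digit t) u = \<kappa> \<and> key_digit \<kappa> = gen_digit t)" for t
    using height_act_other[OF ck that] height_act_inv_other[OF ck that] memU lu hu by simp
  note sum_eq = sum_edge_count_side_nat[OF sub side[OF assms(4)]]
  show "(\<Sum>x\<in>U. ec u x) = 4" if "cyc (key_digit \<kappa>) u \<noteq> \<kappa>"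
  proof -
    have "act t u \<in> U \<and> act_inv t u \<in> U" for t using other[of t] that by metis
    then show ?thesis unfolding sum_eq by (simp add: UNIV_gen)
  qed
  show "(\<Sum>x\<in>U. ec u x)
      = 2 + (if (ht \<kappa> u + 1) mod 2 ^ (n - length \<kappa>) \<in> A then 1 else 0)
          + (if (ht \<kappa> u + 2 ^ (n - length \<kappa>) - 1) mod 2 ^ (n - length \<kappa>) \<in> A then 1 else 0)"
    if c: "cyc (key_digit \<kappa>) u = \<kappa>"
  proof -
    have "act (other_gen s) u \<in> U \<and> act_inv (other_gen s) u \<in> U"
      using other[of "other_gen s"] s gen_digit_other by metis
    moreover have "act s u \<in> U \<longleftrightarrow> (ht \<kappa> u + 1) mod 2 ^ (n - length \<kappa>) \<in> A"
      using memU[of "act s u"] height_act_same[of s u \<kappa>] s c lu by simp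
    moreover have "act_inv s u \<in> U \<longleftrightarrow> (ht \<kappa> u + 2 ^ (n - length \<kappa>) - 1) mod 2 ^ (n - length \<kappa>) \<in> A"
      using memU[of "act_inv s u"] height_act_inv_same[of s u \<kappa>] s c lu by simp
    ultimately show ?thesis unfolding sum_eq sum_gen[of _ s] by simp
  qed
qed

text \<open>A vertex with at most one chip, or two vertices with at most two chips on the same cycle,
  give a forbidden subconfiguration together with everything hanging from the arc they span.\<close>

lemma burnable_arc:
  assumes c: "c \<in> burnable" and x: "x \<in> side_verts d n" "key x = \<kappa>"
    and y: "y \<in> side_verts d n" "key y = \<kappa>" and le: "ht \<kappa> x \<le> ht \<kappa> y"
    and small: "c x \<le> 2" "c y \<le> 2" "x = y \<Longrightarrow> c x \<le> 1"
  shows False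
proof -
  have \<kappa>: "valid_key \<kappa>" using key_iff(2)[OF x(1)] x(2) by simp
  define m :: nat where "m = 2 ^ (n - length \<kappa>)"
  define A where "A = {ht \<kappa> x .. ht \<kappa> y}"
  define U where "U = {u. length u = n \<and> ht \<kappa> u \<in> A}"
  have pos: "0 < ht \<kappa> x" "0 < ht \<kappa> y"
    using key_iff(1)[OF x(1), of \<kappa>] key_iff(1)[OF y(1), of \<kappa>] x y \<kappa> by auto
  then have A0: "0 \<notin> A" by (simp add: A_def)
  have less_m: "ht \<kappa> y < m"
    using height_less[of "key_digit \<kappa>" \<kappa> y] y by (auto simp: m_def side_verts_def)
  have "x \<in> U" using x le by (auto simp: U_def A_def side_verts_def)
  note blk = block_degree[OF \<kappa> A0 U_def]
  have "U \<subseteq> V" using blk(1) V_eq by blast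
  then obtain u where u: "u \<in> U" "(\<Sum>w\<in>U. ec u w) \<le> c u"
    using c \<open>x \<in> U\<close> unfolding burnable_def forbidden_free_def by blast
  have us: "u \<in> side_verts d n" by (rule blk(1)[OF u(1)])
  have "c u < 4" using c us dg_eq[OF us] by (auto simp: burnable_def stable_def V_eq)
  \<comment> \<open>Off the cycle all four edges stay in \<open>U\<close>, while a stable vertex has
    at most three chips.\<close>
  then have cu: "cyc (key_digit \<kappa>) u = \<kappa>" using blk(2)[OF u(1)] u(2) by fastforce
  have hu: "ht \<kappa> x \<le> ht \<kappa> u" "ht \<kappa> u \<le> ht \<kappa> y" using u(1) by (auto simp: U_def A_def)
  then have ku: "key u = \<kappa>" using key_iff(1)[OF us, of \<kappa>] cu pos \<kappa> by auto
  have up: "(ht \<kappa> u + 1) mod m \<in> A" if "ht \<kappa> u < ht \<kappa> y"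
    using that less_m hu by (simp add: A_def)
  have down: "(ht \<kappa> u + m - 1) mod m \<in> A" if "ht \<kappa> x < ht \<kappa> u"
  proof -
    have "ht \<kappa> u + m - 1 = (ht \<kappa> u - 1) + m" using that by simp
    then have "(ht \<kappa> u + m - 1) mod m = ht \<kappa> u - 1" using less_m hu by (simp only: mod_add_self2) simp
    moreover have "ht \<kappa> u - 1 \<in> A" using that hu unfolding A_def atLeastAtMost_iff by linarith
    ultimately show ?thesis by simp
  qed
  have deg: "(\<Sum>w\<in>U. ec u w) = 2 + (if (ht \<kappa> u + 1) mod m \<in> A then 1 else 0)
      + (if (ht \<kappa> u + m - 1) mod m \<in> A then 1 else 0)"
    using blk(3)[OF u(1) cu] by (simp add: m_def)
  have eqx: "u = x" if "ht \<kappa> u = ht \<kappa> x" by (rule same_cycle_eq[OF us x(1) ku x(2) that])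
  have eqy: "u = y" if "ht \<kappa> u = ht \<kappa> y" by (rule same_cycle_eq[OF us y(1) ku y(2) that])
  consider "ht \<kappa> u = ht \<kappa> x" "ht \<kappa> u = ht \<kappa> y" | "ht \<kappa> u = ht \<kappa> x" "ht \<kappa> u < ht \<kappa> y"
    | "ht \<kappa> u = ht \<kappa> y" "ht \<kappa> x < ht \<kappa> u" | "ht \<kappa> x < ht \<kappa> u" "ht \<kappa> u < ht \<kappa> y"
    using hu by linarith
  then show False
  proof cases
    case 1
    then have "u = x" "x = y" using eqx eqy by auto
    then have "c u \<le> 1" using small(3) by blast
    moreover have "2 \<le> (\<Sum>w\<in>U. ec u w)" unfolding deg by simp
    ultimately show ?thesis using u(2) by linarith
  next
    case 2
    then have "c u \<le> 2" using eqx small(1) by blast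
    moreover have "3 \<le> (\<Sum>w\<in>U. ec u w)" unfolding deg using up[OF 2(2)] by simp
    ultimately show ?thesis using u(2) by linarith
  next
    case 3
    then have "c u \<le> 2" using eqy small(2) by blast
    moreover have "3 \<le> (\<Sum>w\<in>U. ec u w)" unfolding deg using down[OF 3(2)] by simp
    ultimately show ?thesis using u(2) by linarith
  next
    case 4
    have "4 \<le> (\<Sum>w\<in>U. ec u w)" unfolding deg using up[OF 4(2)] down[OF 4(1)] by simp
    then show ?thesis using u(2) \<open>c u < 4\<close> by linarith
  qed
qed

text \<open>An arc reduced to one vertex excludes values below 2, and an arc between two vertices of
  value 2 excludes a second gap on the same cycle.\<close>

theorem burnable_eq: "burnable = cfg ` {Z. Z \<subseteq> side_verts d n \<and> inj_on key Z}"
proof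
  show "cfg ` {Z. Z \<subseteq> side_verts d n \<and> inj_on key Z} \<subseteq> burnable"
    using cfg_forbidden_free
    by (auto simp: burnable_def configs_def stable_def V_eq dg_eq cfg_def)
  show "burnable \<subseteq> cfg ` {Z. Z \<subseteq> side_verts d n \<and> inj_on key Z}"
  proof
    fix c assume c: "c \<in> burnable"
    have ge: "2 \<le> c w" if "w \<in> side_verts d n" for w
      using burnable_arc[OF c that refl that refl] by fastforce
    have lt: "c w < 4" if "w \<in> side_verts d n" for w
      using c that dg_eq[OF that] by (auto simp: burnable_def stable_def V_eq)
    define Z where "Z = {w \<in> side_verts d n. c w = 2}"
    have "inj_on key Z"
    proof (rule inj_onI, rule ccontr)
      fix x y assume xy: "x \<in> Z" "y \<in> Z" "key x = key y" "x \<noteq> y"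
      then have *: "x \<in> side_verts d n" "y \<in> side_verts d n" "c x = 2" "c y = 2" by (auto simp: Z_def)
      show False
      proof (cases "ht (key x) x \<le> ht (key x) y")
        case True
        then show False using burnable_arc[OF c *(1) refl *(2) xy(3)[symmetric]] * xy(4) by simp
      next
        case False
        then have "ht (key x) y \<le> ht (key x) x" by simp
        then show False using burnable_arc[OF c *(2) xy(3)[symmetric] *(1) refl] * xy(4) by simp
      qed
    qed
    moreover have "c = cfg Z"
    proof
      fix w
      show "c w = cfg Z w"
      proof (cases "w \<in> side_verts d n")
        case True
        then show ?thesis using ge[OF True] lt[OF True] by (auto simp: cfg_def Z_def)
      next
        case False
        then show ?thesis using c by (simp add: cfg_def burnable_def configs_def V_eq)
      qed
    qed
    moreover have "Z \<subseteq> side_verts d n" unfolding Z_def by blast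
    ultimately show "c \<in> cfg ` {Z. Z \<subseteq> side_verts d n \<and> inj_on key Z}"
      by blast
  qed
qed

lemma inj_cfg: "inj_on cfg {Z. Z \<subseteq> side_verts d n}"
proof (rule inj_onI)
  fix Z Z' assume *: "Z \<in> {Z. Z \<subseteq> side_verts d n}" "Z' \<in> {Z. Z \<subseteq> side_verts d n}" "cfg Z = cfg Z'"
  have "Y = {w \<in> side_verts d n. cfg Y w = 2}" if "Y \<subseteq> side_verts d n" for Y
    using that by (auto simp: cfg_def split: if_splits)
  from this[of Z] this[of Z'] show "Z = Z'" using * by simp
qed

end

section \<open>The avalanche on a single cycle\<close>

text \<open>\<open>r\<close> chips are dropped at position \<open>i\<close> of a cycle of length \<open>m\<close> whose root is at position
  0; \<open>z\<close> is the position of the vertex that lacks a chip (0 if there is none), and it moves to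
  \<open>z - r i\<close> modulo \<open>m\<close>. The profile is the number of firings relative to the root.\<close>

definition new_gap :: "nat \<Rightarrow> nat \<Rightarrow> nat \<Rightarrow> nat \<Rightarrow> nat" where
  "new_gap m i r z = nat ((int z - int r * int i) mod int m)"

definition ramp :: "int \<Rightarrow> int \<Rightarrow> int" where
  "ramp a y = max 0 (y - a)"

text \<open>The initial slope for which the profile is back at 0 after one turn; the division is
  exact by the choice of the new gap.\<close>

definition slope :: "nat \<Rightarrow> nat \<Rightarrow> nat \<Rightarrow> nat \<Rightarrow> int" where
  "slope m i r z = (int r * (int m - int i)
     + of_bool (new_gap m i r z \<noteq> 0) * (int m - int (new_gap m i r z))
     - of_bool (z \<noteq> 0) * (int m - int z)) div int m"

definition profile :: "nat \<Rightarrow> nat \<Rightarrow> nat \<Rightarrow> nat \<Rightarrow> int \<Rightarrow> int" where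
  "profile m i r z y = slope m i r z * y - int r * ramp (int i) y
     - of_bool (new_gap m i r z \<noteq> 0) * ramp (int (new_gap m i r z)) y
     + of_bool (z \<noteq> 0) * ramp (int z) y"

text \<open>A gap that disappears retains a chip, a gap that appears releases one.\<close>

definition outflow :: "nat \<Rightarrow> nat \<Rightarrow> nat \<Rightarrow> nat \<Rightarrow> nat" where
  "outflow m i r z = r + (if new_gap m i r z = 0 then 0 else 1) - (if z = 0 then 0 else 1)"

definition cycle_source :: "nat \<Rightarrow> nat \<Rightarrow> nat \<Rightarrow> nat \<Rightarrow> int \<Rightarrow> int" where
  "cycle_source m i r z y = (if y = int i then int r else 0)
     + (if new_gap m i r z \<noteq> 0 \<and> y = int (new_gap m i r z) then 1 else 0)
     - (if z \<noteq> 0 \<and> y = int z then 1 else 0)"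

locale gap_cycle =
  fixes m i r z :: nat
  assumes i: "0 < i" "i < m" and z: "z < m"
begin

abbreviation z' where "z' \<equiv> new_gap m i r z"
abbreviation g where "g \<equiv> profile m i r z"

lemma z'_less: "z' < m"
  using i by (simp add: new_gap_def nat_less_iff)

lemma int_z': "int z' = (int z - int r * int i) mod int m"
  using i by (simp add: new_gap_def)

abbreviation \<alpha> :: int where "\<alpha> \<equiv> of_bool (z' \<noteq> 0)"
abbreviation \<beta> :: int where "\<beta> \<equiv> of_bool (z \<noteq> 0)"

lemma slope_eq: "int m * slope m i r z
    = int r * (int m - int i) + \<alpha> * (int m - int z') - \<beta> * (int m - int z)"
proof -
  define q where "q = (int z - int r * int i) div int m"
  have *: "int z - int r * int i = int z' + q * int m"
    unfolding int_z' q_def by simp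
  have ab: "\<alpha> * int z' = int z'" "\<beta> * int z = int z" by auto
  have "int r * (int m - int i) + \<alpha> * (int m - int z') - \<beta> * (int m - int z)
      = int r * int m - int r * int i + \<alpha> * int m - \<alpha> * int z' - \<beta> * int m + \<beta> * int z"
    by (simp only: algebra_simps)
  also have "\<dots> = int m * (int r + \<alpha> - \<beta> + q)"
    unfolding ab using * by (simp only: algebra_simps)
  finally have "int m dvd int r * (int m - int i) + \<alpha> * (int m - int z') - \<beta> * (int m - int z)"
    by (rule dvdI)
  then show ?thesis unfolding slope_def by (rule dvd_mult_div_cancel)
qed

lemma profile_0: "g 0 = 0"
  by (simp add: profile_def ramp_def)

lemma profile_m: "g (int m) = 0"
proof -
  have "g (int m) = int m * slope m i r z - int r * (int m - int i)
     - \<alpha> * (int m - int z') + \<beta> * (int m - int z)"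
    using i z z'_less by (simp add: profile_def ramp_def mult.commute)
  then show ?thesis unfolding slope_eq by simp
qed

lemma ramp_diff: "ramp a (y + 1) + ramp a (y - 1) - 2 * ramp a y = (if y = a then 1 else 0)"
  by (auto simp: ramp_def max_def)

lemma profile_laplace: "2 * g y - g (y + 1) - g (y - 1) = cycle_source m i r z y"
proof -
  let ?D = "\<lambda>a. ramp a (y + 1) + ramp a (y - 1) - 2 * ramp a y"
  have "2 * g y - g (y + 1) - g (y - 1) = int r * ?D (int i) + \<alpha> * ?D (int z') - \<beta> * ?D (int z)"
    by (simp only: profile_def algebra_simps)
  then show ?thesis unfolding ramp_diff cycle_source_def by auto
qed

text \<open>A gap can disappear only if chips arrive, so the subtraction in \<open>outflow\<close>
  does not truncate.\<close>

lemma outflow_int: "int (outflow m i r z) = int r + \<alpha> - \<beta>"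
proof -
  have r: "0 < r" if "z \<noteq> 0" "z' = 0"
  proof (rule ccontr)
    assume "\<not> 0 < r"
    then show False using that int_z' z by simp
  qed
  show ?thesis using r by (cases "z = 0"; cases "z' = 0") (auto simp: outflow_def)
qed

lemma profile_outflow: "g 1 + g (int m - 1) = int (outflow m i r z)"
proof -
  have rampm: "ramp (int a) (int m - 1) = int m - 1 - int a" if "a < m" for a
    using that by (simp add: ramp_def)
  have zero: "\<alpha> * ramp (int z') 1 = 0" "\<beta> * ramp (int z) 1 = 0" "ramp (int i) 1 = 0"
    using i by (auto simp: ramp_def)
  have "g 1 + g (int m - 1) = int m * slope m i r z - int r * (int m - 1 - int i)
     - \<alpha> * (int m - 1 - int z') + \<beta> * (int m - 1 - int z)"
    unfolding profile_def zero rampm[OF i(2)] rampm[OF z] rampm[OF z'_less]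
    by (simp add: algebra_simps)
  then show ?thesis unfolding slope_eq outflow_int by (simp add: algebra_simps)
qed

text \<open>The profile is concave except at \<open>z\<close>, where its second difference is at most 1.\<close>

lemma profile_nonneg:
  assumes "0 \<le> y" "y \<le> int m"
  shows "0 \<le> g y"
proof (rule ccontr)
  assume neg: "\<not> 0 \<le> g y"
  let ?S = "{0..int m}"
  define \<mu> where "\<mu> = Min (g ` ?S)"
  have \<mu>: "\<mu> \<in> g ` ?S" unfolding \<mu>_def using assms by (intro Min_in) auto
  have le: "\<mu> \<le> g x" if "0 \<le> x" "x \<le> int m" for x unfolding \<mu>_def using that by (intro Min_le) auto
  have \<mu>neg: "\<mu> < 0" using le[OF assms] neg by simp
  let ?T = "{x \<in> ?S. g x = \<mu>}"
  have T: "finite ?T" by (rule finite_subset[of _ ?S]) auto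
  moreover have "?T \<noteq> {}" using \<mu> by auto
  ultimately have T: "finite ?T" "?T \<noteq> {}" by blast+
  \<comment> \<open>At the leftmost and at the rightmost minimum the second difference is positive,
    which happens only at \<open>z\<close>. So both are \<open>z\<close>, the minimum is strict on
    both sides, and the second difference there is at least 2.\<close>
  define a where "a = Min ?T"
  define b where "b = Max ?T"
  have a: "a \<in> ?T" "\<And>x. x \<in> ?T \<Longrightarrow> a \<le> x" unfolding a_def using T Min_in[OF T] by auto
  have b: "b \<in> ?T" "\<And>x. x \<in> ?T \<Longrightarrow> x \<le> b" unfolding b_def using T Max_in[OF T] by auto
  have inner: "0 < x \<and> x < int m" if "x \<in> ?T" for x
    using that profile_0 profile_m \<mu>neg by (cases "x = 0"; cases "x = int m") auto
  have low: "\<mu> + 1 \<le> g (a - 1)" "\<mu> \<le> g (a + 1)" "\<mu> \<le> g (b - 1)" "\<mu> + 1 \<le> g (b + 1)"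
  proof -
    have "a - 1 \<notin> ?T" "b + 1 \<notin> ?T" using a(2)[of "a - 1"] b(2)[of "b + 1"] by auto
    then have "g (a - 1) \<noteq> \<mu>" "g (b + 1) \<noteq> \<mu>" using inner[OF a(1)] inner[OF b(1)] by auto
    then show "\<mu> + 1 \<le> g (a - 1)" "\<mu> \<le> g (a + 1)" "\<mu> \<le> g (b - 1)" "\<mu> + 1 \<le> g (b + 1)"
      using le[of "a - 1"] le[of "a + 1"] le[of "b - 1"] le[of "b + 1"] inner[OF a(1)] inner[OF b(1)] by auto
  qed
  have src: "- 1 \<le> cycle_source m i r z x" "cycle_source m i r z x < 0 \<Longrightarrow> x = int z" for x
    by (auto simp: cycle_source_def split: if_splits)
  have "cycle_source m i r z a < 0" "cycle_source m i r z b < 0"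
    using low a(1) b(1) profile_laplace[of a] profile_laplace[of b] by auto
  then have ab: "a = int z" "b = int z" using src(2) by blast+
  then have "cycle_source m i r z a \<le> - 2"
    using low a(1) profile_laplace[of a] by auto
  then show False using src(1)[of a] by simp
qed

text \<open>If the profile vanished at the entry, its nonnegative neighbours could only bring chips
  there. With \<open>r > 0\<close> this forces a single chip arriving on the gap, and then nothing
  flows out.\<close>

lemma profile_entry_pos:
  assumes "0 < r" "0 < outflow m i r z"
  shows "0 < g (int i)"
proof (rule ccontr)
  assume "\<not> 0 < g (int i)"
  then have "g (int i) \<le> 0" by simp
  then have "cycle_source m i r z (int i) \<le> 0"
    using profile_laplace[of "int i"] profile_nonneg[of "int i + 1"] profile_nonneg[of "int i - 1"] i by simp
  then have "r = 1" "z = i" using assms(1) i by (auto simp: cycle_source_def split: if_splits)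
  then have "z' = 0" by (simp add: new_gap_def)
  then show False using assms(2) \<open>r = 1\<close> \<open>z = i\<close> i by (simp add: outflow_def)
qed

lemma profile_eq_0:
  assumes "outflow m i r z = 0" "r \<le> 1"
  shows "g y = 0"
proof (cases "r = 0")
  case True
  then have zz: "z' = z" using int_z' z by simp
  then have "slope m i r z = 0" using slope_eq i True by simp
  then show ?thesis using True zz by (simp add: profile_def)
next
  case False
  then have r: "r = 1" using assms by simp
  then have zz: "z' = 0" "z \<noteq> 0" using assms(1) by (auto simp: outflow_def split: if_splits)
  then have "(int z - int i) mod int m = 0" using int_z' r by simp
  then have "int m dvd int z - int i" by (simp add: dvd_eq_mod_eq_0)
  moreover have "\<bar>int z - int i\<bar> < int m" using z i by linarith
  ultimately have "int z - int i = 0"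
    using dvd_imp_le_int[of "int z - int i" "int m"] by (cases "int z - int i = 0") auto
  then have "z = i" by simp
  have "int m * slope m i r z = 0"
    using slope_eq zz(2) r \<open>z = i\<close> unfolding zz(1) by simp
  then have "slope m i r z = 0" using i by simp
  then show ?thesis using zz r \<open>z = i\<close> by (simp add: profile_def)
qed

lemma outflow_r0: "r = 0 \<Longrightarrow> outflow m i r z = 0"
proof -
  assume "r = 0"
  then have "z' = z" using int_z' z by simp
  then show ?thesis using \<open>r = 0\<close> by (simp add: outflow_def)
qed

lemma outflow_0_cases:
  assumes "0 < r" "outflow m i r z = 0"
  shows "r = 1 \<and> z = i"
proof -
  have r: "r = 1" "z' = 0" "z \<noteq> 0" using assms by (auto simp: outflow_def split: if_splits)
  then have "(int z - int i) mod int m = 0" using int_z' by simp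
  then have "int m dvd int z - int i" by (simp add: dvd_eq_mod_eq_0)
  moreover have "\<bar>int z - int i\<bar> < int m" using z i by linarith
  ultimately have "int z - int i = 0"
    using dvd_imp_le_int[of "int z - int i" "int m"] by (cases "int z - int i = 0") auto
  then have "z = i" by simp
  then show ?thesis using r by simp
qed

lemma z'_1_ge: "r = 1 \<Longrightarrow> i \<le> z \<Longrightarrow> int z' = int z - int i"
  using int_z' z by (simp add: mod_pos_pos_trivial)

lemma z'_1_less:
  assumes "r = 1" "z < i"
  shows "int z' = int z - int i + int m"
proof -
  have "(int z - int i) mod int m = (int z - int i + int m) mod int m" by simp
  also have "\<dots> = int z - int i + int m" using assms z i by (intro mod_pos_pos_trivial) auto
  finally show ?thesis using int_z' assms by simp
qed

definition arc :: "nat set" where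
  "arc = (if i < z then {1..<z} else {Suc z..<m})"

text \<open>One chip leaving the cycle while \<open>r > 0\<close> chips enter it forces \<open>r = 1\<close>, or \<open>r = 2\<close> with the
  gap filled at \<open>2 i\<close>; in both cases the profile is the trapezoid over the arc from the root to
  the gap that contains \<open>i\<close>.\<close>

lemma profile_support:
  assumes "0 < r" "outflow m i r z = 1"
  shows "z \<noteq> 0" "z \<noteq> i" "y < m \<Longrightarrow> 0 < g (int y) \<longleftrightarrow> y \<in> arc"
proof -
  have dvd_small: "\<exists>q. int z - int r * int i = int z' + q * int m"
    unfolding int_z' by (metis add.commute mod_mult_div_eq mult.commute)
  \<comment> \<open>\<open>t\<close> is the second place where the slope drops: the new gap if one
    chip arrives, \<open>i\<close> itself if two chips arrive and fill the gap. Both cases then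
    share one formula.\<close>
  have ex: "z \<noteq> 0 \<and> z \<noteq> i \<and> (\<exists>t::nat. 0 < t \<and> t < m \<and>
      (i < z \<and> int t = int z - int i \<or> z < i \<and> int t = int z - int i + int m) \<and>
      (\<forall>y. g y = slope m i r z * y - ramp (int i) y - ramp (int t) y + ramp (int z) y) \<and>
      int m * slope m i r z = (int m - int i) + (int m - int t) - (int m - int z))"
  proof (cases "r = 1")
    case True
    have zne: "z \<noteq> 0"
    proof
      assume z0: "z = 0"
      then have "int z' = int z - int i + int m" using z'_1_less[OF True] i by linarith
      then have "z' \<noteq> 0" using i by linarith
      then show False using assms(2) True z0 unfolding outflow_def by (simp split: if_splits)
    qed
    have z'ne: "z' \<noteq> 0"
    proof
      assume "z' = 0"
      then show False using assms(2) True zne unfolding outflow_def by (simp split: if_splits)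
    qed
    have "z \<noteq> i"
    proof
      assume "z = i"
      then have "int z' = 0" using z'_1_ge[OF True] by simp
      then show False using z'ne by linarith
    qed
    have zz: "i < z \<and> int z' = int z - int i \<or> z < i \<and> int z' = int z - int i + int m"
      using z'_1_ge[OF True] z'_1_less[OF True] \<open>z \<noteq> i\<close> by linarith
    have "int r = 1" "\<alpha> = 1" "\<beta> = 1" using True zne z'ne by auto
    then have "int m * slope m i r z = (int m - int i) + (int m - int z') - (int m - int z)"
      "g y = slope m i r z * y - ramp (int i) y - ramp (int z') y + ramp (int z) y" for y
      unfolding slope_eq profile_def by (simp_all only: mult_1)
    then show ?thesis using zne \<open>z \<noteq> i\<close> zz z'ne z'_less by blast
  next
    case False
    then have r2: "r = 2" "z \<noteq> 0" "z' = 0" using assms by (auto simp: outflow_def split: if_splits)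
    then obtain q where q: "int z = 2 * int i + q * int m"
      using dvd_small by (auto simp: algebra_simps)
    have "q = 0 \<or> q = -1"
    proof -
      have "q * int m < 1 * int m" using q z i by linarith
      then have "q < 1" using i by (auto simp only: mult_less_cancel_right)
      moreover have "(-2) * int m < q * int m" using q z i by linarith
      then have "-2 < q" using i by (auto simp only: mult_less_cancel_right)
      ultimately show ?thesis by linarith
    qed
    then have zi: "i < z \<and> int i = int z - int i \<or> z < i \<and> int i = int z - int i + int m"
      using q i by auto
    then have "z \<noteq> i" by auto
    have "int r = 2" "\<alpha> = 0" "\<beta> = 1" using r2 by auto
    then have "int m * slope m i r z = (int m - int i) + (int m - int i) - (int m - int z)"
      "g y = slope m i r z * y - ramp (int i) y - ramp (int i) y + ramp (int z) y" for y
      unfolding slope_eq profile_def by simp_all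
    then show ?thesis using r2 zi i \<open>z \<noteq> i\<close> by blast
  qed
  then obtain t :: nat where zne: "z \<noteq> 0" "z \<noteq> i" and t: "0 < t" "t < m"
    "i < z \<and> int t = int z - int i \<or> z < i \<and> int t = int z - int i + int m"
    and gt: "\<And>y. g y = slope m i r z * y - ramp (int i) y - ramp (int t) y + ramp (int z) y"
    and sl: "int m * slope m i r z = (int m - int i) + (int m - int t) - (int m - int z)"
    by blast
  show "z \<noteq> 0" "z \<noteq> i" by (fact zne)+
  show "0 < g (int y) \<longleftrightarrow> y \<in> arc" if "y < m"
  proof (cases "i < z")
    \<comment> \<open>For \<open>i < z\<close> the profile rises from the root with slope 1 and is
      back at 0 at \<open>z\<close>; otherwise it is 0 up to \<open>z\<close> and positive from
      there until the root is reached again.\<close>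
    case True
    then have "int m * slope m i r z = int m * 1" using sl t by auto
    then have "slope m i r z = 1" using i by simp
    then show ?thesis using True t that z i
      by (auto simp: gt arc_def ramp_def max_def)
  next
    case False
    then have "int m * slope m i r z = int m * 0" using sl t by auto
    then have "slope m i r z = 0" using i by simp
    then show ?thesis using False t that z i zne
      by (auto simp: gt arc_def ramp_def max_def)
  qed
qed

lemma i_in_arc: "z \<noteq> i \<Longrightarrow> i \<in> arc"
  using i by (auto simp: arc_def)

end

section \<open>The chain of cycles from a boundary point to the root\<close>

text \<open>The flow is the number of chips arriving at the entry of the \<open>l\<close>-th cycle.\<close>

fun flow :: "(nat \<Rightarrow> nat) \<Rightarrow> (nat \<Rightarrow> nat) \<Rightarrow> (nat \<Rightarrow> nat) \<Rightarrow> nat \<Rightarrow> nat" where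
  "flow m i z 0 = 1"
| "flow m i z (Suc l) = outflow (m l) (i l) (flow m i z l) (z l)"

lemma flow_cong:
  assumes "\<And>t. t < l \<Longrightarrow> m t = m' t \<and> i t = i' t \<and> z t = z' t"
  shows "flow m i z l = flow m' i' z' l"
  using assms by (induction l) auto

text \<open>Position \<open>m\<close> is identified with the root at 0, where the profile vanishes
  from both sides; there the Laplacian is minus what the two neighbours send to the root.\<close>

lemma (in gap_cycle) cyclic_laplace:
  assumes "h < m"
  shows "2 * g (int h) - g (int ((h + 1) mod m)) - g (int ((h + m - 1) mod m))
    = (if h = 0 then - int (outflow m i r z) else cycle_source m i r z (int h))"
proof (cases "h = 0")
  case True
  have "1 < m" using i by simp
  then have "int ((h + 1) mod m) = 1" "int ((h + m - 1) mod m) = int m - 1"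
    using True by auto
  then show ?thesis using True profile_outflow profile_0 by simp
next
  case False
  have "h + m - 1 = (h - 1) + m" using False by simp
  then have "(h + m - 1) mod m = h - 1" using assms by (simp only: mod_add_self2) simp
  then have a: "int ((h + m - 1) mod m) = int h - 1" using False by simp
  have b: "g (int ((h + 1) mod m)) = g (int h + 1)"
  proof (cases "h + 1 = m")
    case True
    then have eq: "int h + 1 = int m" by simp
    show ?thesis unfolding eq using True profile_0 profile_m by simp
  next
    case False
    then show ?thesis using assms by (simp add: add.commute)
  qed
  show ?thesis unfolding a b using profile_laplace[of "int h"] False by simp
qed

lemma (in side) lap_side:
  assumes "u \<in> side_verts d n" "f (zero_word n) = 0"
  shows "lap f u = (\<Sum>s\<in>UNIV. 2 * f u - f (act s u) - f (act_inv s u))"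
proof -
  have "(\<Sum>v\<in>V. f v * int (ec v u)) = (\<Sum>v\<in>side_verts d n. f v * of_nat (ec u v))"
    unfolding V_eq by (intro sum.cong) (auto simp: ec_sym)
  also have "\<dots> = (\<Sum>s\<in>UNIV. (if act s u \<in> side_verts d n then f (act s u) else 0)
      + (if act_inv s u \<in> side_verts d n then f (act_inv s u) else 0))"
    by (rule sum_edge_count_side[OF Un_upper1 assms(1)])
  also have "\<dots> = (\<Sum>s\<in>UNIV. f (act s u) + f (act_inv s u))"
  proof (rule sum.cong[OF refl])
    fix s
    show "(if act s u \<in> side_verts d n then f (act s u) else 0)
      + (if act_inv s u \<in> side_verts d n then f (act_inv s u) else 0) = f (act s u) + f (act_inv s u)"
      using side_verts_act[OF assms(1) d_nonzero, of s] assms(2) by auto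
  qed
  finally show ?thesis
    unfolding lap_def dg_eq[OF assms(1)] by (simp add: UNIV_gen algebra_simps)
qed

section \<open>Break positions of a boundary point\<close>

locale alternation =
  fixes \<xi> :: "digit stream" and k :: "nat \<Rightarrow> nat"
  assumes zeros_before: "t < k 0 \<Longrightarrow> \<xi> !! t = D0"
    and nonzero: "\<xi> !! k 0 \<noteq> D0"
    and step: "k l < k (Suc l)"
    and brk: "\<xi> !! k (Suc l) = opp (\<xi> !! k l)"
    and between: "k l \<le> t \<Longrightarrow> t < k (Suc l) \<Longrightarrow> \<xi> !! t \<in> {D0, \<xi> !! k l}"
begin

abbreviation e where "e l \<equiv> \<xi> !! k l"

definition seg :: "nat \<Rightarrow> nat \<Rightarrow> digit list" where
  "seg a b = stake (b - a) (sdrop a \<xi>)"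

text \<open>The position from which \<xi> hangs on cycle \<open>l\<close> if the part before the key
  has length \<open>b\<close>; \<open>b\<close> varies because a finite level cuts its last cycle
  short.\<close>

definition pos :: "nat \<Rightarrow> nat \<Rightarrow> nat" where
  "pos l b = tail_val (e l) (stake b \<xi>)"

lemma e_nonzero: "e l \<noteq> D0"
  by (induction l) (use nonzero brk in auto)

lemma strict_mono_k: "strict_mono k"
  using step by (simp add: strict_mono_Suc_iff)

lemma k_ge: "l \<le> k l"
  using strict_mono_k by (rule strict_mono_imp_increasing)

lemma stake_seg: "a \<le> b \<Longrightarrow> stake b \<xi> = stake a \<xi> @ seg a b"
  unfolding seg_def by (metis stake_add le_add_diff_inverse)

lemma length_seg [simp]: "length (seg a b) = b - a"
  by (simp add: seg_def)

lemma nth_seg: "j < b - a \<Longrightarrow> seg a b ! j = \<xi> !! (a + j)"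
  by (simp add: seg_def sdrop_snth)

lemma hd_seg: "a < b \<Longrightarrow> hd (seg a b) = \<xi> !! a"
  using nth_seg[of 0 b a] by (simp add: hd_conv_nth seg_def)

lemma seg_Cons: "a < b \<Longrightarrow> seg a b = \<xi> !! a # tl (seg a b)"
  using hd_seg[of a b] by (metis hd_Cons_tl length_0_conv length_seg zero_less_diff less_numeral_extra(3))

lemma set_seg: "b \<le> k (Suc l) \<Longrightarrow> set (seg (k l) b) \<subseteq> {D0, e l}"
proof
  fix x assume b: "b \<le> k (Suc l)" and "x \<in> set (seg (k l) b)"
  then obtain j where "j < b - k l" "x = \<xi> !! (k l + j)"
    by (metis in_set_conv_nth length_seg nth_seg)
  then show "x \<in> {D0, e l}" using between[of l "k l + j"] b by auto
qed

text \<open>Going back from \<open>k l\<close>, the first nonzero digit met, if any, is of the other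
  kind and cuts off \<open>tail_val\<close>.\<close>

lemma stake_k_tail_val: "tail_val (e l) (stake (k l) \<xi>) = 0"
proof (cases l)
  case 0
  have "e 0 \<notin> set (stake (k 0) \<xi>)"
    using zeros_before nonzero by (auto simp: in_set_conv_nth)
  then show ?thesis using 0 by (simp add: tail_val_eq_0)
next
  case (Suc l')
  have ss: "set (seg (k l') (k l)) \<subseteq> {D0, e l'}" using set_seg[of "k l" l'] Suc by simp
  have el: "e l = opp (e l')" using brk Suc by simp
  then have ne: "e l \<noteq> e l'" "e l \<noteq> D0" using e_nonzero[of l'] by auto
  have "e l' \<in> set (seg (k l') (k l))"
    using hd_seg[of "k l'" "k l"] step[of l'] Suc
    by (metis hd_in_set length_0_conv length_seg zero_less_diff less_numeral_extra(3))
  then have "\<not> set (seg (k l') (k l)) \<subseteq> {D0, e l}" using ne e_nonzero[of l'] by auto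
  moreover have "tail_val (e l) (seg (k l') (k l)) = 0"
    using ss ne by (intro tail_val_eq_0) auto
  moreover have "stake (k l) \<xi> = stake (k l') \<xi> @ seg (k l') (k l)"
    using step[of l'] Suc by (intro stake_seg) auto
  ultimately show ?thesis by (simp add: tail_val_append)
qed

lemma tail_val_seg:
  assumes "b \<le> k (Suc l)"
  shows "tail_val (e l) (u @ seg (k l) b) = tail_val (e l) u + 2 ^ length u * tail_val (e l) (seg (k l) b)"
  using set_seg[OF assms] by (simp add: tail_val_append)

lemma pos_seg:
  assumes "k l \<le> b" "b \<le> k (Suc l)"
  shows "pos l b = 2 ^ k l * tail_val (e l) (seg (k l) b)"
  unfolding pos_def stake_seg[OF assms(1)] tail_val_seg[OF assms(2)]
  by (simp add: stake_k_tail_val)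

lemma tail_val_append_seg:
  assumes "k l \<le> b" "b \<le> k (Suc l)" "length u = k l" "tail_val (e l) u = 0"
  shows "tail_val (e l) (u @ seg (k l) b) = pos l b"
  using assms by (simp add: tail_val_seg pos_seg)

lemma pos_bounds:
  assumes "k l < b" "b \<le> k (Suc l)"
  shows "0 < pos l b" "pos l b < 2 ^ b"
proof -
  note s = seg_Cons[OF assms(1)]
  have "set (seg (k l) b) \<subseteq> {D0, e l}" using set_seg assms by simp
  then have "set (tl (seg (k l) b)) \<subseteq> {D0, e l}" by (subst (asm) s) simp
  then have "0 < tail_val (e l) (seg (k l) b)" by (subst s) simp
  then show "0 < pos l b" using pos_seg[of l b] assms by simp
  show "pos l b < 2 ^ b" using tail_val_less[of "e l" "stake b \<xi>"] by (simp add: pos_def)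
qed

text \<open>A word with nonzero position on cycle \<open>l\<close> has \<open>e l\<close> as its
  last nonzero digit and adds nothing to the value for the next digit. So all that hangs from
  non-root vertices of cycle \<open>l\<close> hangs from the entry of cycle
  \<open>Suc l\<close>.\<close>

lemma tail_val_next:
  assumes "tail_val (e l) u \<noteq> 0" "length u = k (Suc l)" "b \<le> k (Suc (Suc l))" "k (Suc l) \<le> b"
  shows "tail_val (e (Suc l)) (u @ seg (k (Suc l)) b) = pos (Suc l) b"
proof (rule tail_val_append_seg)
  show "tail_val (e (Suc l)) u = 0"
  proof (rule ccontr)
    assume "tail_val (e (Suc l)) u \<noteq> 0"
    then have "e (Suc l) = e l"
      using tail_val_last_nonzero assms(1) e_nonzero by metis
    then show False using brk[of l] e_nonzero[of l] by simp
  qed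
qed (use assms in auto)

end

section \<open>The cycles between a prefix of length n and the zero word\<close>

locale alternation_level = alternation +
  fixes n N :: nat
  assumes level: "k N < n" "n \<le> k (Suc N)"
begin

sublocale side "e N" n
  by standard (rule e_nonzero)

abbreviation x where "x \<equiv> stake n \<xi>"

text \<open>Among the cycles \<open>0..N\<close> only the last one, through the zero word, can be
  cut short by the level; the others have their final length.\<close>

definition brkn :: "nat \<Rightarrow> nat" where "brkn l = min (k (Suc l)) n"

definition \<kappa> :: "nat \<Rightarrow> digit list" where "\<kappa> l = seg (brkn l) n"

definition mm :: "nat \<Rightarrow> nat" where "mm l = 2 ^ brkn l"

definition ii :: "nat \<Rightarrow> nat" where "ii l = pos l (brkn l)"

definition vx :: "nat \<Rightarrow> nat \<Rightarrow> digit list" where "vx l y = bits (e l) (brkn l) y @ \<kappa> l"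

text \<open>Consecutive cycles share a vertex: \<open>root (Suc l)\<close> is at position 0 of cycle
  \<open>l\<close> and at the entry position of cycle \<open>Suc l\<close>. The chain starts at
  \<open>x\<close> and ends at the zero word.\<close>

definition root :: "nat \<Rightarrow> digit list" where
  "root l = (if l \<le> N then zero_word (k l) @ seg (k l) n else zero_word n)"

lemma brkn_bounds:
  assumes "l \<le> N"
  shows "k l < brkn l" "brkn l \<le> k (Suc l)" "brkn l \<le> n"
proof -
  have "k l \<le> k N" using assms strict_mono_k by (simp add: strict_mono_less_eq)
  then show "k l < brkn l" "brkn l \<le> k (Suc l)" "brkn l \<le> n"
    using level step[of l] by (auto simp: brkn_def)
qed

lemma brkn_less:
  assumes "l < N"
  shows "brkn l = k (Suc l)" "brkn l < n"
proof -
  have "k (Suc l) \<le> k N" using assms strict_mono_k by (simp add: strict_mono_less_eq)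
  then show "brkn l = k (Suc l)" "brkn l < n" using level by (auto simp: brkn_def)
qed

lemma brkn_N: "brkn N = n"
  using level by (simp add: brkn_def)

lemma length_\<kappa>: "l \<le> N \<Longrightarrow> n - length (\<kappa> l) = brkn l" "length (\<kappa> l) \<le> n" "length (\<kappa> l) = n - brkn l"
  using brkn_bounds by (auto simp: \<kappa>_def)

lemma x_split: "l \<le> N \<Longrightarrow> x = stake (brkn l) \<xi> @ \<kappa> l"
  unfolding \<kappa>_def using brkn_bounds stake_seg by blast

lemma x_side: "x \<in> side_verts (e N) n"
proof -
  have s: "seg (k N) n \<noteq> []" "hd (seg (k N) n) = e N" using level hd_seg[of "k N" n] by (auto simp flip: length_0_conv)
  then have "last_nonzero (seg (k N) n) \<noteq> D0" using e_nonzero last_nonzero_hd by metis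
  moreover have "last_nonzero (seg (k N) n) \<in> {D0, e N}"
    using last_nonzero_in[of "seg (k N) n"] set_seg[OF level(2)] by blast
  ultimately have "last_nonzero x = e N"
    using level stake_seg[of "k N" n] by (simp add: last_nonzero_append)
  then show ?thesis by (simp add: side_verts_def)
qed

lemma \<kappa>_N: "\<kappa> N = []"
  using brkn_N length_\<kappa>(3)[of N] by simp

lemma \<kappa>_hd: "l < N \<Longrightarrow> \<kappa> l \<noteq> [] \<and> hd (\<kappa> l) = e (Suc l)"
  using brkn_less[of l] hd_seg[of "brkn l" n] length_\<kappa>(3)[of l] by (auto simp: \<kappa>_def simp flip: length_0_conv)

lemma key_digit_\<kappa>: "l \<le> N \<Longrightarrow> key_digit (\<kappa> l) = e l"
proof (cases "l = N")
  case True
  then show ?thesis by (simp add: key_digit_def \<kappa>_N)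
next
  case False
  assume "l \<le> N"
  then have "\<kappa> l \<noteq> []" "hd (\<kappa> l) = e (Suc l)" using False \<kappa>_hd[of l] by auto
  then show ?thesis using brk[of l] e_nonzero[of l] by (cases "e l") (auto simp: key_digit_def)
qed

lemma valid_\<kappa>: "l \<le> N \<Longrightarrow> valid_key (\<kappa> l)"
proof (cases "l = N")
  case True
  then show ?thesis by (simp add: valid_key_def \<kappa>_N)
next
  case False
  assume "l \<le> N"
  then have k: "\<kappa> l \<noteq> []" "hd (\<kappa> l) \<noteq> D0" using False \<kappa>_hd[of l] e_nonzero by auto
  then have "last_nonzero (\<kappa> l) \<noteq> D0" using last_nonzero_hd by blast
  then have "last_nonzero (\<kappa> l) = last_nonzero x"
    by (simp add: x_split[OF \<open>l \<le> N\<close>] last_nonzero_append)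
  then show ?thesis using k x_side length_\<kappa>(2) by (simp add: valid_key_def side_verts_def)
qed

lemma cycle_key_\<kappa>: "l \<le> N \<Longrightarrow> cycle_key (e l) (\<kappa> l)"
  using cycle_key_valid[OF valid_\<kappa>] key_digit_\<kappa> by simp

lemma inj_\<kappa>: "inj_on \<kappa> {..N}"
proof (rule linorder_inj_onI')
  fix l l' assume l: "l \<in> {..N}" "l' \<in> {..N}" "l < l'"
  then have "k (Suc l) \<le> k l'" using strict_mono_k by (simp add: strict_mono_less_eq)
  then have "brkn l < brkn l'"
    using brkn_less[of l] brkn_bounds(1)[of l'] l by simp
  then have "length (\<kappa> l) \<noteq> length (\<kappa> l')"
    using length_\<kappa>(1)[of l] length_\<kappa>(1)[of l'] l by auto
  then show "\<kappa> l \<noteq> \<kappa> l'" by auto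
qed

abbreviation hh :: "nat \<Rightarrow> digit list \<Rightarrow> nat" where "hh l \<equiv> height (e l) (\<kappa> l)"

lemma hh_less: "l \<le> N \<Longrightarrow> length u = n \<Longrightarrow> hh l u < mm l"
  using height_less[of "e l" "\<kappa> l" u] length_\<kappa>(1)[of l] by (simp add: mm_def)

lemma ii_bounds: "l \<le> N \<Longrightarrow> 0 < ii l \<and> ii l < mm l"
  using pos_bounds[of l "brkn l"] brkn_bounds[of l] by (simp add: ii_def mm_def)

lemma vx_iff: "l \<le> N \<Longrightarrow> length u = n \<Longrightarrow> y < mm l \<Longrightarrow> cyc (e l) u = \<kappa> l \<and> hh l u = y \<longleftrightarrow> u = vx l y"
  using cyc_vertex_iff[OF cycle_key_\<kappa>, of l u n y] length_\<kappa>[of l] by (simp add: vx_def mm_def)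

lemma length_vx: "l \<le> N \<Longrightarrow> length (vx l y) = n"
  using brkn_bounds(3)[of l] length_\<kappa>(3)[of l] by (simp add: vx_def)

lemma vx_side:
  assumes "l \<le> N" "0 < y" "y < mm l"
  shows "vx l y \<in> side_verts (e N) n" "key (vx l y) = \<kappa> l" "hh l (vx l y) = y"
proof -
  have c: "cyc (e l) (vx l y) = \<kappa> l" "hh l (vx l y) = y"
    using vx_iff[OF assms(1) length_vx[OF assms(1)] assms(3), of y] by auto
  then show "hh l (vx l y) = y" by simp
  show s: "vx l y \<in> side_verts (e N) n"
    using ht_pos_side[OF valid_\<kappa>[OF assms(1)] length_vx[OF assms(1)]] c key_digit_\<kappa>[OF assms(1)] assms(2) by simp
  show "key (vx l y) = \<kappa> l"
    using key_iff(1)[OF s, of "\<kappa> l"] valid_\<kappa>[OF assms(1)] c key_digit_\<kappa>[OF assms(1)] assms(2) by simp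
qed

lemma key_vx:
  assumes "l \<le> N" "u \<in> side_verts (e N) n" "key u = \<kappa> l"
  shows "u = vx l (hh l u)" "0 < hh l u" "hh l u < mm l"
proof -
  have lu: "length u = n" using assms by (simp add: side_verts_def)
  have "cyc (e l) u = \<kappa> l \<and> 0 < hh l u"
    using key_iff(1)[OF assms(2), of "\<kappa> l"] valid_\<kappa>[OF assms(1)] key_digit_\<kappa>[OF assms(1)] assms(3) by simp
  then show "u = vx l (hh l u)" "0 < hh l u" "hh l u < mm l"
    using vx_iff[OF assms(1) lu hh_less[OF assms(1) lu]] hh_less[OF assms(1) lu] by auto
qed

lemma root_0: "root 0 = x"
proof -
  have "stake (k 0) \<xi> = zero_word (k 0)"
    using zeros_before by (intro nth_equalityI) auto
  moreover have "k 0 \<le> n" using brkn_bounds[of 0] by simp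
  ultimately show ?thesis using stake_seg[of "k 0" n] by (simp add: root_def)
qed

lemma root_ii: "l \<le> N \<Longrightarrow> root l = vx l (ii l)"
proof -
  assume l: "l \<le> N"
  note b = brkn_bounds[OF l]
  have "seg (k l) n = seg (k l) (brkn l) @ \<kappa> l"
  proof -
    have "stake (k l) \<xi> @ seg (k l) n = stake (k l) \<xi> @ seg (k l) (brkn l) @ \<kappa> l"
      using stake_seg[of "k l" n] stake_seg[of "k l" "brkn l"] x_split[OF l] b by simp
    then show ?thesis by simp
  qed
  then have r: "root l = (zero_word (k l) @ seg (k l) (brkn l)) @ \<kappa> l" using l by (simp add: root_def)
  have len: "length (root l) = n" using r b length_\<kappa>(3)[of l] by simp
  have "tail_val (e l) (zero_word (k l)) = 0" using e_nonzero by (intro tail_val_eq_0) auto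
  then have "hh l (root l) = ii l"
    unfolding r height_append ii_def using b by (intro tail_val_append_seg) auto
  moreover have "cyc (e l) (root l) = \<kappa> l"
    unfolding r using set_seg[OF b(2)] cycle_key_\<kappa>[OF l] e_nonzero
    by (intro cyc_append) (auto simp: cycle_key_def)
  ultimately show ?thesis using vx_iff[OF l len] ii_bounds[OF l] by blast
qed

lemma root_Suc: "l \<le> N \<Longrightarrow> root (Suc l) = vx l 0"
proof (cases "l = N")
  case True
  then show ?thesis using brkn_N \<kappa>_N by (simp add: root_def vx_def bits_0)
next
  case False
  assume "l \<le> N"
  then show ?thesis using False brkn_less[of l] by (simp add: root_def vx_def bits_0 \<kappa>_def)
qed

end

lemma sum_indicator_unique:
  assumes "finite A" "\<And>l l'. l \<in> A \<Longrightarrow> l' \<in> A \<Longrightarrow> P l \<Longrightarrow> P l' \<Longrightarrow> l = l'"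
  shows "(\<Sum>l\<in>A. if P l then 1 else 0 :: int) = (if \<exists>l\<in>A. P l then 1 else 0)"
proof (cases "\<exists>l\<in>A. P l")
  case True
  then obtain l where l: "l \<in> A" "P l" by blast
  have "(\<Sum>l'\<in>A. if P l' then 1 else 0 :: int) = (\<Sum>l'\<in>A. if l' = l then 1 else 0)"
    using assms(2) l by (intro sum.cong) auto
  then show ?thesis using l assms(1) by auto
qed auto

section \<open>The odometer of the chain of cycles\<close>

context alternation_level
begin

text \<open>For admissible \<open>Z\<close> the sum has at most one term: it is the position of the
  gap, and 0 if there is none.\<close>

definition gap :: "digit list set \<Rightarrow> nat \<Rightarrow> nat" where
  "gap Z l = (\<Sum>w\<in>{w\<in>Z. key w = \<kappa> l}. hh l w)"

definition admissible :: "digit list set \<Rightarrow> bool" where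
  "admissible Z \<longleftrightarrow> Z \<subseteq> side_verts (e N) n \<and> inj_on key Z"

lemma gap_cases:
  assumes "admissible Z" "l \<le> N"
  shows "gap Z l < mm l"
    and "u \<in> Z \<and> key u = \<kappa> l \<longleftrightarrow> gap Z l \<noteq> 0 \<and> u = vx l (gap Z l)"
proof -
  let ?S = "{w\<in>Z. key w = \<kappa> l}"
  have "gap Z l < mm l \<and> (u \<in> Z \<and> key u = \<kappa> l \<longleftrightarrow> gap Z l \<noteq> 0 \<and> u = vx l (gap Z l))" for u
  proof (cases "?S = {}")
    case True
    then have "gap Z l = 0" unfolding gap_def by (simp only: sum.empty)
    then show ?thesis using True by (auto simp: mm_def)
  next
    case False
    then obtain w where w: "w \<in> Z" "key w = \<kappa> l" by blast
    have "v = w" if "v \<in> Z" "key v = \<kappa> l" for v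
      using w that assms(1) unfolding admissible_def by (metis inj_onD)
    then have S: "?S = {w}" using w by blast
    then have g: "gap Z l = hh l w" unfolding gap_def by (simp only: sum.insert sum.empty finite.emptyI empty_iff simp_thms add_0_right)
    have ws: "w \<in> side_verts (e N) n" using w assms(1) by (auto simp: admissible_def)
    note kv = key_vx[OF assms(2) ws w(2)]
    have "u \<in> Z \<and> key u = \<kappa> l \<longleftrightarrow> u \<in> ?S" by simp
    also have "\<dots> \<longleftrightarrow> u = w" unfolding S by simp
    finally show ?thesis using kv g by auto
  qed
  then show "gap Z l < mm l" "u \<in> Z \<and> key u = \<kappa> l \<longleftrightarrow> gap Z l \<noteq> 0 \<and> u = vx l (gap Z l)"
    by blast+
qed

abbreviation chips :: "digit list set \<Rightarrow> nat \<Rightarrow> nat" where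
  "chips Z \<equiv> flow mm ii (gap Z)"

abbreviation cycle_profile :: "digit list set \<Rightarrow> nat \<Rightarrow> int \<Rightarrow> int" where
  "cycle_profile Z l \<equiv> profile (mm l) (ii l) (chips Z l) (gap Z l)"

abbreviation next_gap :: "digit list set \<Rightarrow> nat \<Rightarrow> nat" where
  "next_gap Z l \<equiv> new_gap (mm l) (ii l) (chips Z l) (gap Z l)"

text \<open>Each profile counts firings relative to the root of its cycle. It is extended constantly
  along everything hanging from the vertices of the cycle, and the relative counts add up along the
  chain.\<close>

definition firings :: "digit list set \<Rightarrow> digit list \<Rightarrow> int" where
  "firings Z u = (\<Sum>l\<le>N. cycle_profile Z l (int (hh l u)))"

abbreviation fired :: "digit list set \<Rightarrow> digit list set" where
  "fired Z \<equiv> {u \<in> side_verts (e N) n. 0 < firings Z u}"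

lemma gap_cycle_level: "admissible Z \<Longrightarrow> l \<le> N \<Longrightarrow> gap_cycle (mm l) (ii l) (gap Z l)"
  using ii_bounds gap_cases(1) by unfold_locales auto

lemma hh_zero: "l \<le> N \<Longrightarrow> hh l (zero_word n) = 0"
  using e_nonzero[of l] by (auto simp: height_def intro!: tail_val_eq_0)

lemma firings_zero: "admissible Z \<Longrightarrow> firings Z (zero_word n) = 0"
  unfolding firings_def
  by (intro sum.neutral) (auto simp: hh_zero gap_cycle.profile_0[OF gap_cycle_level])

text \<open>By the cactus property the height on cycle \<open>l\<close> varies only along the edges
  of this cycle, so the Laplacian of the extended profile is the cyclic one there and 0
  elsewhere.\<close>

lemma local_laplace:
  assumes "admissible Z" "l \<le> N" "length u = n"
  defines "g \<equiv> cycle_profile Z l"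
  shows "(\<Sum>s\<in>UNIV. 2 * g (int (hh l u)) - g (int (hh l (act s u))) - g (int (hh l (act_inv s u))))
    = (if cyc (e l) u = \<kappa> l then if hh l u = 0 then - int (chips Z (Suc l))
        else cycle_source (mm l) (ii l) (chips Z l) (gap Z l) (int (hh l u)) else 0)"
proof -
  interpret gc: gap_cycle "mm l" "ii l" "chips Z l" "gap Z l"
    by (rule gap_cycle_level[OF assms(1,2)])
  obtain s where s: "gen_digit s = e l" using gen_digit_ex e_nonzero by blast
  have other: "hh l (act t u) = hh l u" "hh l (act_inv t u) = hh l u"
    if "\<not> (cyc (gen_digit t) u = \<kappa> l \<and> e l = gen_digit t)" for t
    using height_act_other[OF cycle_key_\<kappa>[OF assms(2)] that] height_act_inv_other[OF cycle_key_\<kappa>[OF assms(2)] that] by auto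
  have o: "hh l (act (other_gen s) u) = hh l u" "hh l (act_inv (other_gen s) u) = hh l u"
    using other[of "other_gen s"] s gen_digit_other by metis+
  show ?thesis
  proof (cases "cyc (e l) u = \<kappa> l")
    case True
    have p: "2 ^ (length u - length (\<kappa> l)) = mm l" using assms(3) length_\<kappa>(1)[OF assms(2)] by (simp add: mm_def)
    have "hh l (act s u) = (hh l u + 1) mod mm l" "hh l (act_inv s u) = (hh l u + mm l - 1) mod mm l"
      using height_act_same[of s u "\<kappa> l"] height_act_inv_same[of s u "\<kappa> l"] True s p by simp_all
    then show ?thesis
      unfolding sum_gen[of _ s] o g_def
      using gc.cyclic_laplace[OF hh_less[OF assms(2,3)]] True by simp
  next
    case False
    have "hh l (act s u) = hh l u" "hh l (act_inv s u) = hh l u"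
      using other[of s] s False by metis+
    then show ?thesis unfolding sum_gen[of _ s] o using False by simp
  qed
qed

definition shifted :: "digit list set \<Rightarrow> digit list set" where
  "shifted Z = {w \<in> Z. key w \<notin> \<kappa> ` {..N}} \<union>
    {vx l (next_gap Z l) | l. l \<le> N \<and> next_gap Z l \<noteq> 0}"

lemma shifted_iff:
  assumes "admissible Z"
  shows "admissible (shifted Z)"
    and "u \<in> shifted Z \<longleftrightarrow> u \<in> Z \<and> key u \<notin> \<kappa> ` {..N} \<or>
      (\<exists>l\<in>{..N}. next_gap Z l \<noteq> 0 \<and>
        u = vx l (next_gap Z l))"
proof -
  let ?z = "\<lambda>l. next_gap Z l"
  have less: "?z l < mm l" if "l \<le> N" for l
    using gap_cycle.z'_less[OF gap_cycle_level[OF assms that]] .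
  have v: "vx l (?z l) \<in> side_verts (e N) n" "key (vx l (?z l)) = \<kappa> l" if "l \<le> N" "?z l \<noteq> 0" for l
    using vx_side[OF that(1), of "?z l"] less[OF that(1)] that(2) by auto
  have "inj_on key (shifted Z)"
  proof (rule inj_onI)
    fix a b assume ab: "a \<in> shifted Z" "b \<in> shifted Z" "key a = key b"
    show "a = b"
    proof (cases "key a \<in> \<kappa> ` {..N}")
      case True
      then obtain l l' where "l \<le> N" "l' \<le> N" "a = vx l (?z l)" "b = vx l' (?z l')" "?z l \<noteq> 0" "?z l' \<noteq> 0"
        using ab by (auto simp: shifted_def)
      moreover from this have "l = l'" using v ab(3) inj_\<kappa> by (metis atMost_iff inj_onD)
      ultimately show ?thesis by simp
    next
      case False
      have "y \<in> Z" if "y \<in> shifted Z" "key y \<notin> \<kappa> ` {..N}" for y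
        using that v by (auto simp: shifted_def)
      then have "a \<in> Z" "b \<in> Z" using ab False by auto
      then show ?thesis using assms ab(3) by (auto simp: admissible_def dest: inj_onD)
    qed
  qed
  then show "admissible (shifted Z)"
    using assms v by (auto simp: admissible_def shifted_def)
  show "u \<in> shifted Z \<longleftrightarrow> u \<in> Z \<and> key u \<notin> \<kappa> ` {..N} \<or>
      (\<exists>l\<in>{..N}. ?z l \<noteq> 0 \<and> u = vx l (?z l))"
    by (auto simp: shifted_def)
qed

text \<open>At each common vertex the outflow of one cycle cancels the inflow of the next, so these
  terms telescope to the chip at \<open>x\<close> and the chips lost at the zero word. The other
  terms trade the old gaps for the new ones.\<close>

lemma lap_firings:
  assumes Z: "admissible Z" and u: "u \<in> side_verts (e N) n"
  shows "lap (firings Z) u = (if u = x then 1 else 0)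
    + (if u \<in> shifted Z then 1 else 0) - (if u \<in> Z then 1 else 0)"
proof -
  let ?z = "\<lambda>l. next_gap Z l"
  let ?g = "\<lambda>l. cycle_profile Z l"
  have lu: "length u = n" using u by (simp add: side_verts_def)
  have less: "?z l < mm l" if "l \<le> N" for l
    using gap_cycle.z'_less[OF gap_cycle_level[OF Z that]] .
  let ?A = "\<lambda>l. if u = root l then int (chips Z l) else 0"
  let ?B = "\<lambda>l. if ?z l \<noteq> 0 \<and> u = vx l (?z l) then 1 else 0 :: int"
  let ?C = "\<lambda>l. if gap Z l \<noteq> 0 \<and> u = vx l (gap Z l) then 1 else 0 :: int"
  have "lap (firings Z) u = (\<Sum>s\<in>UNIV. 2 * firings Z u - firings Z (act s u) - firings Z (act_inv s u))"
    by (rule lap_side[where f = "firings Z", OF u firings_zero[OF Z]])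
  also have "\<dots> = (\<Sum>s\<in>UNIV. \<Sum>l\<le>N. 2 * ?g l (int (hh l u)) - ?g l (int (hh l (act s u))) - ?g l (int (hh l (act_inv s u))))"
    unfolding firings_def by (simp add: sum_subtractf sum_distrib_left)
  also have "\<dots> = (\<Sum>l\<le>N. \<Sum>s\<in>UNIV. 2 * ?g l (int (hh l u)) - ?g l (int (hh l (act s u))) - ?g l (int (hh l (act_inv s u))))"
    by (rule sum.swap)
  also have "\<dots> = (\<Sum>l\<le>N. (?A l - ?A (Suc l)) + (?B l - ?C l))"
  proof (rule sum.cong[OF refl])
    fix l assume "l \<in> {..N}"
    then have l: "l \<le> N" by simp
    have eqv: "u = vx l y \<longleftrightarrow> cyc (e l) u = \<kappa> l \<and> hh l u = y" if "y < mm l" for y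
      using vx_iff[OF l lu that] by blast
    have m0: "0 < mm l" by (simp add: mm_def)
    note rt = root_ii[OF l] root_Suc[OF l]
    note iff = eqv[OF less[OF l]] eqv[OF gap_cases(1)[OF Z l]] eqv[OF m0] eqv[of "ii l"]
    show "(\<Sum>s\<in>UNIV. 2 * ?g l (int (hh l u)) - ?g l (int (hh l (act s u))) - ?g l (int (hh l (act_inv s u))))
      = (?A l - ?A (Suc l)) + (?B l - ?C l)"
      unfolding local_laplace[OF Z l lu] rt iff
      using ii_bounds[OF l] by (auto simp: cycle_source_def iff(4))
  qed
  also have "\<dots> = (\<Sum>l\<le>N. ?A l - ?A (Suc l)) + ((\<Sum>l\<le>N. ?B l) - (\<Sum>l\<le>N. ?C l))"
    by (simp only: sum.distrib sum_subtractf)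
  also have "(\<Sum>l\<le>N. ?A l - ?A (Suc l)) = ?A 0 - ?A (Suc N)"
    by (rule sum_telescope)
  also have "?A (Suc N) = 0" using not_zero_word[OF u] by (simp add: root_def)
  also have "?A 0 = (if u = x then 1 else 0)" by (simp add: root_0)
  also have "(\<Sum>l\<le>N. ?B l) = (if \<exists>l\<in>{..N}. ?z l \<noteq> 0 \<and> u = vx l (?z l) then 1 else 0)"
  proof (rule sum_indicator_unique)
    fix l l' assume *: "l \<in> {..N}" "l' \<in> {..N}" "?z l \<noteq> 0 \<and> u = vx l (?z l)" "?z l' \<noteq> 0 \<and> u = vx l' (?z l')"
    then have "key u = \<kappa> l" "key u = \<kappa> l'"
      using vx_side(2)[of l "?z l"] vx_side(2)[of l' "?z l'"] less by auto
    then show "l = l'" using inj_\<kappa> * by (metis inj_onD)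
  qed simp
  also have "(\<Sum>l\<le>N. ?C l) = (if \<exists>l\<in>{..N}. gap Z l \<noteq> 0 \<and> u = vx l (gap Z l) then 1 else 0)"
  proof (rule sum_indicator_unique)
    fix l l' assume *: "l \<in> {..N}" "l' \<in> {..N}" "gap Z l \<noteq> 0 \<and> u = vx l (gap Z l)" "gap Z l' \<noteq> 0 \<and> u = vx l' (gap Z l')"
    then have "key u = \<kappa> l" "key u = \<kappa> l'"
      using vx_side(2)[of l "gap Z l"] vx_side(2)[of l' "gap Z l'"] gap_cases(1)[OF Z] by auto
    then show "l = l'" using inj_\<kappa> * by (metis inj_onD)
  qed simp
  also have "(\<exists>l\<in>{..N}. gap Z l \<noteq> 0 \<and> u = vx l (gap Z l)) \<longleftrightarrow> u \<in> Z \<and> key u \<in> \<kappa> ` {..N}"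
  proof -
    have "(\<exists>l\<in>{..N}. gap Z l \<noteq> 0 \<and> u = vx l (gap Z l)) \<longleftrightarrow> (\<exists>l\<in>{..N}. u \<in> Z \<and> key u = \<kappa> l)"
      using gap_cases(2)[OF Z] by auto
    then show ?thesis by auto
  qed
  finally have *: "lap (firings Z) u = (if u = x then 1 else 0)
      + ((if \<exists>l\<in>{..N}. ?z l \<noteq> 0 \<and> u = vx l (?z l) then 1 else 0) - (if u \<in> Z \<and> key u \<in> \<kappa> ` {..N} then 1 else 0))"
    by simp
  have key: "key u \<in> \<kappa> ` {..N}" if "\<exists>l\<in>{..N}. ?z l \<noteq> 0 \<and> u = vx l (?z l)"
    using that vx_side(2) less by fastforce
  define Q where "Q \<longleftrightarrow> (\<exists>l\<in>{..N}. ?z l \<noteq> 0 \<and> u = vx l (?z l))"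
  define R where "R \<longleftrightarrow> key u \<in> \<kappa> ` {..N}"
  show ?thesis
    unfolding * shifted_iff(2)[OF Z] Q_def[symmetric] R_def[symmetric]
    using key[folded Q_def R_def] by auto
qed

text \<open>Values are 3 minus the indicator of a gap, so \<open>lap_firings\<close> says that
  \<open>firings Z\<close> carries \<open>cfg Z\<close> with a chip added at \<open>x\<close> to
  \<open>cfg (shifted Z)\<close>; by uniqueness it is the odometer.\<close>

lemma mass_eq:
  assumes "admissible Z"
  shows "avalanche_mass (side_graph (e N) n) {zero_word n} (cfg Z) x = card (fired Z)"
  unfolding V_eq[symmetric]
proof (rule avalanche_mass_eq[of _ _ "cfg (shifted Z)"])
  show "cfg Z \<in> burnable" "cfg (shifted Z) \<in> burnable"
    using assms shifted_iff(1)[OF assms] unfolding burnable_eq admissible_def by auto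
  show "x \<in> V" using x_side V_eq by simp
  fix u assume "u \<in> V"
  then have u: "u \<in> side_verts (e N) n" by (simp add: V_eq)
  show "int (cfg (shifted Z) u) = int (add_chip (cfg Z) x u) - lap (firings Z) u"
    unfolding lap_firings[OF assms u] using u by (auto simp: cfg_def add_chip_def)
qed

section \<open>The set of fired vertices\<close>

lemma hh_next:
  assumes "0 < hh l u" "Suc l \<le> N" "length u = n"
  shows "hh (Suc l) u = ii (Suc l)"
proof -
  have l: "l < N" "l \<le> N" using assms by auto
  note b = brkn_less[OF l(1)] and b' = brkn_bounds[OF assms(2)]
  define v where "v = take (k (Suc l)) u"
  have u: "drop (k (Suc l)) u = \<kappa> l" and v: "tail_val (e l) v \<noteq> 0"
    using assms(1,3) length_\<kappa>(1)[OF l(2)] b(1) by (auto simp: height_def v_def split: if_splits)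
  have lv: "length v = k (Suc l)" using b assms(3) by (simp add: v_def)
  have \<kappa>: "\<kappa> l = seg (k (Suc l)) (brkn (Suc l)) @ \<kappa> (Suc l)"
  proof -
    have "stake (k (Suc l)) \<xi> @ \<kappa> l = stake (k (Suc l)) \<xi> @ seg (k (Suc l)) (brkn (Suc l)) @ \<kappa> (Suc l)"
      using x_split[OF l(2)] x_split[OF assms(2)] b(1) stake_seg[of "k (Suc l)" "brkn (Suc l)"] b' by simp
    then show ?thesis by simp
  qed
  have "u = (v @ seg (k (Suc l)) (brkn (Suc l))) @ \<kappa> (Suc l)"
    using u \<kappa> by (metis append.assoc append_take_drop_id v_def)
  then have "hh (Suc l) u = tail_val (e (Suc l)) (v @ seg (k (Suc l)) (brkn (Suc l)))"
    using height_append by metis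
  also have "\<dots> = ii (Suc l)"
    unfolding ii_def using b' v lv by (intro tail_val_next) auto
  finally show ?thesis .
qed

lemma hh_above:
  assumes "0 < hh l u" "l < l'" "l' \<le> N" "length u = n"
  shows "hh l' u = ii l'"
  using assms(2,3)
proof (induction l')
  case (Suc l')
  have "0 < hh l' u"
  proof (cases "l = l'")
    case False
    then show ?thesis using Suc ii_bounds[of l'] by simp
  qed (use assms(1) in simp)
  then show ?case using hh_next[of l' u] Suc.prems assms(4) by simp
qed simp

lemma cycle_profile_nonneg:
  assumes "admissible Z" "l \<le> N" "length u = n"
  shows "0 \<le> cycle_profile Z l (int (hh l u))"
  using gap_cycle.profile_nonneg[OF gap_cycle_level[OF assms(1,2)]] hh_less[OF assms(2,3)] by simp

lemma firings_pos_iff: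
  assumes "admissible Z" "length u = n"
  shows "0 < firings Z u \<longleftrightarrow> (\<exists>l\<le>N. 0 < cycle_profile Z l (int (hh l u)))"
proof -
  let ?g = "\<lambda>l. cycle_profile Z l (int (hh l u))"
  have nn: "0 \<le> ?g l" if "l \<in> {..N}" for l using cycle_profile_nonneg assms that by simp
  have "firings Z u = 0 \<longleftrightarrow> (\<forall>l\<in>{..N}. ?g l = 0)"
    unfolding firings_def using nn by (intro sum_nonneg_eq_0_iff) auto
  moreover have "0 \<le> firings Z u" unfolding firings_def by (intro sum_nonneg nn)
  ultimately show ?thesis using nn by (metis atMost_iff order_less_le)
qed

lemma chips_zero_mono: "admissible Z \<Longrightarrow> t \<le> l \<Longrightarrow> l \<le> Suc N \<Longrightarrow> chips Z t = 0 \<Longrightarrow> chips Z l = 0"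
proof (induction l)
  case (Suc l)
  show ?case
  proof (cases "t = Suc l")
    case False
    then have "chips Z l = 0" using Suc by simp
    then show ?thesis using gap_cycle.outflow_r0[OF gap_cycle_level[of Z l]] Suc.prems by simp
  qed (use Suc in simp)
qed simp

lemma chips_pos_mono:
  assumes "admissible Z" "l \<le> N" "0 < chips Z (Suc l)"
  shows "0 < chips Z l"
proof (rule ccontr)
  assume "\<not> 0 < chips Z l"
  then have "chips Z l = 0" by linarith
  then have "chips Z (Suc l) = 0" using chips_zero_mono[OF assms(1), of l "Suc l"] assms(2) by linarith
  then show False using assms(3) by linarith
qed

lemma fired_dead_1:
  assumes "admissible Z" "chips Z 1 = 0" "length u = n"
  shows "\<not> 0 < firings Z u"
proof -
  have "cycle_profile Z l y = 0" if "l \<le> N" for l y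
  proof (rule gap_cycle.profile_eq_0[OF gap_cycle_level[OF assms(1) that]])
    show "outflow (mm l) (ii l) (chips Z l) (gap Z l) = 0"
      using chips_zero_mono[OF assms(1), of 1 "Suc l"] assms(2) that by simp
    show "chips Z l \<le> 1"
      using chips_zero_mono[OF assms(1), of 1 l] assms(2) that by (cases l) auto
  qed
  then show ?thesis using firings_pos_iff[OF assms(1,3)] by simp
qed

text \<open>A single chip meeting the gap at the entry of cycle \<open>Suc q\<close> makes the
  profiles of this and all later cycles vanish. A positive profile on a cycle before
  \<open>q\<close> belongs to words hanging from the entry of cycle \<open>q\<close>, which lies in
  the arc anyway.\<close>

lemma fired_dead:
  assumes Z: "admissible Z" and q: "Suc q \<le> N" "0 < chips Z (Suc q)" "chips Z (Suc (Suc q)) = 0"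
    and u: "length u = n"
  shows "0 < firings Z u \<longleftrightarrow> hh q u \<in> gap_cycle.arc (mm q) (ii q) (gap Z q)"
    and "gap Z q \<noteq> 0" "gap Z q \<noteq> ii q" "gap Z (Suc q) = ii (Suc q)" "chips Z (Suc q) = 1"
proof -
  interpret gc: gap_cycle "mm q" "ii q" "chips Z q" "gap Z q"
    by (rule gap_cycle_level[OF Z]) (use q in simp)
  interpret gc': gap_cycle "mm (Suc q)" "ii (Suc q)" "chips Z (Suc q)" "gap Z (Suc q)"
    by (rule gap_cycle_level[OF Z q(1)])
  show one: "chips Z (Suc q) = 1" and "gap Z (Suc q) = ii (Suc q)"
    using gc'.outflow_0_cases q by auto
  have r: "0 < chips Z q" using chips_pos_mono[OF Z _ q(2)] q(1) by simp
  note sup = gc.profile_support[OF r one[unfolded flow.simps]]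
  show "gap Z q \<noteq> 0" and ne: "gap Z q \<noteq> ii q" by (fact sup(1,2))+
  have hq: "hh q u < mm q" using hh_less[OF _ u] q by simp
  show "0 < firings Z u \<longleftrightarrow> hh q u \<in> gc.arc"
  proof
    assume "hh q u \<in> gc.arc"
    then have "0 < gc.g (int (hh q u))" using sup(3)[OF hq] by simp
    then show "0 < firings Z u" using firings_pos_iff[OF Z u] q(1) by (meson Suc_leD)
  next
    assume "0 < firings Z u"
    then obtain l where l: "l \<le> N" "0 < cycle_profile Z l (int (hh l u))"
      using firings_pos_iff[OF Z u] by blast
    have "\<not> q < l"
    proof
      assume ql: "q < l"
      have "cycle_profile Z l (int (hh l u)) = 0"
      proof (rule gap_cycle.profile_eq_0[OF gap_cycle_level[OF Z l(1)]])
        show "outflow (mm l) (ii l) (chips Z l) (gap Z l) = 0"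
          using chips_zero_mono[OF Z, of "Suc (Suc q)" "Suc l"] q ql l(1) by simp
        show "chips Z l \<le> 1"
          using chips_zero_mono[OF Z, of "Suc (Suc q)" l] q(3) one ql l(1) by (cases "l = Suc q") auto
      qed
      then show False using l(2) by simp
    qed
    then consider "l = q" | "l < q" by linarith
    then show "hh q u \<in> gc.arc"
    proof cases
      case 1
      then show ?thesis using l(2) sup(3)[OF hq] by simp
    next
      case 2
      have "hh l u \<noteq> 0"
      proof
        assume "hh l u = 0"
        then show False using l(2) gap_cycle.profile_0[OF gap_cycle_level[OF Z l(1)]] by simp
      qed
      then have "hh q u = ii q" using hh_above[of l u q] 2 q(1) u by simp
      then show ?thesis using gc.i_in_arc ne by simp
    qed
  qed
qed

lemma fired_alive:
  assumes Z: "admissible Z" and l: "l \<le> N" "0 < chips Z (Suc l)" and u: "length u = n" "hh l u = ii l"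
  shows "0 < firings Z u"
proof -
  interpret gc: gap_cycle "mm l" "ii l" "chips Z l" "gap Z l"
    by (rule gap_cycle_level[OF Z l(1)])
  have "0 < chips Z l" by (rule chips_pos_mono[OF Z l])
  then have "0 < gc.g (int (hh l u))" using gc.profile_entry_pos l(2) u(2) by simp
  then show ?thesis using firings_pos_iff[OF Z u(1)] l(1) by blast
qed

text \<open>The count on the right does not involve \<open>n\<close>; this makes masses comparable
  between levels.\<close>

lemma card_hh:
  assumes "l < N" "0 \<notin> A"
  shows "card {u \<in> side_verts (e N) n. hh l u \<in> A} = card {v. length v = k (Suc l) \<and> tail_val (e l) v \<in> A}"
proof -
  have l: "l \<le> N" using assms by simp
  note b = brkn_less[OF assms(1)]
  have lk: "length (\<kappa> l) = n - k (Suc l)" using length_\<kappa>(3)[of l] b by simp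
  have "{u \<in> side_verts (e N) n. hh l u \<in> A} = (\<lambda>v. v @ \<kappa> l) ` {v. length v = k (Suc l) \<and> tail_val (e l) v \<in> A}"
  proof (rule subset_antisym; rule subsetI)
    fix u assume u: "u \<in> {u \<in> side_verts (e N) n. hh l u \<in> A}"
    then have lu: "length u = n" by (simp add: side_verts_def)
    have "hh l u \<noteq> 0" using u assms(2) by (metis mem_Collect_eq)
    then have "drop (k (Suc l)) u = \<kappa> l" "hh l u = tail_val (e l) (take (k (Suc l)) u)"
      using lu length_\<kappa>(1)[OF l] b by (auto simp: height_def split: if_splits)
    then have "u = take (k (Suc l)) u @ \<kappa> l" "length (take (k (Suc l)) u) = k (Suc l)" "tail_val (e l) (take (k (Suc l)) u) \<in> A"
      using u lu b by (metis append_take_drop_id, simp, simp)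
    then show "u \<in> (\<lambda>v. v @ \<kappa> l) ` {v. length v = k (Suc l) \<and> tail_val (e l) v \<in> A}" by blast
  next
    fix u assume "u \<in> (\<lambda>v. v @ \<kappa> l) ` {v. length v = k (Suc l) \<and> tail_val (e l) v \<in> A}"
    then obtain v where v: "u = v @ \<kappa> l" "length v = k (Suc l)" "tail_val (e l) v \<in> A" by blast
    have h: "hh l u = tail_val (e l) v" using v(1) height_append by metis
    moreover have "length u = n" using v lk b by simp
    moreover have "0 < hh l u" using h v(3) assms(2) by (metis gr0I)
    ultimately show "u \<in> {u \<in> side_verts (e N) n. hh l u \<in> A}"
      using ht_pos_side[OF valid_\<kappa>[OF l], of u] key_digit_\<kappa>[OF l] v(3) by simp
  qed
  then show ?thesis by (simp add: card_image inj_on_def)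
qed

end

section \<open>Mass probabilities\<close>

context alternation
begin

definition m :: "nat \<Rightarrow> nat" where "m l = 2 ^ k (Suc l)"

definition i :: "nat \<Rightarrow> nat" where "i l = pos l (k (Suc l))"

definition gaps :: "nat set \<Rightarrow> (nat \<Rightarrow> nat) set" where
  "gaps J = PiE J (\<lambda>l. {..<m l})"

definition fired_words :: "nat \<Rightarrow> nat \<Rightarrow> digit list set" where
  "fired_words q y = {v. length v = k (Suc q) \<and> tail_val (e q) v \<in> gap_cycle.arc (m q) (i q) y}"

definition branch :: "nat \<Rightarrow> digit list set" where
  "branch q = {v. length v = k (Suc q) \<and> tail_val (e q) v = i q}"

text \<open>If the flow first vanishes after cycle \<open>T - 1\<close>, this cycle only fills its gap at the entry and
  fires nothing; the arc of cycle \<open>T - 2\<close> and all that hangs from it is what has fired.\<close>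

definition mass_of :: "nat \<Rightarrow> (nat \<Rightarrow> nat) \<Rightarrow> nat" where
  "mass_of T z = (if T = 1 then 0 else card (fired_words (T - 2) (z (T - 2))))"

definition dies :: "(nat \<Rightarrow> nat) \<Rightarrow> nat \<Rightarrow> bool" where
  "dies z T \<longleftrightarrow> flow m i z T = 0 \<and> (\<forall>t<T. 0 < flow m i z t)"

text \<open>Only the gaps of cycles \<open>0..L\<close> are recorded; they decide about every mass
  below \<open>card (branch L)\<close>.\<close>

definition event :: "nat \<Rightarrow> nat \<Rightarrow> (nat \<Rightarrow> nat) set" where
  "event L M = {z \<in> gaps {..L}. \<exists>T\<le>Suc L. dies z T \<and> mass_of T z = M}"

lemma i_bounds: "0 < i l" "i l < m l"
  using pos_bounds[of l "k (Suc l)"] step[of l] by (auto simp: i_def m_def)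

lemma m_ge: "2 ^ Suc l \<le> m l"
  unfolding m_def using k_ge[of "Suc l"] by (intro power_increasing) auto

lemma dies_pos: "dies z T \<Longrightarrow> 0 < T"
  by (cases T) (auto simp: dies_def)

lemma dies_unique: "dies z T \<Longrightarrow> dies z T' \<Longrightarrow> T = T'"
  unfolding dies_def by (metis less_irrefl nat_neq_iff)

lemma finite_words: "finite {v :: digit list. length v = l}"
proof -
  have "finite {v :: digit list. set v \<subseteq> UNIV \<and> length v = l}"
    by (rule finite_lists_length_eq) simp
  then show ?thesis by simp
qed

lemma card_words: "card {v :: digit list. length v = l} = 3 ^ l"
proof -
  have "card {v :: digit list. set v \<subseteq> UNIV \<and> length v = l} = card (UNIV :: digit set) ^ l"
    by (rule card_lists_length_eq) simp
  moreover have "card (UNIV :: digit set) = 3" by (simp add: UNIV_digit)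
  ultimately show ?thesis by simp
qed

lemma finite_fired_words: "finite (fired_words q y)"
  by (rule finite_subset[OF _ finite_words[of "k (Suc q)"]]) (auto simp: fired_words_def)

lemma finite_branch: "finite (branch q)"
  by (rule finite_subset[OF _ finite_words[of "k (Suc q)"]]) (auto simp: branch_def)

lemma arc_eq: "gap_cycle.arc (m q) (i q) y = (if i q < y then {1..<y} else {Suc y..<m q})"
  if "y < m q"
proof -
  interpret gap_cycle "m q" "i q" 0 y by unfold_locales (use i_bounds that in auto)
  show ?thesis by (rule arc_def)
qed

lemma card_fired_words_le: "card (fired_words q y) \<le> 3 ^ k (Suc q)"
  unfolding card_words[symmetric]
  by (rule card_mono[OF finite_words]) (auto simp: fired_words_def)

lemma branch_le:
  assumes "y < m q" "y \<noteq> i q"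
  shows "card (branch q) \<le> card (fired_words q y)"
proof (rule card_mono[OF finite_fired_words])
  show "branch q \<subseteq> fired_words q y"
    using assms i_bounds[of q] by (auto simp: branch_def fired_words_def arc_eq)
qed

text \<open>Continued by digits of \<xi>, the fired words hang from the entry of the next cycle, and
  the zero word shows that they are not all of its branch. With \<open>branch_le\<close> this puts
  the masses for different \<open>q\<close> into disjoint intervals, so a positive mass determines
  \<open>q\<close>.\<close>

lemma fired_words_less:
  assumes "y < m q" 
  shows "card (fired_words q y) < card (branch (Suc q))"
proof -
  let ?h = "\<lambda>v. v @ seg (k (Suc q)) (k (Suc (Suc q)))"
  have inj: "inj_on ?h A" for A by (simp add: inj_on_def)
  have len: "length (?h v) = k (Suc (Suc q))" if "length v = k (Suc q)" for v
    using that step[of "Suc q"] by simp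
  have "?h ` fired_words q y \<subset> branch (Suc q)"
  proof (rule psubsetI)
    show "?h ` fired_words q y \<subseteq> branch (Suc q)"
    proof (rule image_subsetI)
      fix v assume v: "v \<in> fired_words q y"
      then have "length v = k (Suc q)" "tail_val (e q) v \<noteq> 0"
        using assms by (auto simp: fired_words_def arc_eq split: if_splits)
      then show "?h v \<in> branch (Suc q)"
        using len tail_val_next[of q v "k (Suc (Suc q))"] step[of "Suc q"]
        by (auto simp: branch_def i_def)
    qed
    have "tail_val d (zero_word l) = 0" if "d \<noteq> D0" for d l
      using that by (intro tail_val_eq_0) auto
    then have z: "tail_val (e q) (zero_word (k (Suc q))) = 0" "tail_val (e (Suc q)) (zero_word (k (Suc q))) = 0"
      using e_nonzero by auto
    have "?h (zero_word (k (Suc q))) \<in> branch (Suc q)"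
      using len[of "zero_word (k (Suc q))"] step[of "Suc q"] z(2)
        tail_val_append_seg[of "Suc q" "k (Suc (Suc q))" "zero_word (k (Suc q))"]
      by (auto simp: branch_def i_def)
    moreover have "zero_word (k (Suc q)) \<notin> fired_words q y"
      using z(1) assms by (auto simp: fired_words_def arc_eq)
    then have "?h (zero_word (k (Suc q))) \<notin> ?h ` fired_words q y" by auto
    ultimately show "?h ` fired_words q y \<noteq> branch (Suc q)" by metis
  qed
  then have "card (?h ` fired_words q y) < card (branch (Suc q))"
    by (rule psubset_card_mono[OF finite_branch])
  then show ?thesis by (simp add: card_image inj)
qed

lemma branch_pos: "0 < card (branch q)"
proof -
  have "stake (k (Suc q)) \<xi> \<in> branch q" by (simp add: branch_def i_def pos_def)
  then show ?thesis using finite_branch card_gt_0_iff by blast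
qed

lemma branch_strict_mono: "strict_mono (\<lambda>q. card (branch q))"
proof (rule strict_mono_Suc_iff[THEN iffD2], rule allI)
  fix q
  have "card (branch q) \<le> card (fired_words q 0)"
    using i_bounds[of q] by (intro branch_le) auto
  also have "\<dots> < card (branch (Suc q))"
    using i_bounds[of q] by (intro fired_words_less) auto
  finally show "card (branch q) < card (branch (Suc q))" .
qed

text \<open>A digit opposite to \<open>e q\<close> at place \<open>k q - 1\<close> hides everything
  before it from \<open>tail_val\<close>, so the first \<open>k q - 1\<close> digits are
  free.\<close>

lemma branch_ge: "0 < k q \<Longrightarrow> 3 ^ (k q - 1) \<le> card (branch q)"
proof -
  assume k: "0 < k q"
  let ?h = "\<lambda>v. (v @ [opp (e q)]) @ seg (k q) (k (Suc q))"
  have "?h ` {v. length v = k q - 1} \<subseteq> branch q"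
  proof (rule image_subsetI)
    fix v :: "digit list" assume "v \<in> {v. length v = k q - 1}"
    then have len: "length (v @ [opp (e q)]) = k q" using k by simp
    have "tail_val (e q) (v @ [opp (e q)]) = 0"
      using e_nonzero[of q] by (simp add: tail_val_append)
    then show "?h v \<in> branch q"
      using tail_val_append_seg[of q "k (Suc q)" "v @ [opp (e q)]"] len step[of q]
      by (simp add: branch_def i_def)
  qed
  then have "card (?h ` {v. length v = k q - 1}) \<le> card (branch q)"
    by (rule card_mono[OF finite_branch])
  then show ?thesis by (simp add: card_image inj_on_def card_words)
qed

lemma gap_cycle_free: "y < m l \<Longrightarrow> gap_cycle (m l) (i l) y"
  using i_bounds[of l] by unfold_locales

text \<open>On each side of the entry the arcs are nested, and the larger one gains a word at
  position \<open>y\<close>. Hence a mass leaves at most one gap on each side.\<close>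

lemma fired_words_mono:
  assumes "y < m q" "y' < m q" "i q < y \<and> y < y' \<or> y' < y \<and> y < i q"
  shows "card (fired_words q y) < card (fired_words q y')"
proof (rule psubset_card_mono[OF finite_fired_words])
  define v where "v = bits (e q) (k (Suc q)) y"
  have v: "length v = k (Suc q)" "tail_val (e q) v = y"
    using assms(1) e_nonzero[of q] by (auto simp: v_def tail_val_bits m_def)
  have "y \<in> gap_cycle.arc (m q) (i q) y'" "y \<notin> gap_cycle.arc (m q) (i q) y"
    and sub: "gap_cycle.arc (m q) (i q) y \<subseteq> gap_cycle.arc (m q) (i q) y'"
    using assms i_bounds[of q] by (auto simp: arc_eq)
  then have "v \<in> fired_words q y'" "v \<notin> fired_words q y"
    using v by (auto simp: fired_words_def)
  moreover have "fired_words q y \<subseteq> fired_words q y'" using sub by (auto simp: fired_words_def)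
  ultimately show "fired_words q y \<subset> fired_words q y'" by blast
qed

lemma gap_values_le_2: "card {y. y < m q \<and> y \<noteq> i q \<and> card (fired_words q y) = M} \<le> 2"
proof -
  let ?A = "{y. y < m q \<and> i q < y \<and> card (fired_words q y) = M}"
  let ?B = "{y. y < m q \<and> y < i q \<and> card (fired_words q y) = M}"
  have le1: "card S \<le> 1" if "\<And>y y'. y \<in> S \<Longrightarrow> y' \<in> S \<Longrightarrow> \<not> y < y'" for S :: "nat set"
  proof (cases "finite S")
    case True
    have "a = b" if "a \<in> S" "b \<in> S" for a b
      using \<open>\<And>y y'. y \<in> S \<Longrightarrow> y' \<in> S \<Longrightarrow> \<not> y < y'\<close> that by (metis nat_neq_iff)
    then show ?thesis using True by (simp add: card_le_Suc0_iff_eq)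
  qed simp
  have "card ?A \<le> 1"
  proof (rule le1)
    fix y y' assume "y \<in> ?A" "y' \<in> ?A"
    then show "\<not> y < y'" using fired_words_mono[of y q y'] by auto
  qed
  moreover have "card ?B \<le> 1"
  proof (rule le1)
    fix y y' assume "y \<in> ?B" "y' \<in> ?B"
    then show "\<not> y < y'" using fired_words_mono[of y' q y] by auto
  qed
  moreover have "{y. y < m q \<and> y \<noteq> i q \<and> card (fired_words q y) = M} = ?A \<union> ?B" by auto
  ultimately show ?thesis using card_Un_le[of ?A ?B] by simp
qed

lemma finite_gaps: "finite J \<Longrightarrow> finite (gaps J)"
  unfolding gaps_def by (intro finite_PiE) auto

lemma card_gaps: "finite J \<Longrightarrow> card (gaps J) = (\<Prod>l\<in>J. m l)"
  unfolding gaps_def by (simp add: card_PiE)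

lemma m_pos: "0 < m l"
  by (simp add: m_def)

lemma gaps_less: "z \<in> gaps J \<Longrightarrow> l \<in> J \<Longrightarrow> z l < m l"
  unfolding gaps_def by auto

lemma dies_last:
  assumes "\<And>l. l \<le> Suc q \<Longrightarrow> z l < m l" "dies z (Suc (Suc q))"
  shows "z (Suc q) = i (Suc q)" "z q \<noteq> i q" "z q \<noteq> 0"
proof -
  interpret a: gap_cycle "m q" "i q" "flow m i z q" "z q" by (rule gap_cycle_free) (use assms in simp)
  interpret b: gap_cycle "m (Suc q)" "i (Suc q)" "flow m i z (Suc q)" "z (Suc q)"
    by (rule gap_cycle_free) (use assms in simp)
  have f: "0 < flow m i z q" "0 < flow m i z (Suc q)" "flow m i z (Suc (Suc q)) = 0"
    using assms(2) unfolding dies_def by (blast intro: less_SucI)+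
  then have "flow m i z (Suc q) = 1" "z (Suc q) = i (Suc q)"
    using b.outflow_0_cases by auto
  then show "z (Suc q) = i (Suc q)" "z q \<noteq> i q" "z q \<noteq> 0"
    using a.profile_support(1,2)[OF f(1)] by auto
qed

lemma event_cases:
  assumes "z \<in> event L M" "0 < M"
  obtains q where "Suc q \<le> L" "dies z (Suc (Suc q))" "M = card (fired_words q (z q))"
    "z q < m q" "z q \<noteq> 0" "z q \<noteq> i q" "z (Suc q) = i (Suc q)"
    "card (branch q) \<le> M" "M < card (branch (Suc q))"
proof -
  obtain T where T: "z \<in> gaps {..L}" "T \<le> Suc L" "dies z T" "mass_of T z = M"
    using assms(1) by (auto simp: event_def)
  have "T \<noteq> 1" using T(4) assms(2) by (auto simp: mass_of_def)
  moreover define q where "q = T - 2"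
  ultimately have q: "T = Suc (Suc q)" using dies_pos[OF T(3)] by linarith
  have less: "z l < m l" if "l \<le> Suc q" for l using gaps_less[OF T(1), of l] T(2) q that by simp
  have d: "z (Suc q) = i (Suc q)" "z q \<noteq> i q" "z q \<noteq> 0" using dies_last[of q z] less T(3) q by auto
  have M: "M = card (fired_words q (z q))" using T(4) q by (simp add: mass_of_def)
  show thesis
  proof (rule that[of q])
    show "card (branch q) \<le> M" "M < card (branch (Suc q))"
      unfolding M using branch_le[of "z q" q] fired_words_less[of "z q" q] less[of q] d by auto
  qed (use T q M d less in auto)
qed

text \<open>The gap of cycle \<open>Suc q\<close> is prescribed and that of cycle \<open>q\<close>
  has at most two values; the earlier ones are counted without restriction.\<close>

lemma event_upper:
  assumes "card (branch q) \<le> M" "M < card (branch (Suc q))"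
  shows "card (event (Suc q) M) \<le> 2 * (\<Prod>l<q. m l)"
proof -
  let ?S = "{y. y < m q \<and> y \<noteq> i q \<and> card (fired_words q y) = M}"
  have M0: "0 < M" using assms(1) branch_pos[of q] by simp
  have "event (Suc q) M \<subseteq> PiE {..Suc q} (\<lambda>l. if l = Suc q then {i (Suc q)} else if l = q then ?S else {..<m l})"
  proof
    fix z assume z: "z \<in> event (Suc q) M"
    obtain q' where q': "Suc q' \<le> Suc q" "dies z (Suc (Suc q'))" "M = card (fired_words q' (z q'))"
      "z q' < m q'" "z q' \<noteq> 0" "z q' \<noteq> i q'" "z (Suc q') = i (Suc q')"
      "card (branch q') \<le> M" "M < card (branch (Suc q'))"
      using event_cases[OF z M0] .
    have "q' = q"
    proof (rule ccontr)
      assume "q' \<noteq> q"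
      then have "Suc q' \<le> q" using q'(1) by simp
      then have "card (branch (Suc q')) \<le> card (branch q)"
        using strict_mono_less_eq[OF branch_strict_mono] by blast
      then show False using q'(9) assms(1) by simp
    qed
    moreover have "z \<in> gaps {..Suc q}" using z by (simp add: event_def)
    ultimately show "z \<in> PiE {..Suc q} (\<lambda>l. if l = Suc q then {i (Suc q)} else if l = q then ?S else {..<m l})"
      using q' by (auto simp: gaps_def PiE_iff)
  qed
  then have "card (event (Suc q) M) \<le> card (PiE {..Suc q} (\<lambda>l. if l = Suc q then {i (Suc q)} else if l = q then ?S else {..<m l}))"
    by (intro card_mono finite_PiE) auto
  also have "\<dots> = (\<Prod>l\<le>Suc q. card (if l = Suc q then {i (Suc q)} else if l = q then ?S else {..<m l}))"
    by (simp add: card_PiE)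
  also have "\<dots> = (\<Prod>l<q. card (if l = Suc q then {i (Suc q)} else if l = q then ?S else {..<m l})) * card ?S"
    by (simp add: prod.lessThan_Suc lessThan_Suc_atMost[symmetric] del: prod.atMost_Suc)
  also have "(\<Prod>l<q. card (if l = Suc q then {i (Suc q)} else if l = q then ?S else {..<m l})) = (\<Prod>l<q. m l)"
    by (intro prod.cong) auto
  also have "(\<Prod>l<q. m l) * card ?S \<le> (\<Prod>l<q. m l) * 2"
    using gap_values_le_2 by (intro mult_left_mono) auto
  finally show ?thesis by simp
qed

text \<open>The gaps of the first \<open>q\<close> cycles for which exactly one chip reaches cycle
  \<open>q\<close>; each of them can be completed to an avalanche that ends at cycle
  \<open>Suc q\<close>.\<close>

definition single :: "nat \<Rightarrow> (nat \<Rightarrow> nat) set" where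
  "single q = {z \<in> gaps {..<q}. flow m i z q = 1}"

lemma flow_upd: "flow m i (z(q := y)) q = flow m i z q"
  by (rule flow_cong) auto

lemma flow_upd_Suc: "flow m i (z(q := y)) (Suc q) = outflow (m q) (i q) (flow m i z q) y"
  by (simp add: flow_upd)

lemma gaps_upd: "z \<in> gaps {..<q} \<Longrightarrow> y < m q \<Longrightarrow> z(q := y) \<in> gaps {..<Suc q}"
  by (auto simp: gaps_def PiE_iff extensional_def less_Suc_eq)

lemma upd_inj: "z \<in> gaps {..<q} \<Longrightarrow> z' \<in> gaps {..<q} \<Longrightarrow> z(q := y) = z'(q := y') \<Longrightarrow> z = z' \<and> y = y'"
  unfolding gaps_def
  by (metis PiE_arb fun_upd_same fun_upd_triv fun_upd_upd lessThan_iff less_irrefl)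

lemma outflow_1:
  assumes "y < m q" "y \<noteq> 0" "y \<noteq> i q"
  shows "outflow (m q) (i q) 1 y = 1"
proof -
  interpret gap_cycle "m q" "i q" 1 y by (rule gap_cycle_free[OF assms(1)])
  have "z' \<noteq> 0"
  proof
    assume "z' = 0"
    then have "outflow (m q) (i q) 1 y = 0" using assms by (simp add: outflow_def)
    then show False using outflow_0_cases assms by simp
  qed
  then show ?thesis using assms by (simp add: outflow_def)
qed

text \<open>The gap \<open>y\<close> on cycle \<open>q\<close> lets the single chip pass, and a gap
  at the entry of cycle \<open>Suc q\<close> stops it.\<close>

lemma event_lower:
  assumes "0 < y" "y < m q" "y \<noteq> i q"
  shows "card (single q) \<le> card (event (Suc q) (card (fired_words q y)))"
proof (rule card_inj_on_le)
  let ?h = "\<lambda>z. z(q := y, Suc q := i (Suc q))"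
  show "inj_on ?h (single q)"
  proof (rule inj_onI)
    fix z z' assume *: "z \<in> single q" "z' \<in> single q" "?h z = ?h z'"
    then have "z(q := y) \<in> gaps {..<Suc q}" "z'(q := y) \<in> gaps {..<Suc q}"
      using assms gaps_upd by (auto simp: single_def)
    then have "z(q := y) = z'(q := y)" using upd_inj *(3) by blast
    then show "z = z'" using upd_inj * by (auto simp: single_def)
  qed
  show "finite (event (Suc q) (card (fired_words q y)))"
    by (rule finite_subset[OF _ finite_gaps[of "{..Suc q}"]]) (auto simp: event_def)
  show "?h ` single q \<subseteq> event (Suc q) (card (fired_words q y))"
  proof (rule image_subsetI)
    fix z assume z: "z \<in> single q"
    let ?z = "?h z"
    have in_g: "?z \<in> gaps {..Suc q}"
      using z gaps_upd[of "z(q := y)" "Suc q" "i (Suc q)"] gaps_upd[of z q y] assms i_bounds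
      by (simp add: single_def lessThan_Suc_atMost)
    have fq: "flow m i ?z q = 1"
      using z flow_cong[of q m m i i ?z z] by (simp add: single_def)
    have f1: "flow m i ?z (Suc q) = 1"
      using outflow_1[of y q] assms fq by simp
    have "new_gap (m (Suc q)) (i (Suc q)) 1 (i (Suc q)) = 0" by (simp add: new_gap_def)
    then have f2: "flow m i ?z (Suc (Suc q)) = 0"
      using f1 i_bounds(1)[of "Suc q"] by (simp add: outflow_def)
    have pos: "0 < flow m i ?z t" if "t \<le> q" for t
    proof (rule ccontr)
      assume "\<not> 0 < flow m i ?z t"
      then have t0: "flow m i ?z t = 0" by simp
      have "flow m i ?z l = 0" if "t \<le> l" "l \<le> q" for l
        using that
      proof (induction l rule: dec_induct)
        case (step l)
        have "?z l < m l" using gaps_less[OF in_g, of l] step by simp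
        then show ?case using gap_cycle.outflow_r0[OF gap_cycle_free] step by simp
      qed (use t0 in simp)
      then show False using fq that by simp
    qed
    have "dies ?z (Suc (Suc q))"
      unfolding dies_def using f1 f2 pos by (auto simp: less_Suc_eq_le le_Suc_eq simp del: flow.simps)
    then show "?z \<in> event (Suc q) (card (fired_words q y))"
      using in_g by (auto simp: event_def mass_of_def intro!: exI[of _ "Suc (Suc q)"])
  qed
qed

text \<open>The excluded gaps are 0, where the chip creates a gap and two chips leave, and
  \<open>i q\<close>, where the gap swallows the chip.\<close>

lemma single_Suc: "card (single q) * (m q - 2) \<le> card (single (Suc q))"
proof -
  let ?S = "{..<m q} - {0, i q}"
  have "card (single q \<times> ?S) \<le> card (single (Suc q))"
  proof (rule card_inj_on_le[where f = "\<lambda>(z, y). z(q := y)"])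
    show "inj_on (\<lambda>(z, y). z(q := y)) (single q \<times> ?S)"
      using upd_inj by (auto simp: inj_on_def single_def)
    show "(\<lambda>(z, y). z(q := y)) ` (single q \<times> ?S) \<subseteq> single (Suc q)"
      using gaps_upd flow_upd outflow_1 by (auto simp: single_def)
    show "finite (single (Suc q))"
      by (rule finite_subset[OF _ finite_gaps[of "{..<Suc q}"]]) (auto simp: single_def)
  qed
  moreover have "card ?S = m q - 2"
    using i_bounds[of q] by (subst card_Diff_subset) auto
  ultimately show ?thesis by (simp add: card_cartesian_product)
qed

text \<open>The probability that exactly one chip reaches cycle \<open>q\<close>, for independent
  uniform gaps.\<close>

definition rate :: "nat \<Rightarrow> real" where
  "rate q = real (card (single q)) / real (\<Prod>l<q. m l)"

lemma rate_Suc: "rate q * (1 - 2 / real (m q)) \<le> rate (Suc q)"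
proof -
  have m2: "2 \<le> m q" using i_bounds[of q] by simp
  have P: "0 < real (\<Prod>l<q. m l)" using m_pos by (simp add: prod_pos)
  have "rate q * (1 - 2 / real (m q)) = real (card (single q) * (m q - 2)) / (real (\<Prod>l<q. m l) * real (m q))"
    using m2 m_pos[of q] by (simp add: rate_def field_simps of_nat_diff)
  also have "\<dots> \<le> real (card (single (Suc q))) / (real (\<Prod>l<q. m l) * real (m q))"
    using single_Suc[of q] P m_pos[of q] by (intro divide_right_mono) (simp_all only: of_nat_mono, simp)
  finally show ?thesis by (simp add: rate_def)
qed

text \<open>As \<open>m q\<close> is at least \<open>2 ^ Suc q\<close>, one step costs a factor of
  at least \<open>1 - 1 / 2 ^ q\<close>. The term \<open>2 / 2 ^ q\<close> is the reserve that pays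
  for it: it is halved in each step, and \<open>2 \<le> q0\<close> makes the bracket at most 1 at
  the start.\<close>

lemma rate_bound:
  assumes "2 \<le> q0" "q0 \<le> q"
  shows "rate q0 * (1 / 2 + 2 / 2 ^ q) \<le> rate q"
  using assms(2)
proof (induction q rule: dec_induct)
  case base
  have "(2::real) / 2 ^ q0 \<le> 1 / 2"
    using power_increasing[OF assms(1), of "2::real"] by (simp add: field_simps)
  then have "1 / 2 + (2::real) / 2 ^ q0 \<le> 1" by linarith
  then have "rate q0 * (1 / 2 + 2 / 2 ^ q0) \<le> rate q0 * 1"
    by (rule mult_left_mono) (auto simp: rate_def prod_nonneg)
  then show ?case by simp
next
  case (step q)
  have r0: "0 \<le> rate q0" by (auto simp: rate_def prod_nonneg)
  define a :: real where "a = 2 / 2 ^ q"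
  define \<delta> where "\<delta> = 2 / real (m q)"
  have "2 \<le> q" using assms(1) step by simp
  then have "(2::real) / 2 ^ q \<le> 1 / 2"
    using power_increasing[of 2 q "2::real"] by (simp add: field_simps)
  then have a: "0 < a" "a \<le> 1 / 2" by (auto simp: a_def)
  have "real (2 ^ Suc q) \<le> real (m q)" using m_ge[of q] of_nat_mono by blast
  then have "\<delta> \<le> 2 / 2 ^ Suc q" unfolding \<delta>_def by (intro divide_left_mono) (auto simp: m_pos)
  then have d: "0 \<le> \<delta>" "\<delta> \<le> a / 2" by (auto simp: a_def \<delta>_def)
  have "\<delta> * (1 / 2 + a) \<le> \<delta> * 1" using a d by (intro mult_left_mono) auto
  moreover have "(1 / 2 + a) * (1 - \<delta>) = 1 / 2 + a - \<delta> * (1 / 2 + a)" by (subst right_diff_distrib) (simp add: mult.commute)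
  ultimately have "1 / 2 + a / 2 \<le> (1 / 2 + a) * (1 - \<delta>)" using d by linarith
  then have "rate q0 * (1 / 2 + a / 2) \<le> rate q0 * (1 / 2 + a) * (1 - \<delta>)"
    using mult_left_mono[OF _ r0] by (simp add: mult.assoc)
  also have "\<dots> \<le> rate q * (1 - \<delta>)"
  proof (rule mult_right_mono)
    show "rate q0 * (1 / 2 + a) \<le> rate q" using step.IH by (simp add: a_def)
    show "0 \<le> 1 - \<delta>" using a d by linarith
  qed
  also have "\<dots> \<le> rate (Suc q)" using rate_Suc by (simp add: \<delta>_def)
  finally show ?case by (simp add: a_def)
qed

text \<open>The digit at \<open>k l\<close> is nonzero and nothing before it counts, so the binary
  valuation of the entry is exactly \<open>k l\<close>.\<close>

lemma odd_multiple: "\<exists>c. odd c \<and> i l = 2 ^ k l * c"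
proof -
  note s = seg_Cons[OF step[of l]]
  have "set (seg (k l) (k (Suc l))) \<subseteq> {D0, e l}" using set_seg by simp
  then have "set (tl (seg (k l) (k (Suc l)))) \<subseteq> {D0, e l}" by (subst (asm) s) simp
  then have "odd (tail_val (e l) (seg (k l) (k (Suc l))))" by (subst s) simp
  then show ?thesis using pos_seg[of l "k (Suc l)"] step[of l] unfolding i_def by (metis less_imp_le_nat order_refl)
qed

text \<open>The flow starts at 1, can be raised to 2 on the first cycle, kept there, and brought back
  to 1 on a cycle where \<open>2 i\<close> is not a multiple of \<open>m\<close>. If \<open>m\<close> is 2 on the first cycle, it is
  impossible to keep it at 1 there.\<close>

lemma rate_pos:
  assumes "1 \<le> l" "k l + 2 \<le> k (Suc l)"
  shows "0 < rate (Suc l)"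
proof -
  have two: "\<exists>z\<in>gaps {..<t}. flow m i z t = 2" if "1 \<le> t" "t \<le> l" for t
    using that
  proof (induction t rule: dec_induct)
    case base
    \<comment> \<open>Without a gap on cycle 0 the chip creates one, and two chips leave.\<close>
    define z where "z = (\<lambda>_ :: nat. undefined :: nat)(0 := 0)"
    have "z \<in> gaps {..<Suc 0}" unfolding z_def
      by (rule gaps_upd) (auto simp: gaps_def m_pos)
    moreover have "flow m i z (Suc 0) = 2"
    proof -
      interpret gap_cycle "m 0" "i 0" 1 0 by (rule gap_cycle_free[OF m_pos])
      have "z' \<noteq> 0" using z'_1_less i_bounds[of 0] by linarith
      then show ?thesis by (simp add: z_def outflow_def)
    qed
    ultimately show ?case by auto
  next
    case (step t)
    then obtain z where z: "z \<in> gaps {..<t}" "flow m i z t = 2" by auto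
    define w where "w = nat ((2 * int (i t)) mod int (m t))"
    have "2 ^ Suc t \<ge> (4::nat)" using step(1) power_increasing[of 2 "Suc t" "2::nat"] by simp
    then have m4: "4 \<le> m t" using m_ge[of t] by simp
    \<comment> \<open>The gap has to avoid 0 and the residue of \<open>2 * i t\<close>, where two
      chips would fill it; a length of at least 4 leaves room for 1 or 2.\<close>
    define y where "y = (if w = 1 then 2 else 1 :: nat)"
    have y: "y < m t" "y \<noteq> 0" "y \<noteq> w" using m4 by (auto simp: y_def)
    have "new_gap (m t) (i t) 2 y \<noteq> 0"
    proof
      assume "new_gap (m t) (i t) 2 y = 0"
      moreover have "0 \<le> (int y - 2 * int (i t)) mod int (m t)" using m4 by simp
      ultimately have "(int y - 2 * int (i t)) mod int (m t) = 0" by (simp add: new_gap_def)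
      then have "int y mod int (m t) = (2 * int (i t)) mod int (m t)"
        by (metis dvd_eq_mod_eq_0 mod_eq_dvd_iff)
      then have "int y = (2 * int (i t)) mod int (m t)" using y(1) by simp
      then show False using y(3) unfolding w_def by (metis nat_int)
    qed
    then have "flow m i (z(t := y)) (Suc t) = 2" unfolding flow_upd_Suc z(2) using y by (simp add: outflow_def)
    then show ?case using gaps_upd[OF z(1) y(1)] by blast
  qed
  then obtain z where z: "z \<in> gaps {..<l}" "flow m i z l = 2" using assms(1) by blast
  \<comment> \<open>The gap that two chips fill, so that one leaves. It is not 0, because
    \<open>2 * i l\<close> has valuation \<open>k l + 1\<close>, which is less than that of
    \<open>m l\<close>.\<close>
  define w where "w = nat ((2 * int (i l)) mod int (m l))"
  have intw: "int w = (2 * int (i l)) mod int (m l)" using m_pos[of l] by (simp add: w_def)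
  have w: "w < m l" using intw m_pos[of l] by (metis of_nat_0_less_iff of_nat_less_iff pos_mod_bound)
  have w0: "w \<noteq> 0"
  proof
    assume "w = 0"
    then have "int (m l) dvd 2 * int (i l)" using intw by auto
    then have "m l dvd 2 * i l" by (metis int_dvd_int_iff of_nat_mult of_nat_numeral)
    moreover obtain c where c: "odd c" "i l = 2 ^ k l * c" using odd_multiple by blast
    moreover have "2 ^ (k l + 2) dvd m l" unfolding m_def using assms(2) by (intro le_imp_power_dvd)
    ultimately have "2 ^ (k l + 2) dvd 2 ^ (k l + 1) * c" by (metis dvd_trans mult.assoc power_Suc Suc_eq_plus1)
    then have "2 ^ (k l + 1) * 2 dvd 2 ^ (k l + 1) * c" by simp
    then have "2 dvd c" using dvd_mult_cancel_left[of "2 ^ (k l + 1)" 2 c] by simp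
    then show False using c(1) by simp
  qed
  have "new_gap (m l) (i l) 2 w = 0"
  proof -
    have "(int w - 2 * int (i l)) mod int (m l) = 0"
      unfolding intw by (simp add: mod_diff_left_eq)
    then show ?thesis by (simp add: new_gap_def)
  qed
  then have "flow m i (z(l := w)) (Suc l) = 1" unfolding flow_upd_Suc z(2) using w0 by (simp add: outflow_def)
  then have "z(l := w) \<in> single (Suc l)" using gaps_upd[OF z(1) w] by (simp add: single_def)
  moreover have "finite (single (Suc l))"
    by (rule finite_subset[OF _ finite_gaps[of "{..<Suc l}"]]) (auto simp: single_def)
  ultimately have "0 < card (single (Suc l))" using card_gt_0_iff by blast
  then show ?thesis unfolding rate_def using m_pos by (simp add: prod_pos)
qed

end

lemma measure_pmf_of_set_image:
  assumes "inj_on f A" "finite A" "A \<noteq> {}"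
  shows "measure_pmf.prob (pmf_of_set (f ` A)) {c. P c} = real (card {a \<in> A. P (f a)}) / real (card A)"
proof -
  have "f ` A \<inter> {c. P c} = f ` {a \<in> A. P (f a)}" by auto
  moreover have "inj_on f {a \<in> A. P (f a)}" using assms(1) by (rule inj_on_subset) auto
  ultimately show ?thesis
    using assms by (simp add: measure_pmf_of_set card_image)
qed

section \<open>The law of the mass at level n\<close>

context alternation_level
begin

lemma mm_eq: "l < N \<Longrightarrow> mm l = m l" "l < N \<Longrightarrow> ii l = i l"
  using brkn_less(1)[of l] by (auto simp: mm_def m_def ii_def i_def)

lemma chips_eq:
  assumes "L < N" "t \<le> Suc L"
  shows "chips Z t = flow m i (restrict (gap Z) {..L}) t"
  by (rule flow_cong) (use assms mm_eq in auto)

lemma mass_alive: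
  assumes Z: "admissible Z" and L: "L < N" "0 < chips Z (Suc L)"
  shows "card (branch L) \<le> card (fired Z)"
proof -
  have "card (branch L) = card {u \<in> side_verts (e N) n. hh L u \<in> {i L}}"
    using i_bounds(1)[of L] card_hh[OF L(1), of "{i L}"] by (simp add: branch_def)
  also have "\<dots> \<le> card (fired Z)"
  proof (rule card_mono)
    show "finite (fired Z)" using finite_side_verts by simp
    show "{u \<in> side_verts (e N) n. hh L u \<in> {i L}} \<subseteq> fired Z"
      using fired_alive[OF Z _ L(2)] L(1) mm_eq[OF L(1)] by (auto simp: side_verts_def)
  qed
  finally show ?thesis .
qed

lemma mass_dies:
  assumes Z: "admissible Z" and L: "L < N" and T: "T \<le> Suc L" "dies (restrict (gap Z) {..L}) T"
  shows "card (fired Z) = mass_of T (restrict (gap Z) {..L})"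
proof (cases "T = 1")
  case True
  then have "chips Z 1 = 0" using T chips_eq[OF L, of 1] by (auto simp: dies_def)
  then have "\<not> 0 < firings Z u" if "u \<in> side_verts (e N) n" for u
    using fired_dead_1[OF Z] that by (simp add: side_verts_def)
  then have none: "fired Z = {}" by blast
  show ?thesis unfolding none using True by (simp add: mass_of_def)
next
  case False
  define q where "q = T - 2"
  have q: "T = Suc (Suc q)" using False dies_pos[OF T(2)] unfolding q_def by linarith
  have qL: "Suc q \<le> L" "q < N" "Suc q \<le> N" using q T(1) L by auto
  have c: "0 < chips Z (Suc q)" "chips Z (Suc (Suc q)) = 0"
    using T(2) chips_eq[OF L, of "Suc q" Z] chips_eq[OF L, of "Suc (Suc q)" Z] qL q
    unfolding dies_def by auto
  let ?A = "gap_cycle.arc (mm q) (ii q) (gap Z q)"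
  have g: "gap Z q < m q" using gap_cases(1)[OF Z, of q] qL mm_eq by simp
  have arc: "?A = gap_cycle.arc (m q) (i q) (gap Z q)" using mm_eq[OF qL(2)] by simp
  have "0 \<notin> ?A" unfolding arc arc_eq[OF g] by auto
  have "fired Z = {u \<in> side_verts (e N) n. hh q u \<in> ?A}"
    using fired_dead(1)[OF Z qL(3) c] by (auto simp: side_verts_def)
  then have "card (fired Z) = card (fired_words q (gap Z q))"
    using card_hh[OF qL(2) \<open>0 \<notin> ?A\<close>] arc by (simp add: fired_words_def)
  then show ?thesis using q qL by (simp add: mass_of_def)
qed

lemma restrict_gap_gaps:
  assumes "admissible Z" "L < N"
  shows "restrict (gap Z) {..L} \<in> gaps {..L}"
proof -
  have "gap Z l < m l" if "l \<le> L" for l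
    using gap_cases(1)[OF assms(1), of l] mm_eq(1)[of l] that assms(2) by simp
  then show ?thesis by (simp add: gaps_def)
qed

text \<open>If chips leave cycle \<open>L\<close>, the whole branch at its entry has fired and the
  mass is too large. Otherwise the flow dies within the recorded cycles, and their gaps alone give
  the mass.\<close>

lemma mass_iff_event:
  assumes Z: "admissible Z" and L: "L < N" "M < card (branch L)"
  shows "card (fired Z) = M \<longleftrightarrow> restrict (gap Z) {..L} \<in> event L M"
proof -
  let ?z = "restrict (gap Z) {..L}"
  have zg: "?z \<in> gaps {..L}" by (rule restrict_gap_gaps[OF Z L(1)])
  show ?thesis
  proof (cases "chips Z (Suc L) = 0")
    case False
    have "\<not> dies ?z T" if "T \<le> Suc L" for T
    proof
      assume "dies ?z T"
      then have "chips Z T = 0" using chips_eq[OF L(1) that] by (simp add: dies_def)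
      then have "chips Z (Suc L) = 0" using chips_zero_mono[OF Z that] L(1) by simp
      then show False using False by simp
    qed
    then have "?z \<notin> event L M" by (auto simp: event_def)
    moreover have "M < card (fired Z)"
      using mass_alive[OF Z L(1)] False L(2) by (meson gr0I less_le_trans)
    ultimately show ?thesis by simp
  next
    case True
    define T where "T = (LEAST t. chips Z t = 0)"
    have T: "chips Z T = 0" "T \<le> Suc L" "\<And>t. t < T \<Longrightarrow> 0 < chips Z t"
      unfolding T_def using LeastI[of "\<lambda>t. chips Z t = 0", OF True] Least_le[of "\<lambda>t. chips Z t = 0", OF True]
        not_less_Least by blast+
    have d: "dies ?z T" unfolding dies_def
      using T chips_eq[OF L(1)] by (metis less_imp_le_nat order_trans)
    show ?thesis unfolding mass_dies[OF Z L(1) T(2) d]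
      using d T(2) zg dies_unique by (auto simp: event_def)
  qed
qed

definition chain_part :: "nat \<Rightarrow> (nat \<Rightarrow> nat) \<Rightarrow> digit list set" where
  "chain_part L z = {vx l (z l) | l. l \<le> L \<and> z l \<noteq> 0}"

text \<open>Admissibility only compares vertices with the same key, so the gaps on the chain can be
  replaced freely without touching the others.\<close>

lemma admissible_swap:
  assumes L: "L \<le> N" and Y: "admissible Y" and z: "\<And>l. l \<le> L \<Longrightarrow> z l < mm l"
  defines "Z \<equiv> {w \<in> Y. key w \<notin> \<kappa> ` {..L}} \<union> chain_part L z"
  shows "admissible Z" "l \<le> L \<Longrightarrow> gap Z l = z l"
    "{w \<in> Z. key w \<notin> \<kappa> ` {..L}} = {w \<in> Y. key w \<notin> \<kappa> ` {..L}}"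
proof -
  have v: "vx l (z l) \<in> side_verts (e N) n" "key (vx l (z l)) = \<kappa> l" if "l \<le> L" "z l \<noteq> 0" for l
    using vx_side[of l "z l"] that L z[of l] by auto
  have keyeq: "key w \<in> \<kappa> ` {..L}" if "w \<in> chain_part L z" for w
    using that v by (auto simp: chain_part_def)
  show split: "{w \<in> Z. key w \<notin> \<kappa> ` {..L}} = {w \<in> Y. key w \<notin> \<kappa> ` {..L}}"
    unfolding Z_def using keyeq by blast
  have chain: "w \<in> chain_part L z" if "w \<in> Z" "key w \<in> \<kappa> ` {..L}" for w
    using that unfolding Z_def by blast
  have inj\<kappa>: "inj_on \<kappa> {..L}" using inj_\<kappa> by (rule inj_on_subset) (use L in auto)
  show adm: "admissible Z"
    unfolding admissible_def
  proof
    show "Z \<subseteq> side_verts (e N) n"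
      using Y v unfolding Z_def admissible_def chain_part_def by auto
    show "inj_on key Z"
    proof (rule inj_onI)
      fix a b assume ab: "a \<in> Z" "b \<in> Z" "key a = key b"
      show "a = b"
      proof (cases "key a \<in> \<kappa> ` {..L}")
        case True
        then have "a \<in> chain_part L z" "b \<in> chain_part L z" using chain ab by auto
        then obtain l l' where l: "l \<le> L" "l' \<le> L" "a = vx l (z l)" "b = vx l' (z l')" "z l \<noteq> 0" "z l' \<noteq> 0"
          unfolding chain_part_def by blast
        then have "\<kappa> l = \<kappa> l'" using v ab(3) by metis
        then have "l = l'" using inj\<kappa> l by (auto dest: inj_onD)
        then show ?thesis using l by simp
      next
        case False
        then have "a \<in> {w \<in> Z. key w \<notin> \<kappa> ` {..L}}" "b \<in> {w \<in> Z. key w \<notin> \<kappa> ` {..L}}" using ab by auto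
        then have "a \<in> Y" "b \<in> Y" unfolding split by auto
        then show ?thesis using Y ab(3) by (auto simp: admissible_def dest: inj_onD)
      qed
    qed
  qed
  show "gap Z l = z l" if l: "l \<le> L"
  proof (cases "z l = 0")
    case False
    then have "vx l (z l) \<in> Z" using l unfolding Z_def chain_part_def by blast
    then have "gap Z l \<noteq> 0" "vx l (z l) = vx l (gap Z l)"
      using gap_cases(2)[OF adm, of l "vx l (z l)"] v[OF l False] l L by auto
    then have "hh l (vx l (z l)) = hh l (vx l (gap Z l))" by simp
    then show ?thesis
      using vx_side(3)[of l "z l"] vx_side(3)[of l "gap Z l"] l L z[OF l] False \<open>gap Z l \<noteq> 0\<close> gap_cases(1)[OF adm, of l]
      by simp
  next
    case True
    have "gap Z l = 0"
    proof (rule ccontr)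
      assume "gap Z l \<noteq> 0"
      then have w: "vx l (gap Z l) \<in> Z" "key (vx l (gap Z l)) = \<kappa> l"
        using gap_cases(2)[OF adm, of l "vx l (gap Z l)"] l L by auto
      then have "vx l (gap Z l) \<in> chain_part L z" using chain l by auto
      then obtain l' where l': "l' \<le> L" "z l' \<noteq> 0" "vx l (gap Z l) = vx l' (z l')"
        unfolding chain_part_def by blast
      then have "\<kappa> l = \<kappa> l'" using v w(2) by metis
      then have "l = l'" using inj\<kappa> l l' by (auto dest: inj_onD)
      then show False using l' True by simp
    qed
    then show ?thesis using True by simp
  qed
qed

definition rest_sets :: "nat \<Rightarrow> digit list set set" where
  "rest_sets L = {Y. admissible Y \<and> (\<forall>w\<in>Y. key w \<notin> \<kappa> ` {..L})}"

text \<open>Exchanging the chain part shows that every choice of gaps on cycles \<open>0..L\<close>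
  has equally many completions. A uniform recurrent configuration thus has uniform, independent gaps
  there.\<close>

lemma fiber_card:
  assumes L: "L < N" and z: "z \<in> gaps {..L}"
  shows "card {Z. admissible Z \<and> restrict (gap Z) {..L} = z} = card (rest_sets L)"
proof (rule bij_betw_same_card)
  have zl: "z l < mm l" if "l \<le> L" for l
    using gaps_less[OF z, of l] that mm_eq[of l] L by simp
  have LN: "L \<le> N" using L by simp
  let ?f = "\<lambda>Z. {w \<in> Z. key w \<notin> \<kappa> ` {..L}}" and ?g = "\<lambda>Y. Y \<union> chain_part L z"
  show "bij_betw ?f {Z. admissible Z \<and> restrict (gap Z) {..L} = z} (rest_sets L)"
  proof (rule bij_betw_byWitness[where f' = ?g])
    have key: "key w \<in> \<kappa> ` {..L}" if "w \<in> chain_part L z" for w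
      using that vx_side(2) zl LN unfolding chain_part_def by fastforce
    show "\<forall>Z\<in>{Z. admissible Z \<and> restrict (gap Z) {..L} = z}. ?g (?f Z) = Z"
    proof (rule ballI)
      fix Z assume "Z \<in> {Z. admissible Z \<and> restrict (gap Z) {..L} = z}"
      then have Z: "admissible Z" and "restrict (gap Z) {..L} = z" by auto
      then have gz: "gap Z l = z l" if "l \<le> L" for l using that by (metis atMost_iff restrict_apply')
      have "w \<in> chain_part L z \<longleftrightarrow> w \<in> Z \<and> key w \<in> \<kappa> ` {..L}" for w
      proof -
        have "w \<in> chain_part L z \<longleftrightarrow> (\<exists>l\<le>L. gap Z l \<noteq> 0 \<and> w = vx l (gap Z l))"
          unfolding chain_part_def using gz by auto
        also have "\<dots> \<longleftrightarrow> (\<exists>l\<le>L. w \<in> Z \<and> key w = \<kappa> l)"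
        proof -
          have "gap Z l \<noteq> 0 \<and> w = vx l (gap Z l) \<longleftrightarrow> w \<in> Z \<and> key w = \<kappa> l" if "l \<le> L" for l
            using gap_cases(2)[OF Z, of l w] that LN by simp
          then show ?thesis by blast
        qed
        finally show ?thesis by auto
      qed
      then show "?g (?f Z) = Z" by blast
    qed
    show "\<forall>Y\<in>rest_sets L. ?f (?g Y) = Y"
      using key unfolding rest_sets_def by blast
    show "?f ` {Z. admissible Z \<and> restrict (gap Z) {..L} = z} \<subseteq> rest_sets L"
      unfolding rest_sets_def admissible_def by (auto intro: inj_on_subset)
    show "?g ` rest_sets L \<subseteq> {Z. admissible Z \<and> restrict (gap Z) {..L} = z}"
    proof (rule image_subsetI)
      fix Y assume "Y \<in> rest_sets L"
      then have Y: "admissible Y" "{w \<in> Y. key w \<notin> \<kappa> ` {..L}} = Y" unfolding rest_sets_def by auto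
      have "restrict (gap (?g Y)) {..L} = z"
      proof
        fix l
        show "restrict (gap (?g Y)) {..L} l = z l"
          using admissible_swap(2)[OF LN Y(1) zl, of l] z unfolding Y(2)
          by (auto simp: gaps_def PiE_def extensional_def)
      qed
      moreover have "admissible (?g Y)" using admissible_swap(1)[OF LN Y(1) zl] unfolding Y(2) by simp
      ultimately show "?g Y \<in> {Z. admissible Z \<and> restrict (gap Z) {..L} = z}" by simp
    qed
  qed
qed

lemma finite_admissible: "finite {Z. admissible Z}"
  by (rule finite_subset[of _ "Pow (side_verts (e N) n)"])
    (auto simp: admissible_def finite_side_verts)

lemma card_admissible_event:
  assumes L: "L < N" and E: "E \<subseteq> gaps {..L}"
  shows "card {Z. admissible Z \<and> restrict (gap Z) {..L} \<in> E} = card E * card (rest_sets L)"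
proof -
  have finE: "finite E" using E finite_gaps[of "{..L}"] finite_subset by auto
  have "{Z. admissible Z \<and> restrict (gap Z) {..L} \<in> E} = (\<Union>z\<in>E. {Z. admissible Z \<and> restrict (gap Z) {..L} = z})"
    by auto
  also have "card \<dots> = (\<Sum>z\<in>E. card {Z. admissible Z \<and> restrict (gap Z) {..L} = z})"
    by (rule card_UN_disjoint) (use finE finite_admissible in \<open>auto intro: finite_subset\<close>)
  also have "\<dots> = (\<Sum>z\<in>E. card (rest_sets L))"
    by (rule sum.cong) (use E fiber_card[OF L] in auto)
  finally show ?thesis by simp
qed

lemma H_side: "H_graph \<xi> n = side_graph (e N) n"
  using H_graph_side[of n \<xi>] x_side e_nonzero by (simp add: side_verts_def)

lemma H_recurrent_eq: "H_recurrent \<xi> n = cfg ` {Z. admissible Z}"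
  unfolding H_side using recurrent_configs_eq burnable_eq x_side V_eq by (auto simp: admissible_def)

lemma H_mass_eq: "admissible Z \<Longrightarrow> H_mass \<xi> n (cfg Z) = card (fired Z)"
  unfolding H_side by (rule mass_eq)

lemma H_mass_iff:
  assumes "admissible Z" "L < N" "M < card (branch L)"
  shows "H_mass \<xi> n (cfg Z) = M \<longleftrightarrow> restrict (gap Z) {..L} \<in> event L M"
  unfolding H_mass_eq[OF assms(1)] by (rule mass_iff_event[OF assms])

text \<open>The common number of completions cancels. The formula is exact at every level that
  contains cycle \<open>Suc L\<close>, not only in the limit.\<close>

lemma H_mass_prob_eq:
  assumes L: "L < N" "M < card (branch L)"
  shows "H_mass_prob \<xi> n M = real (card (event L M)) / real (\<Prod>l\<le>L. m l)"
proof -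
  have ev: "event L M \<subseteq> gaps {..L}" by (auto simp: event_def)
  have ne: "admissible {}" by (simp add: admissible_def)
  have inj: "inj_on cfg {Z. admissible Z}"
    using inj_cfg by (rule inj_on_subset) (auto simp: admissible_def)
  have "{Z \<in> {Z. admissible Z}. H_mass \<xi> n (cfg Z) = M} = {Z. admissible Z \<and> restrict (gap Z) {..L} \<in> event L M}"
    using H_mass_iff[OF _ L] by blast
  then have num: "card {Z \<in> {Z. admissible Z}. H_mass \<xi> n (cfg Z) = M} = card (event L M) * card (rest_sets L)"
    using card_admissible_event[OF L(1) ev] by simp
  have "{Z. admissible Z} = {Z. admissible Z \<and> restrict (gap Z) {..L} \<in> gaps {..L}}"
    using restrict_gap_gaps L(1) by blast
  then have den: "card {Z. admissible Z} = (\<Prod>l\<le>L. m l) * card (rest_sets L)"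
    using card_admissible_event[OF L(1) order_refl] card_gaps[of "{..L}"] by simp
  have "0 < card {Z. admissible Z}" using finite_admissible ne card_gt_0_iff by blast
  then have "0 < card (rest_sets L)" using den by simp
  moreover have "H_mass_prob \<xi> n M = real (card {Z \<in> {Z. admissible Z}. H_mass \<xi> n (cfg Z) = M}) / real (card {Z. admissible Z})"
    unfolding H_mass_prob_def H_recurrent_eq
    by (rule measure_pmf_of_set_image[OF inj finite_admissible]) (use ne in auto)
  ultimately show ?thesis unfolding num den by simp
qed

lemma realized_event:
  assumes L: "L < N" "M < card (branch L)" and c: "c \<in> H_recurrent \<xi> n" "H_mass \<xi> n c = M"
  shows "event L M \<noteq> {}"
proof -
  obtain Z where Z: "admissible Z" "c = cfg Z" using c(1) unfolding H_recurrent_eq by blast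
  then have "restrict (gap Z) {..L} \<in> event L M" using H_mass_iff[OF Z(1) L] c(2) by simp
  then show ?thesis by blast
qed

end

section \<open>Almost every boundary point\<close>

text \<open>The wait for the next occurrence of any digit is of smaller order than the position; in
  this form the randomness of \<xi> enters.\<close>

definition dense_digits :: "digit stream \<Rightarrow> bool" where
  "dense_digits \<xi> \<longleftrightarrow> (\<forall>j>0. \<exists>t0. \<forall>t\<ge>t0. \<forall>d. \<exists>s\<in>{t..<t + t div j}. \<xi> !! s = d)"

abbreviation digit_measure :: "digit measure" where
  "digit_measure \<equiv> measure_pmf (pmf_of_set UNIV)"

text \<open>Induction on the length for windows at the start, then on the place of the window; both
  condition on the first digit.\<close>

lemma emeasure_avoiding:
  "emeasure (stream_space digit_measure) {\<xi>. \<forall>s\<in>{t..<t + q}. \<xi> !! s \<noteq> d} = ennreal ((2 / 3) ^ q)"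
proof -
  let ?S = "stream_space digit_measure"
  define A where "A t q = {\<xi> :: digit stream. \<forall>s\<in>{t..<t + q}. \<xi> !! s \<noteq> d}" for t q
  interpret S: prob_space ?S by (rule prob_space.prob_space_stream_space[OF prob_space_measure_pmf])
  have sp: "space ?S = UNIV" by (simp add: space_stream_space)
  have meas: "A t q \<in> sets ?S" for t q
  proof -
    have "{\<xi> \<in> space ?S. \<forall>s\<in>{t..<t + q}. \<xi> !! s \<noteq> d} \<in> sets ?S" by measurable
    then show ?thesis by (simp add: A_def sp)
  qed
  have shift: "{\<xi> \<in> space ?S. x ## \<xi> \<in> A (Suc t) q} = A t q" for x t q
  proof -
    have "x ## \<xi> \<in> A (Suc t) q \<longleftrightarrow> \<xi> \<in> A t q" for \<xi>
    proof -
      have eq: "{Suc t..<Suc t + q} = Suc ` {t..<t + q}" by (simp add: image_Suc_atLeastLessThan)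
      show ?thesis unfolding A_def mem_Collect_eq eq by (simp del: image_Suc_atLeastLessThan)
    qed
    then show ?thesis by (auto simp: sp)
  qed
  have start: "{\<xi> \<in> space ?S. x ## \<xi> \<in> A 0 (Suc q)} = (if x = d then {} else A 0 q)" for x q
  proof -
    have "x ## \<xi> \<in> A 0 (Suc q) \<longleftrightarrow> x \<noteq> d \<and> \<xi> \<in> A 0 q" for \<xi>
    proof -
      have eq: "{0..<0 + Suc q} = insert 0 (Suc ` {0..<q})"
        by (simp add: image_Suc_atLeastLessThan atLeast0_lessThan_Suc_eq_insert_0)
      show ?thesis unfolding A_def mem_Collect_eq eq by (simp del: image_Suc_atLeastLessThan)
    qed
    then show ?thesis by (auto simp: sp)
  qed
  have base: "emeasure ?S (A 0 q) = ennreal ((2 / 3) ^ q)" for q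
  proof (induction q)
    case 0
    have "A 0 0 = space ?S" by (simp add: A_def sp)
    then show ?case using S.emeasure_space_1 by simp
  next
    case (Suc q)
    have "emeasure ?S (A 0 (Suc q)) = (\<integral>\<^sup>+x. emeasure ?S (if x = d then {} else A 0 q) \<partial>digit_measure)"
      unfolding prob_space.emeasure_stream_space[OF prob_space_measure_pmf meas] start ..
    also have "\<dots> = (\<integral>\<^sup>+x. ennreal ((2 / 3) ^ q) * indicator (- {d}) x \<partial>digit_measure)"
      by (intro nn_integral_cong) (auto simp: Suc indicator_def)
    also have "\<dots> = ennreal ((2 / 3) ^ q) * emeasure digit_measure (- {d})"
      by (subst nn_integral_cmult_indicator) auto
    also have "emeasure digit_measure (- {d}) = ennreal (2 / 3)"
    proof -
      have "card (UNIV :: digit set) = 3" "card (- {d}) = 2"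
        by (cases d; simp add: UNIV_digit Compl_eq_Diff_UNIV insert_Diff_if)+
      then show ?thesis
        unfolding measure_pmf.emeasure_eq_measure by (simp add: measure_pmf_of_set)
    qed
    finally show ?case by (simp add: ennreal_mult' [symmetric] mult.commute)
  qed
  have "emeasure ?S (A t q) = ennreal ((2 / 3) ^ q)"
  proof (induction t)
    case (Suc t)
    have "emeasure ?S (A (Suc t) q) = (\<integral>\<^sup>+x. emeasure ?S (A t q) \<partial>digit_measure)"
      unfolding prob_space.emeasure_stream_space[OF prob_space_measure_pmf meas] shift ..
    then show ?case using Suc by simp
  qed (rule base)
  then show ?thesis by (simp add: A_def)
qed

text \<open>\<open>t div j\<close> exceeds \<open>t / j - 1\<close>, so the terms are bounded by a
  geometric sequence of ratio \<open>(2 / 3) powr (1 / j)\<close>; the factor \<open>3 / 2\<close>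
  pays for the rounding.\<close>

lemma summable_window:
  assumes "0 < j"
  shows "summable (\<lambda>t. (2 / 3 :: real) ^ (t div j))"
proof (rule summable_comparison_test)
  define r where "r = (2 / 3 :: real) powr (1 / real j)"
  have r: "0 < r" "r < 1"
    using assms powr_less_mono2[of "1 / real j" "2 / 3" 1] by (auto simp: r_def)
  show "summable (\<lambda>t. (3 / 2) * r ^ t)"
    using r by (intro summable_mult summable_geometric) auto
  have "(2 / 3 :: real) ^ (t div j) \<le> 3 / 2 * r ^ t" for t
  proof -
    have "t < j + t div j * j" using assms by (rule dividend_less_div_times)
    then have "real t \<le> real j + real (t div j) * real j" by (metis less_imp_le of_nat_add of_nat_le_iff of_nat_mult)
    then have "real t / real j \<le> 1 + real (t div j)" using assms by (simp add: field_simps)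
    then have "(2 / 3 :: real) powr real (t div j) \<le> (2 / 3) powr (real t / real j - 1)"
      by (intro powr_mono') auto
    also have "\<dots> = 3 / 2 * r ^ t"
      by (simp add: powr_diff r_def powr_powr flip: powr_realpow)
    finally show ?thesis by (simp add: powr_realpow)
  qed
  then show "\<exists>N. \<forall>t\<ge>N. norm ((2 / 3 :: real) ^ (t div j)) \<le> 3 / 2 * r ^ t" by auto
qed

text \<open>Borel-Cantelli for each of the countably many pairs of \<open>j\<close> and
  \<open>d\<close>: the window at \<open>t\<close> misses \<open>d\<close> with probability
  \<open>(2 / 3) ^ (t div j)\<close>, which is summable over \<open>t\<close>.\<close>

lemma AE_dense_digits: "AE \<xi> in uniform_boundary_measure. dense_digits \<xi>"
proof -
  let ?S = "stream_space digit_measure"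
  have sp: "space ?S = UNIV" by (simp add: space_stream_space)
  have one: "AE \<xi> in ?S. \<exists>t0. \<forall>t\<ge>t0. \<exists>s\<in>{t..<t + t div j}. \<xi> !! s = d" if j: "0 < j" for j d
  proof -
    define A where "A t = {\<xi> :: digit stream. \<forall>s\<in>{t..<t + t div j}. \<xi> !! s \<noteq> d}" for t
    have em: "emeasure ?S (A t) = ennreal ((2 / 3) ^ (t div j))" for t
      unfolding A_def by (rule emeasure_avoiding)
    have "AE \<xi> in ?S. eventually (\<lambda>t. \<xi> \<in> space ?S - A t) sequentially"
    proof (rule borel_cantelli_AE1)
      fix t
      have "{\<xi> \<in> space ?S. \<forall>s\<in>{t..<t + t div j}. \<xi> !! s \<noteq> d} \<in> sets ?S" by measurable
      then show "A t \<in> sets ?S" by (simp add: A_def sp)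
      show "emeasure ?S (A t) < \<infinity>" by (simp add: em)
    next
      show "summable (\<lambda>t. measure ?S (A t))"
        using summable_window[OF j] by (simp add: measure_def em)
    qed
    then show ?thesis
      by (rule AE_mp) (auto simp: eventually_sequentially A_def intro!: AE_I2)
  qed
  have "AE \<xi> in ?S. \<forall>j d. 0 < j \<longrightarrow> (\<exists>t0. \<forall>t\<ge>t0. \<exists>s\<in>{t..<t + t div j}. \<xi> !! s = d)"
  proof (subst AE_all_countable, rule allI)
    fix j :: nat
    have "AE \<xi> in ?S. \<forall>d\<in>UNIV. 0 < j \<longrightarrow> (\<exists>t0. \<forall>t\<ge>t0. \<exists>s\<in>{t..<t + t div j}. \<xi> !! s = d)"
      by (rule AE_finite_allI) (use one in \<open>auto intro: AE_I2\<close>)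
    then show "AE \<xi> in ?S. \<forall>d. 0 < j \<longrightarrow> (\<exists>t0. \<forall>t\<ge>t0. \<exists>s\<in>{t..<t + t div j}. \<xi> !! s = d)" by simp
  qed
  then show ?thesis
    unfolding uniform_boundary_measure_def
  proof (rule AE_mp, intro AE_I2 impI)
    fix \<xi> :: "digit stream"
    assume *: "\<forall>j d. 0 < j \<longrightarrow> (\<exists>t0. \<forall>t\<ge>t0. \<exists>s\<in>{t..<t + t div j}. \<xi> !! s = d)"
    show "dense_digits \<xi>"
      unfolding dense_digits_def
    proof (intro allI impI)
      fix j :: nat assume "0 < j"
      then have "\<forall>d. \<exists>t0. \<forall>t\<ge>t0. \<exists>s\<in>{t..<t + t div j}. \<xi> !! s = d" using * by blast
      then obtain f where f: "\<And>d t. f d \<le> t \<Longrightarrow> \<exists>s\<in>{t..<t + t div j}. \<xi> !! s = d" by metis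
      have "f d \<le> f D0 + f D1 + f D2" for d by (cases d) auto
      then have "\<forall>t\<ge>f D0 + f D1 + f D2. \<forall>d. \<exists>s\<in>{t..<t + t div j}. \<xi> !! s = d"
        using f by (meson order_trans)
      then show "\<exists>t0. \<forall>t\<ge>t0. \<forall>d. \<exists>s\<in>{t..<t + t div j}. \<xi> !! s = d" by blast
    qed
  qed
qed

lemma dense_digits_infinite:
  assumes "dense_digits \<xi>"
  shows "\<exists>s>t. \<xi> !! s = d"
proof -
  obtain t0 where t0: "\<And>t d. t \<ge> t0 \<Longrightarrow> \<exists>s\<in>{t..<t + t div 1}. \<xi> !! s = d"
    using assms unfolding dense_digits_def by (metis zero_less_one)
  obtain s where "s \<in> {max t0 (Suc t)..<max t0 (Suc t) + max t0 (Suc t) div 1}" "\<xi> !! s = d"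
    using t0[of "max t0 (Suc t)" d] by auto
  then show ?thesis by (intro exI[of _ s]) auto
qed

lemma alternation_exists:
  assumes "dense_digits \<xi>"
  shows "\<exists>k. alternation \<xi> k"
proof -
  define nxt where "nxt a = (LEAST t. a < t \<and> \<xi> !! t = opp (\<xi> !! a))" for a
  define k where "k = rec_nat (LEAST t. \<xi> !! t \<noteq> D0) (\<lambda>_. nxt)"
  have k0: "k 0 = (LEAST t. \<xi> !! t \<noteq> D0)" and kS: "k (Suc l) = nxt (k l)" for l by (simp_all add: k_def)
  have nxt: "a < nxt a \<and> \<xi> !! nxt a = opp (\<xi> !! a)" for a
    unfolding nxt_def using dense_digits_infinite[OF assms, of a "opp (\<xi> !! a)"] by (rule LeastI_ex)
  obtain t where "\<xi> !! t = D1" using dense_digits_infinite[OF assms] by blast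
  then have "\<xi> !! t \<noteq> D0" by simp
  then have "\<exists>t. \<xi> !! t \<noteq> D0" by blast
  then have nz0: "\<xi> !! k 0 \<noteq> D0" unfolding k0 by (rule LeastI_ex)
  have nz: "\<xi> !! k l \<noteq> D0" for l by (induction l) (use nz0 nxt kS in auto)
  have "alternation \<xi> k"
  proof
    show "\<xi> !! t = D0" if "t < k 0" for t using not_less_Least that unfolding k0 by blast
    show "\<xi> !! k 0 \<noteq> D0" by (rule nz0)
    show "k l < k (Suc l)" "\<xi> !! k (Suc l) = opp (\<xi> !! k l)" for l using nxt kS by auto
    show "\<xi> !! t \<in> {D0, \<xi> !! k l}" if "k l \<le> t" "t < k (Suc l)" for l t
    proof (cases "t = k l")
      case False
      then have "\<xi> !! t \<noteq> opp (\<xi> !! k l)"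
        using that not_less_Least[of t "\<lambda>t. k l < t \<and> \<xi> !! t = opp (\<xi> !! k l)"] unfolding kS nxt_def by auto
      then show ?thesis using opp_iff[OF nz[of l], of "\<xi> !! t"] by blast
    qed simp
  qed
  then show ?thesis by blast
qed

section \<open>The limits of the mass probabilities and their exponent\<close>

context alternation
begin

lemma k_interval:
  assumes "k 0 \<le> s"
  shows "\<exists>l. k l \<le> s \<and> s < k (Suc l)"
proof -
  define l where "l = (GREATEST l. k l \<le> s)"
  have b: "\<And>l. k l \<le> s \<Longrightarrow> l \<le> s" using k_ge order_trans by blast
  have 1: "k l \<le> s" unfolding l_def by (rule GreatestI_nat[where P = "\<lambda>l. k l \<le> s", OF assms b])
  have "\<not> k (Suc l) \<le> s"
  proof
    assume "k (Suc l) \<le> s"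
    then have "Suc l \<le> l" unfolding l_def by (rule Greatest_le_nat) (rule b)
    then show False by simp
  qed
  then show ?thesis using 1 by auto
qed

lemma level_exists:
  assumes "k (Suc L) < n"
  shows "\<exists>N. alternation_level \<xi> k n N \<and> L < N"
proof -
  have "k 0 \<le> k (Suc L)" using strict_mono_k by (simp add: strict_mono_less_eq)
  then have "k 0 \<le> n - 1" using assms by linarith
  then obtain N where N: "k N \<le> n - 1" "n - 1 < k (Suc N)" using k_interval by blast
  have "k (Suc L) < k (Suc N)" using assms N by linarith
  then have "L < N \<or> L = N" using strict_mono_less[OF strict_mono_k, of "Suc L" "Suc N"] by auto
  moreover have "L \<noteq> N" using assms N by auto
  moreover have "alternation_level \<xi> k n N" by unfold_locales (use N assms in auto)
  ultimately show ?thesis by blast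
qed

lemma H_mass_prob_eventually:
  assumes "M < card (branch L)" "k (Suc L) < n"
  shows "H_mass_prob \<xi> n M = real (card (event L M)) / real (\<Prod>l\<le>L. m l)"
  using level_exists[OF assms(2)] alternation_level.H_mass_prob_eq assms(1) by blast

text \<open>The sequence is constant as soon as \<open>n\<close> exceeds
  \<open>k (Suc L)\<close>.\<close>

lemma H_mass_prob_tendsto:
  assumes "M < card (branch L)"
  shows "(\<lambda>n. H_mass_prob \<xi> n M) \<longlonglongrightarrow> real (card (event L M)) / real (\<Prod>l\<le>L. m l)"
  by (rule tendsto_eventually, rule eventually_sequentiallyI[of "Suc (k (Suc L))"])
    (use H_mass_prob_eventually[OF assms] in simp)

lemma branch_unbounded: "M < card (branch (Suc M))"
  using strict_mono_imp_increasing[OF branch_strict_mono, of "Suc M"] by simp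

text \<open>A realizable mass occurs for arbitrarily large \<open>n\<close>, hence at a level deep
  enough for \<open>mass_iff_event\<close>, where its avalanche must end within the recorded
  cycles.\<close>

lemma realizable_cases:
  assumes "M \<in> realizable_masses \<xi>" "0 < M"
  obtains q y where "0 < y" "y < m q" "y \<noteq> i q" "M = card (fired_words q y)"
    "card (branch q) \<le> M" "M < card (branch (Suc q))"
proof -
  have "\<forall>B. \<exists>n\<ge>B. \<exists>c\<in>H_recurrent \<xi> n. H_mass \<xi> n c = M"
    using assms(1) unfolding realizable_masses_def frequently_sequentially mem_Collect_eq .
  then obtain n where "Suc (k (Suc (Suc M))) \<le> n" and n2: "\<exists>c\<in>H_recurrent \<xi> n. H_mass \<xi> n c = M"
    by blast
  then have n: "k (Suc (Suc M)) < n" by simp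
  obtain N where N: "alternation_level \<xi> k n N" "Suc M < N" using level_exists[OF n] by blast
  have "event (Suc M) M \<noteq> {}"
    using n2 alternation_level.realized_event[OF N branch_unbounded] by blast
  then obtain z where "z \<in> event (Suc M) M" by blast
  from event_cases[OF this assms(2)] show thesis using that by (metis gr0I)
qed

text \<open>The lengths of cycles \<open>q\<close> and \<open>Suc q\<close> contribute the power of
  2. The product of the earlier lengths cancels in the upper bound and turns
  \<open>card (single q)\<close> into \<open>rate q\<close> in the lower one.\<close>

lemma prob_bounds:
  assumes "0 < y" "y < m q" "y \<noteq> i q" "M = card (fired_words q y)"
    "card (branch q) \<le> M" "M < card (branch (Suc q))"
  defines "p \<equiv> lim (\<lambda>n. H_mass_prob \<xi> n M)"
  shows "rate q / 2 ^ (k (Suc q) + k (Suc (Suc q))) \<le> p" "p \<le> 2 / 2 ^ (k (Suc q) + k (Suc (Suc q)))"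
proof -
  define R where "R = real (\<Prod>l<q. m l)"
  have R: "0 < R" unfolding R_def using m_pos by (simp add: prod_pos)
  define D :: real where "D = 2 ^ (k (Suc q) + k (Suc (Suc q)))"
  have D: "0 < D" by (simp add: D_def)
  have prod: "real (\<Prod>l\<le>Suc q. m l) = R * D"
    by (simp add: lessThan_Suc_atMost[symmetric] R_def D_def m_def power_add del: prod.atMost_Suc)
  have p: "p = real (card (event (Suc q) M)) / (R * D)"
    unfolding p_def prod[symmetric] by (rule limI[OF H_mass_prob_tendsto[OF assms(6)]])
  have "real (card (single q)) \<le> real (card (event (Suc q) M))"
    using event_lower[OF assms(1-3)] assms(4) by simp
  then have "real (card (single q)) / (R * D) \<le> p"
    unfolding p using R D by (intro divide_right_mono) auto
  then show "rate q / 2 ^ (k (Suc q) + k (Suc (Suc q))) \<le> p"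
    unfolding rate_def D_def[symmetric] R_def[symmetric] by simp
  have "real (card (event (Suc q) M)) \<le> real (2 * (\<Prod>l<q. m l))"
    using event_upper[OF assms(5,6)] by (rule of_nat_mono)
  then have "real (card (event (Suc q) M)) \<le> 2 * R" by (simp add: R_def)
  then have "p \<le> 2 * R / (R * D)"
    unfolding p using R D by (intro divide_right_mono) auto
  then show "p \<le> 2 / 2 ^ (k (Suc q) + k (Suc (Suc q)))" using R by (simp add: D_def)
qed

text \<open>The window starting at \<open>k q + 1\<close> contains the digit opposite to
  \<open>e q\<close>, which cannot occur before \<open>k (Suc q)\<close>.\<close>

lemma growth:
  assumes "dense_digits \<xi>" "0 < j"
  shows "\<exists>q0. \<forall>q\<ge>q0. k (Suc q) \<le> (k q + 1) + (k q + 1) div j"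
proof -
  obtain t0 where t0: "\<And>t d. t \<ge> t0 \<Longrightarrow> \<exists>s\<in>{t..<t + t div j}. \<xi> !! s = d"
    using assms unfolding dense_digits_def by metis
  have "k (Suc q) \<le> (k q + 1) + (k q + 1) div j" if "t0 \<le> q" for q
  proof -
    have "t0 \<le> k q + 1" using that k_ge[of q] by simp
    then obtain s where s: "k q + 1 \<le> s" "s < (k q + 1) + (k q + 1) div j" "\<xi> !! s = opp (e q)"
      using t0[of "k q + 1" "opp (e q)"] by auto
    have "\<not> s < k (Suc q)"
    proof
      assume "s < k (Suc q)"
      then have "\<xi> !! s \<in> {D0, e q}" using between[of q s] s(1) by simp
      then show False using s(3) e_nonzero[of q] by auto
    qed
    then show ?thesis using s(2) by simp
  qed
  then show ?thesis by blast
qed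

text \<open>Both ratios of successive \<open>k\<close> are close to 1, so the sum is close to
  \<open>2 * k q\<close>. The \<open>- 1\<close> matches the lower bound
  \<open>3 ^ (k q - 1)\<close> for the mass and is absorbed since \<open>k q\<close> tends to
  infinity.\<close>

lemma growth_ratio:
  assumes "dense_digits \<xi>" "0 < (\<eta> :: real)"
  shows "\<exists>q0. \<forall>q\<ge>q0. real (k (Suc q) + k (Suc (Suc q))) \<le> (2 + \<eta>) * (real (k q) - 1)"
proof -
  \<comment> \<open>The limit is \<open>- \<eta>\<close>, so the difference is negative for large
    \<open>j\<close>.\<close>
  have "(\<lambda>j. (1 + 1 / real j) ^ 2 + (1 + 1 / real j) ^ 4 - (2 + \<eta>) * (1 - 1 / real j))
      \<longlonglongrightarrow> (1 + 0) ^ 2 + (1 + 0) ^ 4 - (2 + \<eta>) * (1 - 0)"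
    by (intro tendsto_intros lim_1_over_n)
  then have "\<forall>\<^sub>F j in sequentially. (1 + 1 / real j) ^ 2 + (1 + 1 / real j) ^ 4 - (2 + \<eta>) * (1 - 1 / real j) < 0"
    using assms(2) by (intro order_tendstoD(2)) auto
  then obtain j where j: "0 < j" "(1 + 1 / real j) ^ 2 + (1 + 1 / real j) ^ 4 \<le> (2 + \<eta>) * (1 - 1 / real j)"
    unfolding eventually_sequentially by (metis diff_less_0_iff_less less_imp_le max.cobounded1 max.cobounded2 zero_less_Suc le_SucI max_def)
  define a where "a = 1 + 1 / real j"
  have a: "1 \<le> a" by (simp add: a_def)
  obtain q0 where q0: "\<And>q. q0 \<le> q \<Longrightarrow> k (Suc q) \<le> (k q + 1) + (k q + 1) div j"
    using growth[OF assms(1) j(1)] by blast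
  \<comment> \<open>One factor \<open>a\<close> bounds the window, the other one the replacement of
    \<open>k q + 1\<close> by \<open>k q\<close>.\<close>
  have step1: "real (k (Suc q)) \<le> a ^ 2 * real (k q)" if "max q0 j \<le> q" for q
  proof -
    have jk: "real j \<le> real (k q)" using that k_ge[of q] by simp
    have "real (k (Suc q)) \<le> real ((k q + 1) + (k q + 1) div j)" using q0[of q] that by simp
    also have "\<dots> \<le> (real (k q) + 1) + (real (k q) + 1) / real j"
      using of_nat_div_le_of_nat[of "k q + 1" j, where 'a = real] by (simp add: add.commute)
    also have "\<dots> = a * (real (k q) + 1)" by (simp add: a_def algebra_simps add_divide_distrib)
    also have "\<dots> \<le> a * (a * real (k q))"
    proof (rule mult_left_mono)
      have "1 \<le> real (k q) / real j" using jk j(1) by simp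
      then show "real (k q) + 1 \<le> a * real (k q)" by (simp add: a_def algebra_simps add_divide_distrib)
    qed (use a in simp)
    finally show ?thesis by (simp add: power2_eq_square)
  qed
  have "real (k (Suc q) + k (Suc (Suc q))) \<le> (2 + \<eta>) * (real (k q) - 1)" if q: "max q0 j \<le> q" for q
  proof -
    have "real (k (Suc (Suc q))) \<le> a ^ 2 * real (k (Suc q))" using step1[of "Suc q"] q by simp
    also have "\<dots> \<le> a ^ 2 * (a ^ 2 * real (k q))" using step1[OF q] by (intro mult_left_mono) auto
    also have "\<dots> = a ^ 4 * real (k q)" by (simp add: power_numeral_reduce)
    finally have "real (k (Suc q) + k (Suc (Suc q))) \<le> (a ^ 2 + a ^ 4) * real (k q)"
      using step1[OF q] by (simp add: algebra_simps)
    also have "\<dots> \<le> ((2 + \<eta>) * (1 - 1 / real j)) * real (k q)"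
      using j(2) by (intro mult_right_mono) (auto simp: a_def)
    also have "\<dots> = (2 + \<eta>) * (real (k q) - real (k q) / real j)"
      by (simp add: algebra_simps add_divide_distrib)
    also have "\<dots> \<le> (2 + \<eta>) * (real (k q) - 1)"
    proof (rule mult_left_mono)
      have "real j \<le> real (k q)" using q k_ge[of q] by simp
      then show "real (k q) - real (k q) / real j \<le> real (k q) - 1" using j(1) by simp
    qed (use assms(2) in simp)
    finally show ?thesis .
  qed
  then show ?thesis by blast
qed

text \<open>A digit \<open>D0\<close> is never a break, so one beyond \<open>k 1\<close> lies
  strictly between two breaks, which are then at least 2 apart. This supplies the cycle needed in
  \<open>rate_pos\<close>.\<close>

lemma long_gap:
  assumes "dense_digits \<xi>"
  shows "\<exists>l\<ge>1. k l + 2 \<le> k (Suc l)"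
proof -
  obtain s where s: "k 1 < s" "\<xi> !! s = D0" using dense_digits_infinite[OF assms] by blast
  have "k 0 \<le> s" using s(1) step[of 0] by simp
  then obtain l where l: "k l \<le> s" "s < k (Suc l)" using k_interval by blast
  have "s \<noteq> k l" using s(2) e_nonzero[of l] by auto
  moreover have "l \<noteq> 0" using l(2) s(1) by (metis One_nat_def less_asym')
  ultimately show ?thesis using l by (intro exI[of _ l]) auto
qed

text \<open>In logarithms, \<open>M\<close> is squeezed between \<open>3 ^ (k q - 1)\<close> and
  \<open>3 ^ k (Suc q)\<close>, and the probability is comparable with a power of 2 whose exponent
  is the sum of the next two \<open>k\<close>. The upper bound only uses that \<open>k\<close>
  increases; the lower bound needs \<open>growth_ratio\<close>.\<close>

lemma critical:
  assumes "dense_digits \<xi>"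
  shows "critical_on (realizable_masses \<xi>) (\<lambda>M. lim (\<lambda>n. H_mass_prob \<xi> n M)) (2 * ln 2 / ln 3)"
proof -
  define \<delta> :: real where "\<delta> = 2 * ln 2 / ln 3"
  have \<delta>: "0 < \<delta>" "\<delta> * ln 3 = 2 * ln 2" by (simp_all add: \<delta>_def)
  obtain l where l: "1 \<le> l" "k l + 2 \<le> k (Suc l)" using long_gap[OF assms] by blast
  \<comment> \<open>From \<open>Suc l\<close> on, \<open>rate\<close> stays above half of its value
    there, which gives a constant independent of \<epsilon>.\<close>
  define c where "c = rate (Suc l) / 2"
  have c: "0 < c" using rate_pos[OF l] by (simp add: c_def)
  have rate: "c \<le> rate q" if "Suc l \<le> q" for q
  proof -
    have "rate (Suc l) * (1 / 2) \<le> rate (Suc l) * (1 / 2 + 2 / 2 ^ q)"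
      using rate_pos[OF l] by (intro mult_left_mono) auto
    also have "\<dots> \<le> rate q" using rate_bound[OF _ that] l(1) by simp
    finally show ?thesis by (simp add: c_def)
  qed
  have "\<exists>M0\<ge>1. \<forall>M\<in>realizable_masses \<xi>. real M > M0 \<longrightarrow>
      c * real M powr (- \<delta> - \<epsilon>) \<le> lim (\<lambda>n. H_mass_prob \<xi> n M) \<and>
      lim (\<lambda>n. H_mass_prob \<xi> n M) \<le> 2 * real M powr (- \<delta> + \<epsilon>)" if \<epsilon>: "0 < \<epsilon>" for \<epsilon>
  proof -
    \<comment> \<open>Chosen so that
      \<open>(2 + \<eta>) * ln 2 = (\<delta> + \<epsilon>) * ln 3\<close>.\<close>
    define \<eta> where "\<eta> = \<epsilon> * ln 3 / ln 2"
    have \<eta>: "0 < \<eta>" "\<eta> * ln 2 = \<epsilon> * ln 3" using \<epsilon> by (simp_all add: \<eta>_def)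
    obtain q1 where q1: "\<And>q. q1 \<le> q \<Longrightarrow> real (k (Suc q) + k (Suc (Suc q))) \<le> (2 + \<eta>) * (real (k q) - 1)"
      using growth_ratio[OF assms \<eta>(1)] by blast
    define q2 where "q2 = max q1 (Suc l)"
    show ?thesis
    \<comment> \<open>A mass belonging to cycle \<open>q\<close> is at most
      \<open>3 ^ k (Suc q)\<close>, so a mass above this threshold belongs to a cycle beyond
      \<open>q2\<close>.\<close>
    proof (intro exI[of _ "3 ^ k (Suc q2)"] conjI ballI impI)
      show "(1::real) \<le> 3 ^ k (Suc q2)" by simp
      fix M assume M: "M \<in> realizable_masses \<xi>" "3 ^ k (Suc q2) < real M"
      have M1: "1 \<le> real M" using M(2) by (smt (verit) one_le_power)
      then obtain q y where q: "0 < y" "y < m q" "y \<noteq> i q" "M = card (fired_words q y)"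
        "card (branch q) \<le> M" "M < card (branch (Suc q))"
        using realizable_cases[OF M(1)] by (metis of_nat_0_less_iff zero_less_one less_le_trans)
      have "real M \<le> 3 ^ k (Suc q)" using card_fired_words_le[of q y] q(4)
        by (metis of_nat_le_iff of_nat_numeral of_nat_power)
      then have "(3::real) ^ k (Suc q2) < 3 ^ k (Suc q)" using M(2) by linarith
      then have "k (Suc q2) < k (Suc q)" by (rule power_less_imp_less_exp[rotated]) simp
      then have "q2 < q" using strict_mono_less[OF strict_mono_k] by simp
      then have qq: "q1 \<le> q" "Suc l \<le> q" by (auto simp: q2_def)
      then have kq: "0 < k q" using k_ge[of q] by linarith
      define D :: real where "D = real (k (Suc q) + k (Suc (Suc q)))"
      have expD: "2 ^ (k (Suc q) + k (Suc (Suc q))) = exp (D * ln 2)"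
        unfolding D_def by (metis exp_of_nat_mult exp_ln zero_less_numeral)
      have bounds: "c / exp (D * ln 2) \<le> lim (\<lambda>n. H_mass_prob \<xi> n M)"
        "lim (\<lambda>n. H_mass_prob \<xi> n M) \<le> 2 / exp (D * ln 2)"
      proof -
        have "c / exp (D * ln 2) \<le> rate q / exp (D * ln 2)"
          using rate[OF qq(2)] by (intro divide_right_mono) auto
        then show "c / exp (D * ln 2) \<le> lim (\<lambda>n. H_mass_prob \<xi> n M)"
          using prob_bounds(1)[OF q] expD by simp
        show "lim (\<lambda>n. H_mass_prob \<xi> n M) \<le> 2 / exp (D * ln 2)"
          using prob_bounds(2)[OF q] expD by simp
      qed
      have lnM0: "0 \<le> ln (real M)" using M1 by simp
      have ln_up: "ln (real M) \<le> real (k (Suc q)) * ln 3"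
      proof -
        have "ln (real M) \<le> ln (3 ^ k (Suc q))" using \<open>real M \<le> 3 ^ k (Suc q)\<close> M1 by simp
        then show ?thesis by (simp add: ln_realpow)
      qed
      have ln_low: "(real (k q) - 1) * ln 3 \<le> ln (real M)"
      proof -
        have "3 ^ (k q - 1) \<le> real M"
          using branch_ge[OF kq] q(5) by (metis le_trans of_nat_le_iff of_nat_numeral of_nat_power)
        then have "ln (3 ^ (k q - 1)) \<le> ln (real M)" using M1 by simp
        then show ?thesis using kq by (simp add: ln_realpow of_nat_diff)
      qed
      have "\<delta> * ln (real M) \<le> \<delta> * (real (k (Suc q)) * ln 3)" using ln_up \<delta> by (intro mult_left_mono) auto
      also have "\<dots> = 2 * real (k (Suc q)) * ln 2" using \<delta>(2) by (simp add: algebra_simps)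
      also have "\<dots> \<le> D * ln 2" using step[of "Suc q"] by (simp add: D_def)
      finally have up: "\<delta> * ln (real M) \<le> D * ln 2" .
      have "D * ln 2 \<le> ((2 + \<eta>) * (real (k q) - 1)) * ln 2"
        using q1[OF qq(1)] by (simp add: D_def)
      also have "\<dots> = (real (k q) - 1) * (2 * ln 2 + \<eta> * ln 2)" by (simp add: algebra_simps)
      also have "\<dots> = (\<delta> + \<epsilon>) * ((real (k q) - 1) * ln 3)" unfolding \<eta>(2) \<delta>(2)[symmetric] by (simp add: algebra_simps)
      also have "\<dots> \<le> (\<delta> + \<epsilon>) * ln (real M)" using ln_low \<delta> \<epsilon> by (intro mult_left_mono) auto
      finally have low: "D * ln 2 \<le> (\<delta> + \<epsilon>) * ln (real M)" .
      have "real M powr (- \<delta> - \<epsilon>) \<le> exp (- (D * ln 2))"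
        using low M1 by (simp add: powr_def algebra_simps)
      then have "c * real M powr (- \<delta> - \<epsilon>) \<le> c / exp (D * ln 2)"
        using c by (simp add: exp_minus field_simps)
      then show "c * real M powr (- \<delta> - \<epsilon>) \<le> lim (\<lambda>n. H_mass_prob \<xi> n M)" using bounds(1) by linarith
      have "0 \<le> \<epsilon> * ln (real M)" using \<epsilon> lnM0 by simp
      then have "exp (- (D * ln 2)) \<le> real M powr (- \<delta> + \<epsilon>)"
        using up M1 by (simp add: powr_def algebra_simps)
      then have "2 / exp (D * ln 2) \<le> 2 * real M powr (- \<delta> + \<epsilon>)"
        by (simp add: exp_minus field_simps)
      then show "lim (\<lambda>n. H_mass_prob \<xi> n M) \<le> 2 * real M powr (- \<delta> + \<epsilon>)" using bounds(2) by linarith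
    qed
  qed
  then show ?thesis
    unfolding critical_on_def \<delta>_def[symmetric] using \<delta>(1) c by (metis zero_less_numeral)
qed

end

theorem theorem7p2p1:
  shows "AE \<xi> in uniform_boundary_measure. \<xi> \<in> one_ended_points \<longrightarrow>
    (\<forall>M. convergent (\<lambda>n. H_mass_prob \<xi> n M)) \<and>
    critical_on (realizable_masses \<xi>) (\<lambda>M. lim (\<lambda>n. H_mass_prob \<xi> n M)) (2 * ln 2 / ln 3)"
  using AE_dense_digits
proof (rule AE_mp, intro AE_I2 impI)
  fix \<xi> assume \<xi>: "dense_digits \<xi>"
  then obtain k where "alternation \<xi> k" using alternation_exists by blast
  then interpret alternation \<xi> k .
  show "(\<forall>M. convergent (\<lambda>n. H_mass_prob \<xi> n M)) \<and>
    critical_on (realizable_masses \<xi>) (\<lambda>M. lim (\<lambda>n. H_mass_prob \<xi> n M)) (2 * ln 2 / ln 3)"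
    \<comment> \<open>\<open>branch_unbounded\<close> supplies for every \<open>M\<close> a depth at
      which the limit is known.\<close>
    using critical[OF \<xi>] H_mass_prob_tendsto[OF branch_unbounded] convergentI by blast
qed

end
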